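(* Let $\epsilon,\delta\in(0,1)$ and consider an instance $(\mathcal{X},d)$, $\mathcal{X}=\bigcup_{i=1}^m\mathcal{X}_i$, $k_1,\dots,k_m$ of Fair Max-Min diversification with $|\mathcal{X}|=n$, $k=\sum_i k_i$ and optimal diversity $\ell^*$. Assume $k_i\ge 3\epsilon^{-2}\log(2m)$ for all $i\in[m]$. There is a $\mathrm{poly}(n,k,\delta^{-1})$-time (randomized) algorithm that returns a subset $\mathcal{S}\subseteq\mathcal{X}$ with $\mathrm{div}(\mathcal{S})\ge \ell^*/6$ and which, with probability at least $1-\delta$, includes at least $(1-\epsilon)k_i$ points of each group $\mathcal{X}_i$, $i\in[m]$.
   Context: Fair Max-Min diversification: the input is a finite metric space $(\mathcal{X},d)$ with $|\mathcal{X}|=n$, where $\mathcal{X}=\bigcup_{i=1}^m\mathcal{X}_i$ is partitioned into $m$ disjoint groups, and non-negative integers $k_1,\dots,k_m$ with $k_i\le|\mathcal{X}_i|$. For $\mathcal{S}\subseteq\mathcal{X}$ let $\mathrm{div}(\mathcal{S})=\min_{u,v\in\mathcal{S},u\ne v}d(u,v)$ (the minimum over the empty set is $+\infty$). The optimal diversity is $\ell^*=\max\{\mathrm{div}(\mathcal{S}):\mathcal{S}\subseteq\mathcal{X},\ |\mathcal{S}\cap\mathcal{X}_i|=k_i\ \forall i\in[m]\}$. Here $\log$ is the natural logarithm. *)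

theory Defs
  imports "HOL-Probability.Probability"
begin

section \<open>Fair Max-Min diversification\<close>

text \<open>Groups are indexed by \<open>{..<m}\<close>.\<close>

definition fair_instance ::
  "'a set \<Rightarrow> ('a \<Rightarrow> 'a \<Rightarrow> real) \<Rightarrow> nat \<Rightarrow> (nat \<Rightarrow> 'a set) \<Rightarrow> (nat \<Rightarrow> nat) \<Rightarrow> bool" where
  "fair_instance X d m G k \<longleftrightarrow>
     finite X \<and> Metric_space X d \<and>
     X = (\<Union>i<m. G i) \<and> disjoint_family_on G {..<m} \<and>
     (\<forall>i<m. k i \<le> card (G i))"

text \<open>An infimum in \<^typ>\<open>ereal\<close>, so that it is \<open>\<infinity>\<close> when there is no pair of distinct points.\<close>

definition diversity :: "('a \<Rightarrow> 'a \<Rightarrow> real) \<Rightarrow> 'a set \<Rightarrow> ereal" where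
  "diversity d S = (INF (u, v) \<in> {(u, v). u \<in> S \<and> v \<in> S \<and> u \<noteq> v}. ereal (d u v))"

definition opt_diversity ::
  "'a set \<Rightarrow> ('a \<Rightarrow> 'a \<Rightarrow> real) \<Rightarrow> nat \<Rightarrow> (nat \<Rightarrow> 'a set) \<Rightarrow> (nat \<Rightarrow> nat) \<Rightarrow> ereal" where
  "opt_diversity X d m G k =
     Max (diversity d ` {S. S \<subseteq> X \<and> (\<forall>i<m. card (S \<inter> G i) = k i)})"


section \<open>Randomized real-RAM programs\<close>

text \<open>
  The model of computation is a randomized real RAM, presented as a while language.
  The memory consists of arrays of natural numbers and arrays of reals; a scalar variable is
  entry 0 of an array. Control flow and addresses depend on reals only through comparisons
  (there is no rounding of reals to integers), integer arithmetic is restricted to addition and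
  truncated subtraction, so that integers have at most linearly many bits in the running time,
  and the only constants are natural numbers, so that a program cannot carry an
  infinite amount of advice in a real constant. Randomness comes from fair coin flips.
\<close>

datatype nexp =
    N nat
  | NVar string nexp
  | NPlus nexp nexp
  | NMinus nexp nexp

datatype rexp =
    OfNat nexp
  | RVar string nexp
  | RPlus rexp rexp
  | RMinus rexp rexp
  | RTimes rexp rexp
  | RDivide rexp rexp

datatype bexp =
    NLess nexp nexp
  | RLess rexp rexp
  | BNot bexp
  | BAnd bexp bexp

datatype com =
    SKIP
  | NAssign string nexp nexp
  | RAssign string nexp rexp
  | Flip string nexp
  | Seq com com
  | Cond bexp com com
  | While bexp com

record state =
  nats :: "string \<Rightarrow> nat \<Rightarrow> nat"
  reals :: "string \<Rightarrow> nat \<Rightarrow> real"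

primrec nval :: "nexp \<Rightarrow> state \<Rightarrow> nat" where
  "nval (N n) s = n"
| "nval (NVar a e) s = nats s a (nval e s)"
| "nval (NPlus e1 e2) s = nval e1 s + nval e2 s"
| "nval (NMinus e1 e2) s = nval e1 s - nval e2 s"

primrec rval :: "rexp \<Rightarrow> state \<Rightarrow> real" where
  "rval (OfNat e) s = real (nval e s)"
| "rval (RVar a e) s = reals s a (nval e s)"
| "rval (RPlus e1 e2) s = rval e1 s + rval e2 s"
| "rval (RMinus e1 e2) s = rval e1 s - rval e2 s"
| "rval (RTimes e1 e2) s = rval e1 s * rval e2 s"
| "rval (RDivide e1 e2) s = rval e1 s / rval e2 s"

primrec bval :: "bexp \<Rightarrow> state \<Rightarrow> bool" where
  "bval (NLess e1 e2) s \<longleftrightarrow> nval e1 s < nval e2 s"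
| "bval (RLess e1 e2) s \<longleftrightarrow> rval e1 s < rval e2 s"
| "bval (BNot b) s \<longleftrightarrow> \<not> bval b s"
| "bval (BAnd b1 b2) s \<longleftrightarrow> bval b1 s \<and> bval b2 s"

definition nwrite :: "string \<Rightarrow> nat \<Rightarrow> nat \<Rightarrow> state \<Rightarrow> state" where
  "nwrite a i v s = s\<lparr>nats := (nats s)(a := (nats s a)(i := v))\<rparr>"

definition rwrite :: "string \<Rightarrow> nat \<Rightarrow> real \<Rightarrow> state \<Rightarrow> state" where
  "rwrite a i v s = s\<lparr>reals := (reals s)(a := (reals s a)(i := v))\<rparr>"

text \<open>
  One step of execution costs one unit of time. The expressions evaluated in a step are
  subexpressions of the fixed program text, so this is the usual unit-cost measure up to
  a constant factor.
\<close>

primrec step :: "com \<Rightarrow> state \<Rightarrow> (com \<times> state) pmf" where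
  "step SKIP s = return_pmf (SKIP, s)"
| "step (NAssign a i e) s = return_pmf (SKIP, nwrite a (nval i s) (nval e s) s)"
| "step (RAssign a i e) s = return_pmf (SKIP, rwrite a (nval i s) (rval e s) s)"
| "step (Flip a i) s =
     map_pmf (\<lambda>b. (SKIP, nwrite a (nval i s) (of_bool b) s)) (bernoulli_pmf (1 / 2))"
| "step (Seq c1 c2) s =
     (if c1 = SKIP then return_pmf (c2, s)
      else map_pmf (\<lambda>(c1', s'). (Seq c1' c2, s')) (step c1 s))"
| "step (Cond b c1 c2) s = return_pmf (if bval b s then c1 else c2, s)"
| "step (While b c) s = return_pmf (if bval b s then Seq c (While b c) else SKIP, s)"

text \<open>A terminated program \<^const>\<open>SKIP\<close> stays put.\<close>

primrec run :: "nat \<Rightarrow> com \<times> state \<Rightarrow> (com \<times> state) pmf" where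
  "run 0 cfg = return_pmf cfg"
| "run (Suc t) cfg = bind_pmf (step (fst cfg) (snd cfg)) (run t)"

definition halts_within :: "nat \<Rightarrow> com \<Rightarrow> state \<Rightarrow> bool" where
  "halts_within t P s \<longleftrightarrow> (\<forall>cfg \<in> set_pmf (run t (P, s)). fst cfg = SKIP)"

lemma run_SKIP: "run t (SKIP, s) = return_pmf (SKIP, s)"
  by (induction t) (simp_all add: bind_return_pmf)

lemma run_add: "run (t + u) cfg = bind_pmf (run t cfg) (run u)"
proof (induction t arbitrary: cfg)
  case 0
  show ?case by (simp add: bind_return_pmf)
next
  case (Suc t)
  then have "run (t + u) = (\<lambda>cfg. bind_pmf (run t cfg) (run u))" by blast
  then show ?case by (simp add: bind_assoc_pmf)
qed

lemma run_after_halt: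
  assumes "halts_within t P s" "t \<le> t'"
  shows "run t' (P, s) = run t (P, s)"
proof -
  have "run t' (P, s) = bind_pmf (run t (P, s)) (run (t' - t))"
    using run_add[of t "t' - t" "(P, s)"] assms(2) by simp
  also have "\<dots> = bind_pmf (run t (P, s)) return_pmf"
    using assms(1) unfolding halts_within_def
    by (intro bind_pmf_cong refl) (metis prod.collapse run_SKIP)
  finally show ?thesis by (simp add: bind_return_pmf')
qed


section \<open>Input and output conventions\<close>

text \<open>
  The points are presented by an enumeration \<open>xs\<close> without repetitions, and are known to a program
  only through their positions in it. Distances are stored in row-major order. Memory not
  used for the input is 0.
\<close>

definition input_state ::
  "'a list \<Rightarrow> ('a \<Rightarrow> 'a \<Rightarrow> real) \<Rightarrow> nat \<Rightarrow> (nat \<Rightarrow> 'a set) \<Rightarrow> (nat \<Rightarrow> nat) \<Rightarrow>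
   real \<Rightarrow> real \<Rightarrow> state" where
  "input_state xs d m G k \<epsilon> \<delta> =
    (let n = length xs in
     \<lparr> nats = (\<lambda>_ _. 0)
         (''n'' := (\<lambda>_. 0)(0 := n),
          ''m'' := (\<lambda>_. 0)(0 := m),
          ''k'' := (\<lambda>i. if i < m then k i else 0),
          ''group'' := (\<lambda>j. if j < n then (THE i. i < m \<and> xs ! j \<in> G i) else 0)),
       reals = (\<lambda>_ _. 0)
         (''d'' := (\<lambda>p. if p < n * n then d (xs ! (p div n)) (xs ! (p mod n)) else 0),
          ''eps'' := (\<lambda>_. 0)(0 := \<epsilon>),
          ''delta'' := (\<lambda>_. 0)(0 := \<delta>)) \<rparr>)"

text \<open>The output is read off as an indicator vector.\<close>

definition output_set :: "'a list \<Rightarrow> state \<Rightarrow> 'a set" where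
  "output_set xs s = {xs ! j | j. j < length xs \<and> nats s ''out'' j \<noteq> 0}"

definition output_pmf :: "nat \<Rightarrow> com \<Rightarrow> 'a list \<Rightarrow> state \<Rightarrow> 'a set pmf" where
  "output_pmf t P xs s = map_pmf (\<lambda>cfg. output_set xs (snd cfg)) (run t (P, s))"

end

theory Submission
  imports Defs
begin

text \<open>
  The algorithm is deterministic. For every candidate diversity \<open>\<gamma>\<close> among the distances, each group
  is thinned to a maximal \<open>\<gamma>/3\<close>-separated subset. If \<open>\<gamma>\<close> is the optimal diversity, moving the optimal
  points into these subsets keeps them more than \<open>\<gamma>/3\<close> apart, so that open balls of radius \<open>\<gamma>/6\<close>
  contain at most one of them; hence the linear program asking for mass \<open>k i\<close> in group \<open>i\<close> and mass
  at most 1 in each such ball is feasible. A projected subgradient method with integer multipliers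
  and \<open>n^8\<close> steps solves it up to a relative error \<open>1 / n^2\<close>.

  To round, let the points ring at independent exponential times with rates \<open>x\<close> and select a
  point if it rings first in its ball. By the thinning a ball contains at most one point of
  each group, so the selections within a group are independent and Chernoff's bound applies, the
  expected number of selected points being almost \<open>k i\<close>. The exponential moments in its proof can be
  computed exactly and form a supermartingale, and the rounding is derandomized by selecting
  points that do not increase it. Finally the largest \<open>\<gamma>\<close> for which the group sizes are met is kept.
\<close>

section \<open>Bounded loop programs\<close>

text \<open>The time bound is structural: every loop runs over \<open>{..<n}\<close> with
  \<open>n\<close> fixed, so such a program is polynomial by induction on its syntax, and the steps
  of the concrete program are never counted. The price is that groups, too, are scanned up to
  \<open>n\<close>.

  Unit step length keeps the multipliers integral. One step raises the sum of their squares by at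
  most 2 * n^3, so this sum is at most n^12 after n^8 steps. A multiplier dominates the accumulated
  violation of its constraint, so violations are at most n^6 against n^8 steps, which costs at most
  1/2 in the expected number of selected points of a group. With an exact solution, Chernoff's bound
  would ask for \<epsilon>^2 * k i > 2 ln m; the assumption grants 3 ln (2 m), and the surplus pays
  the factor exp (\<epsilon> / 2) caused by that 1/2.

  A guess \<gamma> may be infeasible. The separation of the output does not depend on feasibility,
  the group sizes do; hence the program counts them itself and accepts a guess on this evidence
  alone.\<close>

datatype lcom =
    SetN string nexp nexp
  | SetR string nexp rexp
  | Then lcom lcom (infixr \<open>;;\<close> 60)
  | IfB bexp lcom lcom
  | For string lcom

abbreviation Var :: "string \<Rightarrow> nexp" where
  "Var v \<equiv> NVar v (N 0)"

text \<open>There is no empty statement, so the missing branch is a dummy write; hence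
  \<open>''skip''\<close> in so many sets of modified names.\<close>

abbreviation When :: "bexp \<Rightarrow> lcom \<Rightarrow> lcom" where
  "When b c \<equiv> IfB b c (SetN ''skip'' (N 0) (N 0))"

primrec compile :: "lcom \<Rightarrow> com" where
  "compile (SetN a i e) = NAssign a i e"
| "compile (SetR a i e) = RAssign a i e"
| "compile (c1 ;; c2) = Seq (compile c1) (compile c2)"
| "compile (IfB b c1 c2) = Cond b (compile c1) (compile c2)"
| "compile (For v c) =
     Seq (NAssign v (N 0) (N 0))
       (While (NLess (Var v) (Var ''n''))
         (Seq (compile c) (NAssign v (N 0) (NPlus (Var v) (N 1)))))"

text \<open>The state before iteration \<open>j\<close>, with the counter already at
  \<open>j\<close>. The counter is written outright instead of being incremented; the two agree
  because \<open>wf_lcom\<close> keeps the body from touching it.\<close>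

primrec loop :: "string \<Rightarrow> (state \<Rightarrow> state) \<Rightarrow> state \<Rightarrow> nat \<Rightarrow> state" where
  "loop v f s 0 = nwrite v 0 0 s"
| "loop v f s (Suc j) = nwrite v 0 (Suc j) (f (loop v f s j))"

primrec den :: "lcom \<Rightarrow> state \<Rightarrow> state" where
  "den (SetN a i e) s = nwrite a (nval i s) (nval e s) s"
| "den (SetR a i e) s = rwrite a (nval i s) (rval e s) s"
| "den (c1 ;; c2) s = den c2 (den c1 s)"
| "den (IfB b c1 c2) s = (if bval b s then den c1 s else den c2 s)"
| "den (For v c) s = loop v (den c) s (nats s ''n'' 0)"

primrec mods :: "lcom \<Rightarrow> string set" where
  "mods (SetN a i e) = {a}"
| "mods (SetR a i e) = {a}"
| "mods (c1 ;; c2) = mods c1 \<union> mods c2"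
| "mods (IfB b c1 c2) = mods c1 \<union> mods c2"
| "mods (For v c) = insert v (mods c)"

primrec wf_lcom :: "lcom \<Rightarrow> bool" where
  "wf_lcom (SetN a i e) \<longleftrightarrow> a \<noteq> ''n''"
| "wf_lcom (SetR a i e) \<longleftrightarrow> True"
| "wf_lcom (c1 ;; c2) \<longleftrightarrow> wf_lcom c1 \<and> wf_lcom c2"
| "wf_lcom (IfB b c1 c2) \<longleftrightarrow> wf_lcom c1 \<and> wf_lcom c2"
| "wf_lcom (For v c) \<longleftrightarrow> v \<noteq> ''n'' \<and> v \<notin> mods c \<and> wf_lcom c"

lemma write_sel [simp]:
  "nats (nwrite a i x s) b = (if b = a then (nats s a)(i := x) else nats s b)"
  "reals (nwrite a i x s) = reals s"
  "reals (rwrite a i y s) b = (if b = a then (reals s a)(i := y) else reals s b)"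
  "nats (rwrite a i y s) = nats s"
  by (simp_all add: nwrite_def rwrite_def)

lemma den_frame:
  "a \<notin> mods c \<Longrightarrow> nats (den c s) a = nats s a \<and> reals (den c s) a = reals s a"
proof (induction c arbitrary: s)
  case (For v c)
  have "nats (loop v (den c) s j) a = nats s a \<and> reals (loop v (den c) s j) a = reals s a" for j
    using For by (induction j) auto
  then show ?case by simp
qed auto

lemma wf_lcom_size: "wf_lcom c \<Longrightarrow> nats (den c s) ''n'' = nats s ''n''"
proof (induction c arbitrary: s)
  case (For v c)
  have "nats (loop v (den c) s j) ''n'' = nats s ''n''" for j
    using For by (induction j) auto
  then show ?case by simp
qed auto

section \<open>Deterministic executions of compiled programs and their polynomial length\<close>

inductive steps :: "nat \<Rightarrow> com \<Rightarrow> state \<Rightarrow> com \<Rightarrow> state \<Rightarrow> bool" where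
  steps_0: "steps 0 c s c s"
| steps_Suc: "c \<noteq> SKIP \<Longrightarrow> step c s = return_pmf (c1, s1) \<Longrightarrow> steps t c1 s1 c2 s2 \<Longrightarrow>
    steps (Suc t) c s c2 s2"

lemma steps_run: "steps t c s c' s' \<Longrightarrow> run t (c, s) = return_pmf (c', s')"
  by (induction rule: steps.induct) (simp_all add: bind_return_pmf)

lemma steps_trans: "steps t c s c' s' \<Longrightarrow> steps u c' s' c'' s'' \<Longrightarrow> steps (t + u) c s c'' s''"
  by (induction rule: steps.induct) (auto intro: steps_Suc)

lemma steps_1: "c \<noteq> SKIP \<Longrightarrow> step c s = return_pmf (c1, s1) \<Longrightarrow> steps 1 c s c1 s1"
  using steps_Suc[OF _ _ steps_0] by simp

text \<open>This relies on \<open>steps_Suc\<close> forbidding steps from \<open>SKIP\<close>: an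
  idle step of \<open>SKIP\<close> would not lift, as \<open>Seq SKIP d\<close> moves on to
  \<open>d\<close>.\<close>

lemma steps_Seq: "steps t c s c' s' \<Longrightarrow> steps t (Seq c d) s (Seq c' d) s'"
  by (induction rule: steps.induct) (auto intro: steps_0 steps_Suc)

lemma steps_Seq_SKIP:
  assumes "steps t c s SKIP s'" "steps u d s' e s''"
  shows "steps (t + (1 + u)) (Seq c d) s e s''"
  by (rule steps_trans[OF steps_Seq[OF assms(1)]], rule steps_trans[OF _ assms(2)], rule steps_1) auto

text \<open>Induction downwards from the exit of the loop. Besides its body an iteration costs 4
  steps: the test, the increment and the removal of two finished \<open>SKIP\<close>s. The final 1
  is the failing test.\<close>

lemma steps_While:
  fixes v c
  defines "W \<equiv> While (NLess (Var v) (Var ''n''))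
    (Seq (compile c) (NAssign v (N 0) (NPlus (Var v) (N 1))))"
  assumes wf: "wf_lcom (For v c)"
    and n: "nats s ''n'' 0 = n"
    and body: "\<And>s'. nats s' ''n'' 0 = n \<Longrightarrow> \<exists>t\<le>B. steps t (compile c) s' SKIP (den c s')"
    and j: "j \<le> n"
  shows "\<exists>t\<le>(n - j) * (B + 4) + 1.
    steps t W (loop v (den c) s j) SKIP (loop v (den c) s n)"
  using j
proof (induction j rule: inc_induct)
  case base
  have "nats (loop v (den c) s n) ''n'' = nats s ''n''" "nats (loop v (den c) s n) v 0 = n"
    using wf_lcom_size[OF wf, of s] n by (simp_all, cases n) auto
  then have "step W (loop v (den c) s n) = return_pmf (SKIP, loop v (den c) s n)"
    using n by (simp add: W_def)
  then have "steps 1 W (loop v (den c) s n) SKIP (loop v (den c) s n)"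
    by (intro steps_1) (simp_all add: W_def)
  then show ?case by (intro exI[of _ 1]) simp
next
  case (step j)
  let ?s = "loop v (den c) s j"
  have n': "nats (loop v (den c) s i) ''n'' = nats s ''n''" for i
    using wf by (induction i) (auto simp: wf_lcom_size)
  have vj: "nats ?s v 0 = j" by (cases j) auto
  obtain t where t: "t \<le> B" "steps t (compile c) ?s SKIP (den c ?s)"
    using body[of ?s] n n' by auto
  have vj': "nats (den c ?s) v 0 = j"
    using den_frame[of v c ?s] wf vj by simp
  obtain u where u: "u \<le> (n - Suc j) * (B + 4) + 1"
    "steps u W (loop v (den c) s (Suc j)) SKIP (loop v (den c) s n)"
    using step.IH by blast
  have "steps 1 W ?s (Seq (Seq (compile c) (NAssign v (N 0) (NPlus (Var v) (N 1)))) W) ?s"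
    using n n' vj step.hyps by (intro steps_1) (auto simp: W_def)
  moreover have "steps (t + (1 + 1)) (Seq (compile c) (NAssign v (N 0) (NPlus (Var v) (N 1)))) ?s
      SKIP (loop v (den c) s (Suc j))"
    using vj' by (intro steps_Seq_SKIP[OF t(2)] steps_1) auto
  ultimately have "steps (1 + (t + (1 + 1) + (1 + u))) W ?s SKIP (loop v (den c) s n)"
    using steps_Seq_SKIP[OF _ u(2)] steps_trans by blast
  moreover have "1 + (t + (1 + 1) + (1 + u)) \<le> (n - j) * (B + 4) + 1"
  proof -
    have "n - j = Suc (n - Suc j)" using step.hyps by simp
    then show ?thesis using t(1) u(1) by simp
  qed
  ultimately show ?case by blast
qed

text \<open>The bound refers to the initial size, which a well-formed program never changes, so it
  can be reused for later parts and for every iteration. The base \<open>n + 1\<close> makes powers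
  monotone in the exponent; exponents add under sequencing and grow by one per loop.\<close>

lemma compile_correct:
  "wf_lcom c \<Longrightarrow> \<exists>C p. \<forall>s :: state. \<exists>t \<le> C * (nats s ''n'' 0 + 1) ^ p. steps t (compile c) s SKIP (den c s)"
proof (induction c)
  case (SetN a i e)
  have "steps 1 (compile (SetN a i e)) s SKIP (den (SetN a i e) s)" for s
    by (rule steps_1) auto
  then show ?case by (intro exI[of _ 1] exI[of _ 0]) auto
next
  case (SetR a i e)
  have "steps 1 (compile (SetR a i e)) s SKIP (den (SetR a i e) s)" for s
    by (rule steps_1) auto
  then show ?case by (intro exI[of _ 1] exI[of _ 0]) auto
next
  case (Then c1 c2)
  obtain C1 p1 where 1: "\<And>s :: state. \<exists>t \<le> C1 * (nats s ''n'' 0 + 1) ^ p1. steps t (compile c1) s SKIP (den c1 s)"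
    using Then by auto
  obtain C2 p2 where 2: "\<And>s :: state. \<exists>t \<le> C2 * (nats s ''n'' 0 + 1) ^ p2. steps t (compile c2) s SKIP (den c2 s)"
    using Then by auto
  show ?case
  proof (rule exI[of _ "C1 + C2 + 1"], rule exI[of _ "p1 + p2"], rule allI)
    fix s :: state
    let ?n = "nats s ''n'' 0 + 1"
    obtain t where t: "t \<le> C1 * ?n ^ p1" "steps t (compile c1) s SKIP (den c1 s)"
      using 1 by blast
    have "nats (den c1 s) ''n'' = nats s ''n''" using Then by (auto simp: wf_lcom_size)
    then obtain u where u: "u \<le> C2 * ?n ^ p2" "steps u (compile c2) (den c1 s) SKIP (den c2 (den c1 s))"
      using 2[of "den c1 s"] by auto
    have "t \<le> C1 * ?n ^ (p1 + p2)"
      using t(1) by (rule order_trans) (intro mult_left_mono power_increasing, auto)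
    moreover have "u \<le> C2 * ?n ^ (p1 + p2)"
      using u(1) by (rule order_trans) (intro mult_left_mono power_increasing, auto)
    moreover have "1 \<le> ?n ^ (p1 + p2)" by simp
    ultimately have "t + (1 + u) \<le> (C1 + C2 + 1) * ?n ^ (p1 + p2)"
      unfolding distrib_right mult_1 by linarith
    then show "\<exists>t \<le> (C1 + C2 + 1) * ?n ^ (p1 + p2).
        steps t (compile (c1 ;; c2)) s SKIP (den (c1 ;; c2) s)"
      using steps_Seq_SKIP[OF t(2) u(2)] by (intro exI[of _ "t + (1 + u)"]) simp
  qed
next
  case (IfB b c1 c2)
  obtain C1 p1 where 1: "\<And>s :: state. \<exists>t \<le> C1 * (nats s ''n'' 0 + 1) ^ p1. steps t (compile c1) s SKIP (den c1 s)"
    using IfB by auto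
  obtain C2 p2 where 2: "\<And>s :: state. \<exists>t \<le> C2 * (nats s ''n'' 0 + 1) ^ p2. steps t (compile c2) s SKIP (den c2 s)"
    using IfB by auto
  show ?case
  proof (rule exI[of _ "C1 + C2 + 1"], rule exI[of _ "p1 + p2"], rule allI)
    fix s :: state
    let ?n = "nats s ''n'' 0 + 1"
    obtain t where t: "t \<le> C1 * ?n ^ p1" "steps t (compile c1) s SKIP (den c1 s)"
      using 1 by blast
    obtain u where u: "u \<le> C2 * ?n ^ p2" "steps u (compile c2) s SKIP (den c2 s)"
      using 2 by blast
    have "t \<le> C1 * ?n ^ (p1 + p2)"
      using t(1) by (rule order_trans) (intro mult_left_mono power_increasing, auto)
    moreover have "u \<le> C2 * ?n ^ (p1 + p2)"
      using u(1) by (rule order_trans) (intro mult_left_mono power_increasing, auto)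
    moreover have "1 \<le> ?n ^ (p1 + p2)" by simp
    ultimately have le: "1 + t \<le> (C1 + C2 + 1) * ?n ^ (p1 + p2)" "1 + u \<le> (C1 + C2 + 1) * ?n ^ (p1 + p2)"
      unfolding distrib_right mult_1 by linarith+
    have "steps 1 (compile (IfB b c1 c2)) s (if bval b s then compile c1 else compile c2) s"
      by (rule steps_1) auto
    then have "steps (1 + (if bval b s then t else u)) (compile (IfB b c1 c2)) s SKIP (den (IfB b c1 c2) s)"
      by (rule steps_trans) (use t(2) u(2) in auto)
    then show "\<exists>t \<le> (C1 + C2 + 1) * ?n ^ (p1 + p2).
        steps t (compile (IfB b c1 c2)) s SKIP (den (IfB b c1 c2) s)"
      using le by (intro exI[of _ "1 + (if bval b s then t else u)"]) auto
  qed
next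
  case (For v c)
  obtain C p where C: "\<And>s :: state. \<exists>t \<le> C * (nats s ''n'' 0 + 1) ^ p. steps t (compile c) s SKIP (den c s)"
    using For by auto
  show ?case
  proof (rule exI[of _ "C + 7"], rule exI[of _ "p + 1"], rule allI)
    fix s :: state
    let ?n = "nats s ''n'' 0"
    let ?B = "C * (?n + 1) ^ p"
    obtain t where t: "t \<le> ?n * (?B + 4) + 1"
      "steps t (While (NLess (Var v) (Var ''n'')) (Seq (compile c) (NAssign v (N 0) (NPlus (Var v) (N 1)))))
        (nwrite v 0 0 s) SKIP (den (For v c) s)"
      using steps_While[OF For.prems refl, of s ?B 0] C by auto metis
    have *: "steps 1 (NAssign v (N 0) (N 0)) s SKIP (nwrite v 0 0 s)"
      by (rule steps_1) auto
    \<comment> \<open>The 3 collects the initialisation of the counter, the removal of its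
      \<open>SKIP\<close> and the exit test; with the 4 of each iteration it gives the 7 in the
      constant.\<close>
    have "1 + (1 + t) \<le> ?n * (?B + 4) + 3"
      using t(1) by simp
    also have "\<dots> \<le> (?n + 1) * (C * (?n + 1) ^ p + 7 * (?n + 1) ^ p)"
    proof -
      have "(1::nat) \<le> (?n + 1) ^ p" by simp
      then have "?B + 4 + 3 \<le> C * (?n + 1) ^ p + 7 * (?n + 1) ^ p" by linarith
      then have "(?n + 1) * (?B + 4 + 3) \<le> (?n + 1) * (C * (?n + 1) ^ p + 7 * (?n + 1) ^ p)"
        by (rule mult_left_mono) simp
      then show ?thesis by (simp add: algebra_simps)
    qed
    also have "\<dots> = (C + 7) * (?n + 1) ^ (p + 1)" by (simp add: algebra_simps)
    finally show "\<exists>t \<le> (C + 7) * (?n + 1) ^ (p + 1). steps t (compile (For v c)) s SKIP (den (For v c) s)"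
      using steps_Seq_SKIP[OF * t(2)] by auto
  qed
qed

text \<open>\<open>indep\<close> accounts for the write to the counter that ends each iteration. The
  step may assume that all names outside \<open>mods\<close> still have their values from before the
  loop, so invariants need not carry them.\<close>

lemma For_rule:
  assumes n: "nats s ''n'' 0 = n" and wf: "wf_lcom (For v c)"
    and init: "I 0 s"
    and step: "\<And>j s'. \<lbrakk>j < n; I j s'; nats s' v 0 = j;
        \<And>a. a \<notin> mods (For v c) \<Longrightarrow> nats s' a = nats s a;
        \<And>a. a \<notin> mods (For v c) \<Longrightarrow> reals s' a = reals s a;
        nats s' ''n'' = nats s ''n''\<rbrakk> \<Longrightarrow> I (Suc j) (den c s')"
    and indep: "\<And>j s' x. I j s' \<Longrightarrow> I j (nwrite v 0 x s')"
  shows "I n (den (For v c) s)"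
proof -
  have "j \<le> n \<Longrightarrow> I j (loop v (den c) s j) \<and> nats (loop v (den c) s j) v 0 = j \<and>
      (\<forall>a. a \<notin> mods (For v c) \<longrightarrow> nats (loop v (den c) s j) a = nats s a) \<and>
      (\<forall>a. a \<notin> mods (For v c) \<longrightarrow> reals (loop v (den c) s j) a = reals s a) \<and>
      nats (loop v (den c) s j) ''n'' = nats s ''n''" for j
  proof (induction j)
    case 0
    then show ?case using init indep wf by auto
  next
    case (Suc j)
    then show ?case
      using step[of j "loop v (den c) s j"] indep wf wf_lcom_size[of c]
      by (auto simp: den_frame)
  qed
  then show ?thesis using n by simp
qed

section \<open>Fractional solutions by projected subgradients\<close>

text \<open>Points are positions in the enumeration. Loops over groups also end at \<open>n\<close>:
  \<open>m_le\<close> lets them reach every group, and \<open>k_0\<close> makes the surplus indices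
  demand nothing.\<close>

locale fair_indices =
  fixes n m :: nat and g k :: "nat \<Rightarrow> nat" and D :: "nat \<Rightarrow> nat \<Rightarrow> real" and \<epsilon> :: real
  assumes n_ge: "3 \<le> n" and m_pos: "0 < m" and m_le: "m \<le> n"
    and g_less: "j < n \<Longrightarrow> g j < m"
    and k_le: "k i \<le> n" and k_0: "m \<le> i \<Longrightarrow> k i = 0"
    and k_ge: "i < m \<Longrightarrow> 3 / \<epsilon>^2 * ln (2 * real m) \<le> real (k i)"
    and eps: "0 < \<epsilon>" "\<epsilon> < 1"
    and D_self: "u < n \<Longrightarrow> D u u = 0"
    and D_pos: "\<lbrakk>u < n; v < n; u \<noteq> v\<rbrakk> \<Longrightarrow> 0 < D u v"
    and D_sym: "\<lbrakk>u < n; v < n\<rbrakk> \<Longrightarrow> D u v = D v u"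
    and D_tri: "\<lbrakk>u < n; v < n; w < n\<rbrakk> \<Longrightarrow> D u w \<le> D u v + D v w"
begin

section \<open>Thinning the groups to nets\<close>

definition close :: "real \<Rightarrow> nat \<Rightarrow> nat \<Rightarrow> bool" where
  "close \<gamma> p j \<longleftrightarrow> 6 * D p j < \<gamma>"

text \<open>A recursion along the indices, so it determines \<open>Z\<close> below \<open>n\<close>:
  the greedy maximal \<gamma>/3-separated subset of each group. A rejected point has an accepted one
  of its group closer than that.\<close>

definition is_net :: "real \<Rightarrow> (nat \<Rightarrow> bool) \<Rightarrow> bool" where
  "is_net \<gamma> Z \<longleftrightarrow> (\<forall>j<n. Z j \<longleftrightarrow> \<not> (\<exists>l<j. Z l \<and> g l = g j \<and> 3 * D j l < \<gamma>))"

definition feasible :: "real \<Rightarrow> bool" where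
  "feasible \<gamma> \<longleftrightarrow> (\<exists>Q\<subseteq>{..<n}. (\<forall>i<m. card {j\<in>Q. g j = i} = k i) \<and>
     (\<forall>u\<in>Q. \<forall>v\<in>Q. u \<noteq> v \<longrightarrow> \<gamma> \<le> D u v))"

lemma close_sym: "u < n \<Longrightarrow> v < n \<Longrightarrow> close \<gamma> u v = close \<gamma> v u"
  by (simp add: close_def D_sym)

lemma close_self: "0 < \<gamma> \<Longrightarrow> u < n \<Longrightarrow> close \<gamma> u u"
  by (simp add: close_def D_self)

lemma net_separated:
  assumes "is_net \<gamma> Z" "Z u" "Z v" "u \<noteq> v" "u < n" "v < n" "g u = g v"
  shows "\<gamma> \<le> 3 * D u v"
proof -
  have *: "\<gamma> \<le> 3 * D a b" if "Z a" "Z b" "b < a" "a < n" "b < n" "g a = g b" for a b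
    using assms(1) that unfolding is_net_def by (metis not_le)
  show ?thesis
    using *[of u v] *[of v u] assms D_sym[of u v] by (cases "u < v") auto
qed

text \<open>Two points in a ball of radius \<gamma>/6 are less than \<gamma>/3 apart. Thanks to
  this, a selection settles at most one point per group in the rounding.\<close>

lemma net_close_unique:
  assumes "is_net \<gamma> Z" "Z u" "Z v" "u < n" "v < n" "p < n" "g u = g v" "close \<gamma> p u" "close \<gamma> p v"
  shows "u = v"
proof (rule ccontr)
  assume "u \<noteq> v"
  then have "\<gamma> \<le> 3 * D u v" using net_separated assms by blast
  moreover have "D u v \<le> D p u + D p v" using D_tri[of u p v] D_sym[of p u] assms by simp
  ultimately show False using assms unfolding close_def by simp
qed

text \<open>Moving every optimal point to its representative in the net of its group loses a third of
  the distance at either end.\<close>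

lemma net_feasible:
  assumes net: "is_net \<gamma> Z" and \<gamma>: "0 < \<gamma>" and "feasible \<gamma>"
  shows "\<exists>T\<subseteq>{j. j < n \<and> Z j}. (\<forall>i<m. card {j\<in>T. g j = i} = k i) \<and>
    (\<forall>p<n. card {j\<in>T. close \<gamma> p j} \<le> 1)"
proof -
  obtain Q where Q: "Q \<subseteq> {..<n}" "\<And>i. i < m \<Longrightarrow> card {j\<in>Q. g j = i} = k i"
    "\<And>u v. \<lbrakk>u \<in> Q; v \<in> Q; u \<noteq> v\<rbrakk> \<Longrightarrow> \<gamma> \<le> D u v"
    using assms(3) unfolding feasible_def by blast
  have "\<exists>z<n. Z z \<and> g z = g u \<and> 3 * D u z < \<gamma>" if "u < n" for u
  proof (cases "Z u")
    case True
    then show ?thesis using that \<gamma> D_self by auto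
  next
    case False
    then show ?thesis using net that unfolding is_net_def by (meson order_less_trans)
  qed
  then obtain f where f: "\<And>u. u < n \<Longrightarrow> f u < n \<and> Z (f u) \<and> g (f u) = g u \<and> 3 * D u (f u) < \<gamma>"
    by metis
  have sep: "\<gamma> < 3 * D (f u) (f v)" if "u \<in> Q" "v \<in> Q" "u \<noteq> v" for u v
  proof -
    have uv: "u < n" "v < n" using that Q(1) by auto
    have "D u v \<le> D u (f u) + D (f u) (f v) + D v (f v)"
      using D_tri[of u "f u" v] D_tri[of "f u" "f v" v] D_sym[of v "f v"] f[OF uv(1)] f[OF uv(2)] uv
      by simp
    then show ?thesis using Q(3)[OF that] f[OF uv(1)] f[OF uv(2)] by simp
  qed
  have inj: "inj_on f Q"
  proof (rule inj_onI, rule ccontr)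
    fix u v assume *: "u \<in> Q" "v \<in> Q" "f u = f v" "u \<noteq> v"
    then have "D (f u) (f v) = 0" using f[of v] Q(1) D_self by auto
    then show False using sep[OF *(1,2,4)] \<gamma> by simp
  qed
  show ?thesis
  proof (intro exI[of _ "f ` Q"] conjI allI impI)
    show "f ` Q \<subseteq> {j. j < n \<and> Z j}" using f Q(1) by auto
    show "card {j \<in> f ` Q. g j = i} = k i" if "i < m" for i
    proof -
      have "{j \<in> f ` Q. g j = i} = f ` {j\<in>Q. g j = i}" using f Q(1) by auto
      moreover have "inj_on f {j\<in>Q. g j = i}" using inj by (rule inj_on_subset) auto
      ultimately show ?thesis using Q(2)[OF that] by (simp add: card_image)
    qed
    show "card {j \<in> f ` Q. close \<gamma> p j} \<le> 1" if p: "p < n" for p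
    proof -
      have "f u = f v" if uv: "u \<in> Q" "v \<in> Q" "close \<gamma> p (f u)" "close \<gamma> p (f v)" for u v
      proof (rule ccontr)
        assume "f u \<noteq> f v"
        then have "\<gamma> < 3 * D (f u) (f v)" using sep uv by metis
        moreover have "D (f u) (f v) \<le> D p (f u) + D p (f v)"
        proof -
          have "f u < n" "f v < n" using f uv(1,2) Q(1) by auto
          then show ?thesis using D_tri[of "f u" p "f v"] D_sym[of p "f u"] p by simp
        qed
        ultimately show False using uv(3,4) unfolding close_def by simp
      qed
      moreover have "finite {j \<in> f ` Q. close \<gamma> p j}"
        using Q(1) finite_subset[of Q "{..<n}"] by auto
      ultimately show ?thesis by (auto simp: card_le_Suc0_iff_eq)
    qed
  qed
qed

section \<open>The subgradient iteration and its invariant\<close>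

definition mw_chosen :: "real \<Rightarrow> (nat \<Rightarrow> bool) \<Rightarrow> (nat \<Rightarrow> nat) \<Rightarrow> (nat \<Rightarrow> nat) \<Rightarrow> nat \<Rightarrow> bool" where
  "mw_chosen \<gamma> Z w y j \<longleftrightarrow> Z j \<and> (\<Sum>p<n. of_bool (close \<gamma> p j) * w p) < y (g j)"

text \<open>\<open>w\<close> and \<open>y\<close> are the multipliers of the packing constraints (at most one point in each ball)
  and of the covering constraints (at least \<open>k i\<close> points in each group). The truncated
  subtraction is the projection onto the nonnegative orthant.\<close>

definition mw_step :: "real \<Rightarrow> (nat \<Rightarrow> bool) \<Rightarrow> (nat \<Rightarrow> nat) \<Rightarrow> (nat \<Rightarrow> nat) \<Rightarrow> (nat \<Rightarrow> nat) \<Rightarrow>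
    (nat \<Rightarrow> nat) \<Rightarrow> (nat \<Rightarrow> nat) \<Rightarrow> (nat \<Rightarrow> nat) \<Rightarrow> bool" where
  "mw_step \<gamma> Z w y x w' y' x' \<longleftrightarrow>
     (let A = mw_chosen \<gamma> Z w y in
      (\<forall>p<n. w' p = w p + (\<Sum>j<n. of_bool (close \<gamma> p j \<and> A j)) - 1) \<and>
      (\<forall>i<n. y' i = y i + k i - (\<Sum>j<n. of_bool (A j \<and> g j = i))) \<and>
      (\<forall>j<n. x' j = x j + of_bool (A j)))"

text \<open>Truncation only raises a multiplier, so \<open>w p\<close> and \<open>y i\<close> stay
  above the accumulated violations of their constraints, and bounding the squares bounds the
  violations. The condition on the support stands outside the implication because the rounding
  relies on it for infeasible guesses too.\<close>

definition mw_inv :: "real \<Rightarrow> (nat \<Rightarrow> bool) \<Rightarrow> nat \<Rightarrow> (nat \<Rightarrow> nat) \<Rightarrow> (nat \<Rightarrow> nat) \<Rightarrow> (nat \<Rightarrow> nat) \<Rightarrow> bool" where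
  "mw_inv \<gamma> Z t w y x \<longleftrightarrow>
     (\<forall>j<n. 0 < x j \<longrightarrow> Z j) \<and>
     (feasible \<gamma> \<longrightarrow>
       (\<Sum>p<n. (w p)^2) + (\<Sum>i<n. (y i)^2) \<le> 2 * n^3 * t \<and>
       (\<forall>p<n. (\<Sum>j<n. of_bool (close \<gamma> p j) * x j) \<le> t + w p) \<and>
       (\<forall>i<m. t * k i \<le> y i + (\<Sum>j<n. of_bool (g j = i) * x j)))"

lemma mw_inv_0:
  assumes "\<And>j. j < n \<Longrightarrow> w j = 0 \<and> y j = 0 \<and> x j = 0"
  shows "mw_inv \<gamma> Z 0 w y x"
  using assms by (simp add: mw_inv_def)

text \<open>The left-hand side is the Lagrangian of the current multipliers at \<open>A\<close>. It
  is affine with coefficient \<open>c j - y (g j)\<close> at \<open>j\<close>, and \<open>A\<close>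
  takes exactly the net points with negative coefficient, so it is minimal among subsets of the net.
  The set \<open>T\<close> from \<open>net_feasible\<close> satisfies all constraints and has value
  at most 0. Geometrically: the step has nonpositive inner product with the vector of
  multipliers.\<close>

lemma mw_direction:
  fixes w y :: "nat \<Rightarrow> nat"
  assumes net: "is_net \<gamma> Z" and \<gamma>: "0 < \<gamma>" and feas: "feasible \<gamma>"
  defines "A \<equiv> mw_chosen \<gamma> Z w y"
  shows "(\<Sum>p<n. real (w p) * ((\<Sum>j<n. of_bool (close \<gamma> p j \<and> A j)) - 1)) +
    (\<Sum>i<n. real (y i) * (real (k i) - (\<Sum>j<n. of_bool (A j \<and> g j = i)))) \<le> 0"
proof -
  obtain T where T: "T \<subseteq> {j. j < n \<and> Z j}" "\<And>i. i < m \<Longrightarrow> card {j\<in>T. g j = i} = k i"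
    "\<And>p. p < n \<Longrightarrow> card {j\<in>T. close \<gamma> p j} \<le> 1"
    using net_feasible[OF net \<gamma> feas] by blast
  define c where "c j = (\<Sum>p<n. of_bool (close \<gamma> p j) * real (w p))" for j
  define L where "L B = (\<Sum>p<n. real (w p) * ((\<Sum>j<n. of_bool (close \<gamma> p j \<and> B j)) - 1)) +
    (\<Sum>i<n. real (y i) * (real (k i) - (\<Sum>j<n. of_bool (B j \<and> g j = i))))" for B
  have gn: "g j < n" if "j < n" for j
    using g_less[OF that] m_le by simp
  have L: "L B = (\<Sum>j<n. of_bool (B j) * (c j - y (g j))) - (\<Sum>p<n. w p) + (\<Sum>i<n. y i * k i)" for B
  proof -
    have "(\<Sum>p<n. real (w p) * (\<Sum>j<n. of_bool (close \<gamma> p j \<and> B j))) = (\<Sum>j<n. of_bool (B j) * c j)"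
      unfolding c_def sum_distrib_left by (subst sum.swap) (intro sum.cong refl, auto)
    moreover have "(\<Sum>i<n. real (y i) * (\<Sum>j<n. of_bool (B j \<and> g j = i))) =
        (\<Sum>j<n. of_bool (B j) * real (y (g j)))"
    proof -
      have "(\<Sum>i<n. real (y i) * (\<Sum>j<n. of_bool (B j \<and> g j = i))) =
          (\<Sum>j<n. \<Sum>i<n. if g j = i then of_bool (B j) * real (y i) else 0)"
        unfolding sum_distrib_left by (subst sum.swap) (intro sum.cong refl, auto)
      also have "\<dots> = (\<Sum>j<n. of_bool (B j) * real (y (g j)))"
        using gn by (intro sum.cong refl) simp
      finally show ?thesis .
    qed
    ultimately show ?thesis
      unfolding L_def right_diff_distrib sum_subtractf mult_1_right of_nat_sum of_nat_mult by linarith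
  qed
  have "L A \<le> L (\<lambda>j. j \<in> T)"
  proof -
    have "of_bool (A j) * (c j - y (g j)) \<le> of_bool (j \<in> T) * (c j - y (g j))" if "j < n" for j
    proof -
      have "A j \<longleftrightarrow> Z j \<and> c j < y (g j)"
      proof -
        have "real (\<Sum>p<n. of_bool (close \<gamma> p j) * w p) = c j"
          unfolding c_def of_nat_sum of_nat_mult of_nat_of_bool ..
        then show ?thesis
          unfolding A_def mw_chosen_def by (metis of_nat_less_iff)
      qed
      then show ?thesis using T(1) by auto
    qed
    then show ?thesis unfolding L by (intro add_right_mono diff_right_mono sum_mono) simp
  qed
  also have "L (\<lambda>j. j \<in> T) \<le> 0"
  proof -
    have card: "(\<Sum>j<n. of_bool (R j \<and> j \<in> T)) = real (card {j\<in>T. R j})" for R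
    proof -
      have "{..<n} \<inter> {j. R j \<and> j \<in> T} = {j\<in>T. R j}" using T(1) by auto
      then show ?thesis by (simp add: of_bool_def sum.If_cases)
    qed
    have "(\<Sum>p<n. real (w p) * ((\<Sum>j<n. of_bool (close \<gamma> p j \<and> j \<in> T)) - 1)) \<le> 0"
      unfolding card using T(3) by (intro sum_nonpos mult_nonneg_nonpos) auto
    \<comment> \<open>Indices from \<open>m\<close> on contribute 0: no point has such a group and
      \<open>k\<close> vanishes there.\<close>
    moreover have "(\<Sum>i<n. real (y i) * (real (k i) - (\<Sum>j<n. of_bool (j \<in> T \<and> g j = i)))) = 0"
    proof (rule sum.neutral, rule ballI)
      fix i
      have "card {j\<in>T. g j = i} = k i"
      proof (cases "i < m")
        case False
        have none: "{j\<in>T. g j = i} = {}" using False T(1) g_less by fastforce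
        show ?thesis unfolding none using False k_0[of i] by simp
      qed (use T(2) in simp)
      then show "real (y i) * (real (k i) - (\<Sum>j<n. of_bool (j \<in> T \<and> g j = i))) = 0"
        using card[of "\<lambda>j. g j = i"] by (simp add: conj_commute)
    qed
    ultimately show ?thesis unfolding L_def by simp
  qed
  finally show ?thesis unfolding L_def .
qed

lemma square_trunc: "(real (a - b))^2 \<le> (real a - real b)^2"
  by (cases "b \<le> a") (auto simp: of_nat_diff)

text \<open>The last term is the second-order error of a unit step in one coordinate. Over 2n
  coordinates it adds up to the 2 * n^3 per step in \<open>mw_inv\<close>.\<close>

lemma square_update:
  assumes "\<bar>l\<bar> \<le> real n" "(real a')^2 \<le> (real a + l)^2"
  shows "(real a')^2 \<le> (real a)^2 + 2 * (real a * l) + real n^2"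
proof -
  have "l^2 \<le> real n^2" using assms(1) by (simp add: abs_le_square_iff[symmetric])
  then show ?thesis using assms(2) by (simp add: power2_sum)
qed

lemma mw_inv_step:
  assumes net: "is_net \<gamma> Z" and \<gamma>: "0 < \<gamma>"
    and inv: "mw_inv \<gamma> Z t w y x" and step: "mw_step \<gamma> Z w y x w' y' x'"
  shows "mw_inv \<gamma> Z (Suc t) w' y' x'"
proof -
  define A where "A = mw_chosen \<gamma> Z w y"
  define l where "l p = (\<Sum>j<n. of_bool (close \<gamma> p j \<and> A j) :: nat)" for p
  define c where "c i = (\<Sum>j<n. of_bool (A j \<and> g j = i) :: nat)" for i
  have w': "w' p = w p + l p - 1" if "p < n" for p
    using step that unfolding mw_step_def A_def l_def Let_def by auto
  have y': "y' i = y i + k i - c i" if "i < n" for i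
    using step that unfolding mw_step_def A_def c_def Let_def by auto
  have x': "x' j = x j + of_bool (A j)" if "j < n" for j
    using step that unfolding mw_step_def A_def Let_def by auto
  have l_le: "l p \<le> n" for p
    unfolding l_def using sum_bounded_above[of "{..<n}" "\<lambda>j. of_bool (close \<gamma> p j \<and> A j)" "1::nat"] by auto
  have c_le: "c i \<le> n" for i
    unfolding c_def using sum_bounded_above[of "{..<n}" "\<lambda>j. of_bool (A j \<and> g j = i)" "1::nat"] by auto
  have "Z j" if "j < n" "0 < x' j" for j
    using inv that x'[OF that(1)] unfolding mw_inv_def A_def mw_chosen_def
    by (cases "A j") (auto simp: A_def mw_chosen_def)
  moreover have "(\<Sum>p<n. (w' p)^2) + (\<Sum>i<n. (y' i)^2) \<le> 2 * n^3 * Suc t" if feas: "feasible \<gamma>"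
  proof -
    have "real ((\<Sum>p<n. (w' p)^2) + (\<Sum>i<n. (y' i)^2)) = (\<Sum>p<n. (real (w' p))^2) + (\<Sum>i<n. (real (y' i))^2)"
      by simp
    also have "\<dots> \<le> (\<Sum>p<n. (real (w p))^2 + 2 * (real (w p) * (real (l p) - 1)) + real n^2) +
        (\<Sum>i<n. (real (y i))^2 + 2 * (real (y i) * (real (k i) - real (c i))) + real n^2)"
    proof (intro add_mono sum_mono square_update)
      fix p assume "p \<in> {..<n}"
      then show "(real (w' p))^2 \<le> (real (w p) + (real (l p) - 1))^2"
        using square_trunc[of "w p + l p" 1] by (simp add: w' algebra_simps)
      show "\<bar>real (l p) - 1\<bar> \<le> real n" using l_le[of p] n_ge by linarith
    next
      fix i assume "i \<in> {..<n}"
      then show "(real (y' i))^2 \<le> (real (y i) + (real (k i) - real (c i)))^2"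
        using square_trunc[of "y i + k i" "c i"] by (simp add: y' algebra_simps)
      show "\<bar>real (k i) - real (c i)\<bar> \<le> real n" using c_le[of i] k_le[of i] by linarith
    qed
    also have "\<dots> = real ((\<Sum>p<n. (w p)^2) + (\<Sum>i<n. (y i)^2)) +
        2 * ((\<Sum>p<n. real (w p) * (real (l p) - 1)) + (\<Sum>i<n. real (y i) * (real (k i) - real (c i)))) +
        2 * real n^3"
      unfolding sum.distrib sum_distrib_left[symmetric]
      by (simp add: power3_eq_cube power2_eq_square algebra_simps)
    \<comment> \<open>The cross terms form twice the inner product of \<open>mw_direction\<close>,
      so only second-order errors accumulate.\<close>
    also have "\<dots> \<le> real (2 * n^3 * t) + 2 * 0 + 2 * real n^3"
    proof -
      have "(\<Sum>p<n. (w p)^2) + (\<Sum>i<n. (y i)^2) \<le> 2 * n^3 * t"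
        using inv feas unfolding mw_inv_def by blast
      moreover have "(\<Sum>p<n. real (w p) * (real (l p) - 1)) +
          (\<Sum>i<n. real (y i) * (real (k i) - real (c i))) \<le> 0"
        using mw_direction[OF net \<gamma> feas, of w y]
        unfolding A_def[symmetric] l_def c_def of_nat_sum of_nat_of_bool .
      ultimately show ?thesis
        by (intro add_right_mono add_mono) (simp_all only: of_nat_le_iff, simp)
    qed
    also have "\<dots> = real (2 * n^3 * Suc t)" by (simp add: algebra_simps)
    finally show ?thesis using of_nat_le_iff by blast
  qed
  moreover have "(\<Sum>j<n. of_bool (close \<gamma> p j) * x' j) \<le> Suc t + w' p" if "feasible \<gamma>" "p < n" for p
  proof -
    have "(\<Sum>j<n. of_bool (close \<gamma> p j) * x' j) = (\<Sum>j<n. of_bool (close \<gamma> p j) * x j) + l p"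
      unfolding l_def sum.distrib[symmetric] by (intro sum.cong) (auto simp: x')
    moreover have "(\<Sum>j<n. of_bool (close \<gamma> p j) * x j) \<le> t + w p"
      using inv that unfolding mw_inv_def by blast
    ultimately show ?thesis using w'[OF that(2)] by linarith
  qed
  moreover have "Suc t * k i \<le> y' i + (\<Sum>j<n. of_bool (g j = i) * x' j)" if "feasible \<gamma>" "i < m" for i
  proof -
    have "(\<Sum>j<n. of_bool (g j = i) * x' j) = (\<Sum>j<n. of_bool (g j = i) * x j) + c i"
      unfolding c_def sum.distrib[symmetric] by (intro sum.cong) (auto simp: x')
    moreover have "t * k i \<le> y i + (\<Sum>j<n. of_bool (g j = i) * x j)"
      using inv that unfolding mw_inv_def by blast
    moreover have "i < n" using that m_le by simp
    ultimately show ?thesis using y'[of i] by simp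
  qed
  ultimately show ?thesis unfolding mw_inv_def by blast
qed

end

section \<open>Derandomized rounding\<close>

context fair_indices
begin

section \<open>The potential of the rounding and its change under a selection\<close>

definition ball_mass :: "real \<Rightarrow> (nat \<Rightarrow> nat) \<Rightarrow> nat \<Rightarrow> nat" where
  "ball_mass \<gamma> x j = (\<Sum>l<n. of_bool (close \<gamma> j l) * x l)"

text \<open>If the points ring at independent exponential times with rates proportional to \<open>x\<close>, then
  \<open>x j / ball_mass \<gamma> x j\<close> is the probability that \<open>j\<close> rings first in its ball, and this remains its
  conditional probability as long as no point of the ball has rung. Hence \<open>qf \<gamma> x j\<close> is the
  expectation of \<open>(1 - \<epsilon>) ^ Y j\<close> for the indicator \<open>Y j\<close> of that event.\<close>

definition qf :: "real \<Rightarrow> (nat \<Rightarrow> nat) \<Rightarrow> nat \<Rightarrow> real" where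
  "qf \<gamma> x j = 1 - \<epsilon> * (real (x j) / real (ball_mass \<gamma> x j))"

text \<open>For positive \<open>k i\<close> this is the largest integer strictly below (1 -
  \<epsilon>) * k i, so a group falls short exactly if it gets at most \<open>target i\<close>
  points. It is counted by comparisons because the model cannot round reals; since k i is at most n,
  the range \<open>{..<n}\<close> is long enough.\<close>

definition target :: "nat \<Rightarrow> nat" where
  "target i = (\<Sum>l<n. of_bool (real (Suc l) < (1 - \<epsilon>) * real (k i)))"

text \<open>Markov normalisation: its product with (1 - \<epsilon>)^c is at least 1 exactly when c
  is at most the target.\<close>

definition weight :: "nat \<Rightarrow> real" where
  "weight i = (1 / (1 - \<epsilon>)) ^ target i"

text \<open>The three cases are selected, undecided and ruled out; the value is the conditional
  expectation of (1 - \<epsilon>) ^ Y j.\<close>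

definition factor :: "real \<Rightarrow> (nat \<Rightarrow> nat) \<Rightarrow> (nat \<Rightarrow> bool) \<Rightarrow> (nat \<Rightarrow> bool) \<Rightarrow> nat \<Rightarrow> real" where
  "factor \<gamma> x al S j = (if S j then 1 - \<epsilon> else if al j then qf \<gamma> x j else 1)"

text \<open>The change of the sum of all \<open>V i\<close> when \<open>z\<close> is selected: each
  undecided point in the ball of \<open>z\<close> is settled and loses its factor \<open>qf\<close>,
  and for \<open>z\<close> itself 1 - \<epsilon> takes the place of that factor. It is exact, not
  merely first order, as long as these points lie in different groups.\<close>

definition score :: "real \<Rightarrow> (nat \<Rightarrow> nat) \<Rightarrow> (nat \<Rightarrow> bool) \<Rightarrow> (nat \<Rightarrow> real) \<Rightarrow> nat \<Rightarrow> real" where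
  "score \<gamma> x al V z =
     (\<Sum>j<n. if al j \<and> close \<gamma> z j then V (g j) * (1 / qf \<gamma> x j - 1) else 0) - V (g z) * \<epsilon> / qf \<gamma> x z"

text \<open>The union bound over all groups of the exponential Chernoff bounds for falling short,
  before anything is decided.\<close>

definition initial_potential :: "real \<Rightarrow> (nat \<Rightarrow> nat) \<Rightarrow> real" where
  "initial_potential \<gamma> x = (\<Sum>i<m. weight i * (\<Prod>j<n. if g j = i then qf \<gamma> x j else 1))"

definition round_inv :: "real \<Rightarrow> (nat \<Rightarrow> nat) \<Rightarrow> (nat \<Rightarrow> bool) \<Rightarrow> (nat \<Rightarrow> bool) \<Rightarrow> (nat \<Rightarrow> real) \<Rightarrow> bool" where
  "round_inv \<gamma> x al S V \<longleftrightarrow>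
     (\<forall>j<n. al j \<longrightarrow> 0 < x j \<and> \<not> S j) \<and>
     (\<forall>u<n. \<forall>v<n. S u \<and> S v \<and> u \<noteq> v \<longrightarrow> \<not> close \<gamma> u v) \<and>
     (\<forall>u<n. \<forall>j<n. S u \<and> close \<gamma> u j \<longrightarrow> \<not> al j) \<and>
     (\<forall>i<m. V i = weight i * (\<Prod>j<n. if g j = i then factor \<gamma> x al S j else 1)) \<and>
     (\<Sum>i<m. V i) \<le> initial_potential \<gamma> x"

definition select :: "real \<Rightarrow> (nat \<Rightarrow> nat) \<Rightarrow> nat \<Rightarrow> (nat \<Rightarrow> bool) \<Rightarrow> (nat \<Rightarrow> bool) \<Rightarrow> (nat \<Rightarrow> real) \<Rightarrow>
    (nat \<Rightarrow> bool) \<Rightarrow> (nat \<Rightarrow> bool) \<Rightarrow> (nat \<Rightarrow> real) \<Rightarrow> bool" where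
  "select \<gamma> x z al S V al' S' V' \<longleftrightarrow>
     (\<forall>j<n. al' j \<longleftrightarrow> al j \<and> \<not> close \<gamma> z j) \<and>
     (\<forall>j<n. S' j \<longleftrightarrow> S j \<or> j = z) \<and>
     (\<forall>i<m. V' i = V i * (if i = g z then 1 - \<epsilon> else 1) /
        (\<Prod>j<n. if al j \<and> close \<gamma> z j \<and> g j = i then qf \<gamma> x j else 1))"

lemma x_le_ball_mass:
  assumes "0 < \<gamma>" "j < n"
  shows "x j \<le> ball_mass \<gamma> x j"
  unfolding ball_mass_def
  using member_le_sum[of j "{..<n}" "\<lambda>l. of_bool (close \<gamma> j l) * x l"] assms close_self by simp

lemma qf_bounds:
  assumes "0 < \<gamma>" "j < n"
  shows "1 - \<epsilon> \<le> qf \<gamma> x j" "qf \<gamma> x j \<le> 1" "0 < qf \<gamma> x j"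
proof -
  \<comment> \<open>A ball of mass 0 yields quotient 0 by the convention for division, hence
    \<open>qf\<close> equal to 1.\<close>
  have "real (x j) / real (ball_mass \<gamma> x j) \<le> 1"
    using x_le_ball_mass[OF assms, of x]
    by (cases "ball_mass \<gamma> x j = 0") (auto simp: divide_le_eq_1)
  then show *: "1 - \<epsilon> \<le> qf \<gamma> x j"
    unfolding qf_def using mult_left_le[of "real (x j) / real (ball_mass \<gamma> x j)" \<epsilon>] eps by simp
  show "qf \<gamma> x j \<le> 1" unfolding qf_def using eps by simp
  show "0 < qf \<gamma> x j" using * eps by simp
qed

lemma weight_pos: "0 < weight i"
  unfolding weight_def using eps by simp

text \<open>The average of the scores with weights \<open>x\<close> is nonpositive: this is the supermartingale
  property of the potential.\<close>

lemma score_nonpos: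
  assumes \<gamma>: "0 < \<gamma>" and al: "\<And>j. j < n \<Longrightarrow> al j \<Longrightarrow> 0 < x j" and V: "\<And>i. i < m \<Longrightarrow> 0 \<le> V i"
    and ex: "z0 < n" "al z0"
  shows "\<exists>z<n. al z \<and> score \<gamma> x al V z \<le> 0"
proof (rule ccontr)
  assume "\<not> ?thesis"
  then have pos: "0 < score \<gamma> x al V z" if "z < n" "al z" for z using that by force
  define a where "a z = of_bool (al z) * real (x z)" for z
  define b where "b j = V (g j) / qf \<gamma> x j" for j
  have Vg: "0 \<le> V (g j)" if "j < n" for j using V g_less that by blast
  have "0 < (\<Sum>z<n. a z * score \<gamma> x al V z)"
    using pos al ex by (intro sum_pos2[of _ z0]) (auto simp: a_def less_imp_le)
  also have "(\<Sum>z<n. a z * score \<gamma> x al V z) =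
      (\<Sum>z<n. \<Sum>j<n. of_bool (al j \<and> close \<gamma> z j) * a z * (V (g j) * (1 / qf \<gamma> x j - 1))) -
      (\<Sum>z<n. a z * (\<epsilon> * b z))"
  proof -
    have "a z * score \<gamma> x al V z =
        (\<Sum>j<n. of_bool (al j \<and> close \<gamma> z j) * a z * (V (g j) * (1 / qf \<gamma> x j - 1))) - a z * (\<epsilon> * b z)" for z
    proof -
      have "a z * (\<Sum>j<n. if al j \<and> close \<gamma> z j then V (g j) * (1 / qf \<gamma> x j - 1) else 0) =
          (\<Sum>j<n. of_bool (al j \<and> close \<gamma> z j) * a z * (V (g j) * (1 / qf \<gamma> x j - 1)))"
        unfolding sum_distrib_left by (intro sum.cong refl) simp
      then show ?thesis unfolding score_def b_def right_diff_distrib[of "a z"] by simp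
    qed
    then show ?thesis by (simp only: sum_subtractf)
  qed
  \<comment> \<open>Regrouping by the point \<open>j\<close> that is settled instead of the point
    \<open>z\<close> that rings.\<close>
  also have "(\<Sum>z<n. \<Sum>j<n. of_bool (al j \<and> close \<gamma> z j) * a z * (V (g j) * (1 / qf \<gamma> x j - 1))) =
      (\<Sum>j<n. \<Sum>z<n. of_bool (al j \<and> close \<gamma> z j) * a z * (V (g j) * (1 / qf \<gamma> x j - 1)))"
    by (rule sum.swap)
  also have "\<dots> - (\<Sum>z<n. a z * (\<epsilon> * b z)) =
      (\<Sum>j<n. (\<Sum>z<n. of_bool (al j \<and> close \<gamma> z j) * a z * (V (g j) * (1 / qf \<gamma> x j - 1))) - a j * (\<epsilon> * b j))"
    by (simp only: sum_subtractf)
  also have "\<dots> \<le> 0"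
  proof (rule sum_nonpos)
    fix j assume "j \<in> {..<n}"
    then have j: "j < n" by simp
    show "(\<Sum>z<n. of_bool (al j \<and> close \<gamma> z j) * a z * (V (g j) * (1 / qf \<gamma> x j - 1))) - a j * (\<epsilon> * b j) \<le> 0"
    proof (cases "al j")
      case True
      let ?X = "real (ball_mass \<gamma> x j)"
      have X: "0 < ?X" using al[OF j True] x_le_ball_mass[OF \<gamma> j, of x] by simp
      have q: "0 < qf \<gamma> x j" using qf_bounds[OF \<gamma> j] by blast
      have V1: "V (g j) * (1 / qf \<gamma> x j - 1) = b j * (\<epsilon> * (real (x j) / ?X))"
      proof -
        have "1 / qf \<gamma> x j - 1 = (1 - qf \<gamma> x j) / qf \<gamma> x j"
          using q by (simp add: diff_divide_distrib)
        moreover have "1 - qf \<gamma> x j = \<epsilon> * (real (x j) / ?X)" by (simp add: qf_def)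
        ultimately have "1 / qf \<gamma> x j - 1 = \<epsilon> * (real (x j) / ?X) / qf \<gamma> x j" by (simp only:)
        then show ?thesis unfolding b_def by (simp only:) simp
      qed
      have b: "0 \<le> b j" unfolding b_def using Vg[OF j] q by simp
      \<comment> \<open>Only undecided points ring here, hence an inequality. Other rings would
        merely rule points out and so raise the potential; omitting them is favourable.\<close>
      have "(\<Sum>z<n. of_bool (al j \<and> close \<gamma> z j) * a z) \<le> ?X"
        unfolding ball_mass_def of_nat_sum
        by (intro sum_mono) (use j in \<open>auto simp: a_def close_sym\<close>)
      then have "(\<Sum>z<n. of_bool (al j \<and> close \<gamma> z j) * a z) * (b j * (\<epsilon> * (real (x j) / ?X))) \<le>
          ?X * (b j * (\<epsilon> * (real (x j) / ?X)))"
        using b eps by (intro mult_right_mono) auto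
      also have "\<dots> = a j * (\<epsilon> * b j)" using X True by (simp add: a_def)
      finally show ?thesis unfolding V1 sum_distrib_right by simp
    qed (simp add: a_def)
  qed
  finally show False by simp
qed

lemma round_inv_0:
  assumes \<gamma>: "0 < \<gamma>" and "\<And>j. j < n \<Longrightarrow> al j \<longleftrightarrow> 0 < x j" "\<And>j. j < n \<Longrightarrow> \<not> S j"
    and V: "\<And>i. i < m \<Longrightarrow> V i = weight i * (\<Prod>j<n. if g j = i then qf \<gamma> x j else 1)"
  shows "round_inv \<gamma> x al S V"
proof -
  have "(\<Prod>j<n. if g j = i then factor \<gamma> x al S j else 1) = (\<Prod>j<n. if g j = i then qf \<gamma> x j else 1)" for i
    using assms(2,3) by (intro prod.cong refl) (auto simp: factor_def qf_def)
  then show ?thesis using assms by (simp add: round_inv_def initial_potential_def)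
qed

lemma factor_pos: "0 < \<gamma> \<Longrightarrow> j < n \<Longrightarrow> 0 < factor \<gamma> x al S j"
  using eps qf_bounds by (simp add: factor_def)

lemma round_inv_V_pos:
  assumes "0 < \<gamma>" "round_inv \<gamma> x al S V" "i < m"
  shows "0 < V i"
proof -
  have "0 < (\<Prod>j<n. if g j = i then factor \<gamma> x al S j else 1)"
    using factor_pos[OF assms(1)] by (intro prod_pos) auto
  then show ?thesis using assms weight_pos[of i] by (simp add: round_inv_def)
qed

lemma prod_single:
  fixes f :: "nat \<Rightarrow> real"
  assumes "j < n" "P j" "\<And>l. l < n \<Longrightarrow> P l \<Longrightarrow> l = j"
  shows "(\<Prod>l<n. if P l then f l else 1) = f j"
proof -
  have "P l \<longleftrightarrow> l = j" if "l < n" for l using assms(2) assms(3)[OF that] by auto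
  then have "(\<Prod>l<n. if P l then f l else 1) = (\<Prod>l<n. if l = j then f l else 1)"
    by (intro prod.cong refl) simp
  then show ?thesis using assms(1) by simp
qed

lemma round_inv_select:
  assumes net: "is_net \<gamma> Z" and \<gamma>: "0 < \<gamma>" and xZ: "\<And>j. j < n \<Longrightarrow> 0 < x j \<Longrightarrow> Z j"
    and inv: "round_inv \<gamma> x al S V" and z: "z < n" "al z" "score \<gamma> x al V z \<le> 0"
    and sel: "select \<gamma> x z al S V al' S' V'"
  shows "round_inv \<gamma> x al' S' V'"
proof -
  note I = inv[unfolded round_inv_def, THEN conjunct1]
    inv[unfolded round_inv_def, THEN conjunct2, THEN conjunct1]
    inv[unfolded round_inv_def, THEN conjunct2, THEN conjunct2, THEN conjunct1]
  have al: "0 < x j" "\<not> S j" if "j < n" "al j" for j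
    using I(1) that by simp_all
  have kill: "\<not> al j" if "u < n" "j < n" "S u" "close \<gamma> u j" for u j
    using I(3) that by metis
  have al': "al' j \<longleftrightarrow> al j \<and> \<not> close \<gamma> z j" if "j < n" for j
    using sel that unfolding select_def by blast
  have S': "S' j \<longleftrightarrow> S j \<or> j = z" if "j < n" for j
    using sel that unfolding select_def by blast
  define U where "U j \<longleftrightarrow> al j \<and> close \<gamma> z j" for j
  have Uz: "U z" using z close_self[OF \<gamma>] unfolding U_def by blast
  define pr where "pr i = (\<Prod>j<n. if U j \<and> g j = i then qf \<gamma> x j else 1)" for i
  have V': "V' i = V i * (if i = g z then 1 - \<epsilon> else 1) / pr i" if "i < m" for i
    using sel that unfolding select_def pr_def U_def by (simp add: conj_assoc)
  \<comment> \<open>Undecided points lie in the net, so those in the ball of \<open>z\<close> belong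
    to different groups.\<close>
  have uniq: "l = j" if "l < n" "j < n" "U l" "U j" "g l = g j" for l j
  proof (rule net_close_unique[OF net _ _ that(1,2) z(1) that(5)])
    show "Z l" "Z j" "close \<gamma> z l" "close \<gamma> z j"
      using that(3,4) al(1) xZ that(1,2) unfolding U_def by simp_all
  qed
  have pr_pos: "0 < pr i" for i
    unfolding pr_def using qf_bounds(3)[OF \<gamma>] by (intro prod_pos) auto
  have V_eq: "V' i = weight i * (\<Prod>j<n. if g j = i then factor \<gamma> x al' S' j else 1)" if i: "i < m" for i
  proof -
    \<comment> \<open>Compared factor by factor: a settled point trades its \<open>qf\<close> for 1,
      and \<open>z\<close> trades it for 1 - \<epsilon>.\<close>
    have "(\<Prod>j<n. if g j = i then factor \<gamma> x al' S' j else 1) * pr i =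
        (\<Prod>j<n. (if g j = i then factor \<gamma> x al S j else 1) * (if j = z then if i = g z then 1 - \<epsilon> else 1 else 1))"
      unfolding pr_def prod.distrib[symmetric]
    proof (intro prod.cong refl)
      fix j assume "j \<in> {..<n}"
      then have j: "j < n" by simp
      show "(if g j = i then factor \<gamma> x al' S' j else 1) * (if U j \<and> g j = i then qf \<gamma> x j else 1) =
          (if g j = i then factor \<gamma> x al S j else 1) * (if j = z then if i = g z then 1 - \<epsilon> else 1 else 1)"
        using al'[OF j] S'[OF j] al[OF j] al[OF z(1,2)] z Uz unfolding factor_def U_def by auto
    qed
    also have "\<dots> = (\<Prod>j<n. if g j = i then factor \<gamma> x al S j else 1) * (if i = g z then 1 - \<epsilon> else 1)"
      using z(1) by (simp add: prod.distrib)
    finally have "(\<Prod>j<n. if g j = i then factor \<gamma> x al' S' j else 1) =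
        (\<Prod>j<n. if g j = i then factor \<gamma> x al S j else 1) * (if i = g z then 1 - \<epsilon> else 1) / pr i"
      using pr_pos[of i] by (simp add: field_simps)
    moreover have "V i = weight i * (\<Prod>j<n. if g j = i then factor \<gamma> x al S j else 1)"
      using inv i unfolding round_inv_def by blast
    ultimately show ?thesis unfolding V'[OF i] by simp
  qed
  \<comment> \<open>By \<open>uniq\<close> the product \<open>pr i\<close> has at most one factor
    that is not trivially 1, so dividing by it amounts to adding V i * (1 / qf - 1). This turns the
    product into the sum of \<open>score\<close>.\<close>
  have "V' i = V i + (\<Sum>j<n. if U j \<and> g j = i then V i * (1 / qf \<gamma> x j - 1) else 0) -
      (if i = g z then V i * \<epsilon> / qf \<gamma> x z else 0)" if i: "i < m" for i
  proof (cases "\<exists>j<n. U j \<and> g j = i")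
    case True
    then obtain j where j: "j < n" "U j" "g j = i" by blast
    have "pr i = qf \<gamma> x j" unfolding pr_def
    proof (rule prod_single)
      show "l = j" if "l < n" "U l \<and> g l = i" for l using uniq[OF that(1) j(1)] that(2) j by simp
    qed (use j in auto)
    moreover have "(\<Sum>l<n. if U l \<and> g l = i then V i * (1 / qf \<gamma> x l - 1) else 0) =
        (\<Sum>l<n. if l = j then V i * (1 / qf \<gamma> x l - 1) else 0)"
    proof -
      have "U l \<and> g l = i \<longleftrightarrow> l = j" if "l < n" for l using uniq[OF that j(1)] j by auto
      then show ?thesis by (intro sum.cong refl) simp
    qed
    moreover have "i = g z \<longleftrightarrow> j = z" using uniq[OF j(1) z(1) j(2) Uz] j(3) by auto
    ultimately show ?thesis
      unfolding V'[OF i] using j(1) by (auto simp: algebra_simps diff_divide_distrib)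
  next
    case False
    then have "pr i = 1" unfolding pr_def by (intro prod.neutral) auto
    moreover have "(\<Sum>l<n. if U l \<and> g l = i then V i * (1 / qf \<gamma> x l - 1) else 0) = 0"
      using False by (intro sum.neutral) auto
    moreover have "i \<noteq> g z" using False z(1) Uz by blast
    ultimately show ?thesis unfolding V'[OF i] by simp
  qed
  then have "(\<Sum>i<m. V' i) = (\<Sum>i<m. V i + (\<Sum>j<n. if U j \<and> g j = i then V i * (1 / qf \<gamma> x j - 1) else 0) -
      (if i = g z then V i * \<epsilon> / qf \<gamma> x z else 0))"
    by (intro sum.cong) auto
  also have "\<dots> = (\<Sum>i<m. V i) + (\<Sum>i<m. \<Sum>j<n. if U j \<and> g j = i then V i * (1 / qf \<gamma> x j - 1) else 0) -
      V (g z) * \<epsilon> / qf \<gamma> x z"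
    using g_less[OF z(1)] by (simp add: sum.distrib sum_subtractf)
  also have "(\<Sum>i<m. \<Sum>j<n. if U j \<and> g j = i then V i * (1 / qf \<gamma> x j - 1) else 0) =
      (\<Sum>j<n. \<Sum>i<m. if i = g j then if U j then V i * (1 / qf \<gamma> x j - 1) else 0 else 0)"
    by (subst sum.swap) (intro sum.cong refl, auto)
  also have "\<dots> = (\<Sum>j<n. if U j then V (g j) * (1 / qf \<gamma> x j - 1) else 0)"
    using g_less by (intro sum.cong refl) simp
  finally have "(\<Sum>i<m. V' i) = (\<Sum>i<m. V i) + score \<gamma> x al V z"
    unfolding score_def U_def by simp
  then have "(\<Sum>i<m. V' i) \<le> initial_potential \<gamma> x"
    using inv z(3) unfolding round_inv_def by linarith
  moreover have "\<forall>j<n. al' j \<longrightarrow> 0 < x j \<and> \<not> S' j"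
  proof (intro allI impI)
    fix j assume j: "j < n" "al' j"
    then have "al j" "\<not> close \<gamma> z j" using al'[OF j(1)] by simp_all
    then show "0 < x j \<and> \<not> S' j"
      using al[OF j(1)] S'[OF j(1)] close_self[OF \<gamma> j(1)] by auto
  qed
  moreover have "\<forall>u<n. \<forall>v<n. S' u \<and> S' v \<and> u \<noteq> v \<longrightarrow> \<not> close \<gamma> u v"
  proof (intro allI impI)
    fix u v assume uv: "u < n" "v < n" "S' u \<and> S' v \<and> u \<noteq> v"
    then consider "S u" "S v" | "S u" "v = z" | "u = z" "S v"
      using S'[OF uv(1)] S'[OF uv(2)] by blast
    then show "\<not> close \<gamma> u v"
    proof cases
      case 1
      then show ?thesis using I(2) uv by blast
    next
      case 2
      then show ?thesis using kill[OF uv(1) z(1)] z(2) by blast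
    next
      case 3
      then show ?thesis using kill[OF uv(2) z(1)] z(2) close_sym[OF z(1) uv(2)] by blast
    qed
  qed
  moreover have "\<forall>u<n. \<forall>j<n. S' u \<and> close \<gamma> u j \<longrightarrow> \<not> al' j"
  proof (intro allI impI)
    fix u j assume uj: "u < n" "j < n" "S' u \<and> close \<gamma> u j"
    then show "\<not> al' j"
      using S'[OF uj(1)] al'[OF uj(2)] kill[OF uj(1,2)] by blast
  qed
  moreover have "\<forall>i<m. V' i = weight i * (\<Prod>j<n. if g j = i then factor \<gamma> x al' S' j else 1)"
    using V_eq by (intro allI impI)
  ultimately show ?thesis unfolding round_inv_def by (intro conjI)
qed

text \<open>Markov's inequality read pointwise. With nothing undecided, \<open>V i\<close> is
  \<open>weight i\<close> times (1 - \<epsilon>)^c for the number c of selected points. If the group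
  fell short this would be at least 1, but it is one of several positive terms with sum below
  1.\<close>

lemma round_inv_final:
  assumes inv: "round_inv \<gamma> x al S V" and \<gamma>: "0 < \<gamma>" and dead: "\<And>j. j < n \<Longrightarrow> \<not> al j"
    and small: "initial_potential \<gamma> x < 1" and i: "i < m"
  shows "(1 - \<epsilon>) * real (k i) \<le> (\<Sum>j<n. of_bool (S j \<and> g j = i))"
proof (rule ccontr)
  define c where "c = (\<Sum>j<n. of_bool (S j \<and> g j = i) :: nat)"
  assume "\<not> ?thesis"
  then have less: "real c < (1 - \<epsilon>) * real (k i)" unfolding c_def by simp
  have "(1 - \<epsilon>) * real (k i) \<le> real (k i)"
    using eps by (simp add: mult_left_le_one_le)
  then have "c \<le> n" using less k_le[of i] by linarith
  have "c = (\<Sum>l<c. 1)" by simp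
  also have "\<dots> \<le> (\<Sum>l<c. of_bool (real (Suc l) < (1 - \<epsilon>) * real (k i)))"
  proof (rule sum_mono)
    fix l assume "l \<in> {..<c}"
    then have "real (Suc l) \<le> real c" by simp
    then show "(1::nat) \<le> of_bool (real (Suc l) < (1 - \<epsilon>) * real (k i))" using less by simp
  qed
  also have "\<dots> \<le> target i"
    unfolding target_def using \<open>c \<le> n\<close> by (intro sum_mono2) auto
  finally have "c \<le> target i" .
  have "(\<Prod>j<n. if g j = i then factor \<gamma> x al S j else 1) = (\<Prod>j<n. (1 - \<epsilon>) ^ of_bool (S j \<and> g j = i))"
    using dead by (intro prod.cong refl) (auto simp: factor_def)
  also have "\<dots> = (1 - \<epsilon>) ^ c" unfolding c_def by (rule power_sum[symmetric])
  finally have "V i = (1 / (1 - \<epsilon>)) ^ target i * (1 - \<epsilon>) ^ c"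
    using inv i unfolding round_inv_def weight_def by simp
  also have "\<dots> = (1 / (1 - \<epsilon>)) ^ (target i - c)"
  proof -
    have "(1 / (1 - \<epsilon>)) ^ target i = (1 / (1 - \<epsilon>)) ^ (target i - c) * (1 / (1 - \<epsilon>)) ^ c"
      unfolding power_add[symmetric] using \<open>c \<le> target i\<close> by simp
    then show ?thesis using eps by (simp add: power_one_over)
  qed
  finally have "1 \<le> V i" using eps by (simp add: one_le_power)
  moreover have "V i \<le> (\<Sum>i<m. V i)"
    using i round_inv_V_pos[OF \<gamma> inv] by (intro member_le_sum) (auto simp: less_imp_le)
  ultimately show False using inv small unfolding round_inv_def by linarith
qed

end

text \<open>The exponent of the lower Chernoff tail: (1 - x) powr (-(1 - x)) * exp (-x) is at most
  exp (- x^2 / 2). The auxiliary function is twice the difference of the two sides; its derivative 2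
  * (- ln (1 - t) - t) is nonnegative.\<close>

lemma entropy_bound:
  fixes x :: real
  assumes "0 \<le> x" "x < 1"
  shows "- (1 - x) * ln (1 - x) \<le> x - x^2 / 2"
proof -
  define f where "f t = 2 * (1 - t) * ln (1 - t) + (2 * t - t^2)" for t :: real
  have "f 0 \<le> f x"
  proof (rule DERIV_nonneg_imp_nondecreasing[where f = f])
    fix t assume t: "0 \<le> t" "t \<le> x"
    have "(f has_real_derivative 2 * (- ln (1 - t) - t)) (at t)"
    proof -
      have "((\<lambda>t. ln (1 - t)) has_real_derivative - 1 / (1 - t)) (at t)"
        using t assms by (auto intro!: derivative_eq_intros)
      moreover have "((\<lambda>t. 2 * (1 - t)) has_real_derivative - 2) (at t)"
        "((\<lambda>t. 2 * t - t^2) has_real_derivative 2 - 2 * t) (at t)"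
        by (auto intro!: derivative_eq_intros)
      ultimately have "(f has_real_derivative - 2 * ln (1 - t) + - 1 / (1 - t) * (2 * (1 - t)) + (2 - 2 * t)) (at t)"
        unfolding f_def using DERIV_add[OF DERIV_mult] by blast
      moreover have "- 2 * ln (1 - t) + - 1 / (1 - t) * (2 * (1 - t)) + (2 - 2 * t) = 2 * (- ln (1 - t) - t)"
        using t assms by (simp add: field_simps)
      ultimately show ?thesis by (simp only:)
    qed
    moreover have "0 \<le> 2 * (- ln (1 - t) - t)"
      using ln_le_minus_one[of "1 - t"] t assms by simp
    ultimately show "\<exists>y. (f has_real_derivative y) (at t) \<and> 0 \<le> y" by blast
  qed (use assms in simp)
  then show ?thesis unfolding f_def by (simp add: algebra_simps)
qed

section \<open>Chernoff's bound for the initial potential\<close>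

context fair_indices
begin

lemma target_le: "real (target i) \<le> (1 - \<epsilon>) * real (k i)"
proof -
  let ?r = "(1 - \<epsilon>) * real (k i)"
  have "target i = card ({..<n} \<inter> {l. real (Suc l) < ?r})"
    unfolding target_def by (simp add: of_bool_def sum.If_cases)
  also have "\<dots> \<le> card {..<nat \<lfloor>?r\<rfloor>}"
  proof (rule card_mono)
    show "{..<n} \<inter> {l. real (Suc l) < ?r} \<subseteq> {..<nat \<lfloor>?r\<rfloor>}"
    proof
      fix l assume "l \<in> {..<n} \<inter> {l. real (Suc l) < ?r}"
      then have "int (Suc l) \<le> \<lfloor>?r\<rfloor>" by (simp add: le_floor_iff)
      then show "l \<in> {..<nat \<lfloor>?r\<rfloor>}" by simp
    qed
  qed simp
  finally have "target i \<le> nat \<lfloor>?r\<rfloor>" by simp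
  moreover have "0 \<le> ?r" using eps by simp
  ultimately show ?thesis by linarith
qed

lemma initial_potential_less:
  assumes \<gamma>: "0 < \<gamma>" and feas: "feasible \<gamma>" and inv: "mw_inv \<gamma> Z (n^8) w y x"
  shows "initial_potential \<gamma> x < 1"
proof -
  \<comment> \<open>With n^8 steps the bound is 2 * n^11, which is below the perfect square n^12; so
    every single multiplier is at most n^6.\<close>
  have sq: "(\<Sum>p<n. (w p)^2) + (\<Sum>i<n. (y i)^2) \<le> (n^6)^2"
  proof -
    have "(\<Sum>p<n. (w p)^2) + (\<Sum>i<n. (y i)^2) \<le> 2 * n^3 * n^8"
      using inv feas unfolding mw_inv_def by blast
    also have "\<dots> = 2 * n^11" by (simp flip: power_add)
    also have "\<dots> \<le> n * n^11" using n_ge by (intro mult_right_mono) auto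
    also have "\<dots> = (n^6)^2" by (simp flip: power_Suc power_mult)
    finally show ?thesis .
  qed
  have w: "w p \<le> n^6" if "p < n" for p
  proof (rule power2_le_imp_le)
    show "(w p)^2 \<le> (n^6)^2" using member_le_sum[of p "{..<n}" "\<lambda>p. (w p)^2"] that sq by simp
  qed simp
  have y: "y i \<le> n^6" if "i < n" for i
  proof (rule power2_le_imp_le)
    show "(y i)^2 \<le> (n^6)^2" using member_le_sum[of i "{..<n}" "\<lambda>i. (y i)^2"] that sq by simp
  qed simp
  \<comment> \<open>Dividing \<open>x\<close> by this, instead of by the number n^8 of steps, makes
    the packing constraints hold exactly and leaves a loss in the covering constraints only.\<close>
  define E where "E = real n^8 + real n^6"
  have E: "0 < E" unfolding E_def using n_ge by (simp add: add_pos_pos)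
  have X: "real (ball_mass \<gamma> x j) \<le> E" if "j < n" for j
  proof -
    have "ball_mass \<gamma> x j \<le> n^8 + w j"
      using inv feas that unfolding mw_inv_def ball_mass_def by blast
    then have "ball_mass \<gamma> x j \<le> n^8 + n^6" using w[OF that] by linarith
    then have "real (ball_mass \<gamma> x j) \<le> real (n^8 + n^6)" by (rule of_nat_mono)
    then show ?thesis unfolding E_def by simp
  qed
  define p where "p j = real (x j) / real (ball_mass \<gamma> x j)" for j
  have p: "real (x j) / E \<le> p j" if "j < n" for j
  proof (cases "x j = 0")
    case False
    then have "0 < ball_mass \<gamma> x j" using x_le_ball_mass[OF \<gamma> that, of x] by simp
    then show ?thesis unfolding p_def using X[OF that] by (intro divide_left_mono) (auto simp: E)
  qed (simp add: p_def)
  have less: "weight i * (\<Prod>j<n. if g j = i then qf \<gamma> x j else 1) < 1 / real m" if i: "i < m" for i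
  proof -
    let ?k = "real (k i)"
    define \<mu> where "\<mu> = (\<Sum>j<n. of_bool (g j = i) * p j)"
    \<comment> \<open>(n^8 * k - n^6) / (n^8 + n^6) is at least k - 1/2 precisely if 2 * k + 1 is at
      most n^2, which follows from k \<le> n and 3 \<le> n.\<close>
    have "?k - 1/2 \<le> \<mu>"
    proof -
      have "n^8 * k i \<le> y i + (\<Sum>j<n. of_bool (g j = i) * x j)"
        using inv feas i unfolding mw_inv_def by blast
      then have "n^8 * k i \<le> n^6 + (\<Sum>j<n. of_bool (g j = i) * x j)"
        using y[of i] i m_le by linarith
      then have "real (n^8 * k i) \<le> real (n^6 + (\<Sum>j<n. of_bool (g j = i) * x j))"
        by (rule of_nat_mono)
      then have "real n^8 * ?k - real n^6 \<le> (\<Sum>j<n. of_bool (g j = i) * real (x j))"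
        by (simp only: of_nat_mult of_nat_power of_nat_add of_nat_sum of_nat_of_bool)
      also have "\<dots> \<le> (\<Sum>j<n. of_bool (g j = i) * p j * E)"
        using p E by (intro sum_mono) (simp add: pos_divide_le_eq)
      also have "\<dots> = \<mu> * E" unfolding \<mu>_def sum_distrib_right ..
      finally have 1: "real n^8 * ?k - real n^6 \<le> \<mu> * E" .
      have "2 * ?k + 1 \<le> real n^2"
      proof -
        have "2 * k i + 1 \<le> 3 * n" using k_le[of i] n_ge by linarith
        also have "\<dots> \<le> n^2" unfolding power2_eq_square using n_ge by (intro mult_right_mono) auto
        finally have "real (2 * k i + 1) \<le> real (n^2)" by (rule of_nat_mono)
        then show ?thesis by simp
      qed
      then have "real n^6 * (2 * ?k + 1) \<le> real n^6 * real n^2" by (intro mult_left_mono) auto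
      then have "(?k - 1/2) * E \<le> real n^8 * ?k - real n^6"
        unfolding E_def by (simp add: algebra_simps flip: power_add)
      then show ?thesis using 1 E by (meson mult_le_cancel_right_pos order_trans)
    qed
    have "(\<Prod>j<n. if g j = i then qf \<gamma> x j else 1) \<le> (\<Prod>j<n. exp (- \<epsilon> * (of_bool (g j = i) * p j)))"
    proof (rule prod_mono)
      fix j assume "j \<in> {..<n}"
      then have "0 < qf \<gamma> x j" using qf_bounds[OF \<gamma>] by simp
      moreover have "qf \<gamma> x j \<le> exp (- \<epsilon> * p j)"
        using exp_ge_add_one_self[of "- \<epsilon> * p j"] unfolding qf_def p_def by simp
      ultimately show "0 \<le> (if g j = i then qf \<gamma> x j else 1) \<and>
          (if g j = i then qf \<gamma> x j else 1) \<le> exp (- \<epsilon> * (of_bool (g j = i) * p j))"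
        by simp
    qed
    also have "\<dots> = exp (- \<epsilon> * \<mu>)"
      unfolding \<mu>_def sum_distrib_left by (simp only: exp_sum finite_lessThan)
    also have "\<dots> \<le> exp (- \<epsilon> * (?k - 1/2))"
      using \<open>?k - 1/2 \<le> \<mu>\<close> eps by (simp add: mult_left_mono)
    finally have prod: "(\<Prod>j<n. if g j = i then qf \<gamma> x j else 1) \<le> exp (- \<epsilon> * (?k - 1/2))" .
    have "weight i = exp (real (target i) * - ln (1 - \<epsilon>))"
      unfolding weight_def using eps
      by (simp add: exp_of_nat_mult ln_div exp_minus inverse_eq_divide power_one_over)
    also have "\<dots> \<le> exp ((1 - \<epsilon>) * ?k * - ln (1 - \<epsilon>))"
      unfolding exp_le_cancel_iff using eps target_le[of i] by (intro mult_right_mono) auto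
    also have "\<dots> = exp (?k * (- (1 - \<epsilon>) * ln (1 - \<epsilon>)))" by (simp add: algebra_simps)
    also have "\<dots> \<le> exp (?k * (\<epsilon> - \<epsilon>^2 / 2))"
      unfolding exp_le_cancel_iff using entropy_bound[of \<epsilon>] eps by (intro mult_left_mono) auto
    finally have "weight i * (\<Prod>j<n. if g j = i then qf \<gamma> x j else 1) \<le>
        exp (?k * (\<epsilon> - \<epsilon>^2 / 2)) * exp (- \<epsilon> * (?k - 1/2))"
      using prod qf_bounds(3)[OF \<gamma>] by (intro mult_mono prod_nonneg) (auto simp: less_imp_le)
    also have "\<dots> = exp (\<epsilon> / 2 - \<epsilon>^2 * ?k / 2)"
      by (simp add: algebra_simps flip: exp_add)
    \<comment> \<open>The assumption bounds the exponent by 1/2 - 3/2 * ln (2 m). Half a logarithm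
      and the ln 2 on the right, both estimated by ln 2 \<ge> 2/3, outweigh the 1/2.\<close>
    also have "\<dots> < exp (ln 2 - ln (2 * real m))"
      unfolding exp_less_cancel_iff
    proof -
      have "3 * ln (2 * real m) \<le> \<epsilon>^2 * ?k"
        using k_ge[OF i] eps by (simp add: field_simps)
      moreover have "ln 2 \<le> ln (2 * real m)" using m_pos by simp
      ultimately show "\<epsilon> / 2 - \<epsilon>^2 * ?k / 2 < ln 2 - ln (2 * real m)"
        using eps ln2_ge_two_thirds by linarith
    qed
    also have "\<dots> = 1 / real m" using m_pos by (simp add: exp_diff)
    finally show ?thesis .
  qed
  have "initial_potential \<gamma> x < (\<Sum>i<m. 1 / real m)"
    unfolding initial_potential_def using less m_pos by (intro sum_strict_mono) auto
  then show ?thesis using m_pos by simp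
qed

end

section \<open>The program\<close>

text \<open>The model cannot multiply integers, so the offset of a row is looked up in a table of
  multiples of \<open>n\<close>.\<close>

abbreviation "dist_exp u v \<equiv> RVar ''d'' (NPlus (NVar ''row'' (Var u)) (Var v))"

abbreviation "rscalar a \<equiv> RVar a (N 0)"

abbreviation "one_minus_eps \<equiv> RMinus (OfNat (N 1)) (rscalar ''eps'')"

definition close_test :: "string \<Rightarrow> string \<Rightarrow> bexp" where
  "close_test u v = RLess (RTimes (OfNat (N 6)) (dist_exp u v)) (rscalar ''gamma'')"

definition eq_test :: "nexp \<Rightarrow> nexp \<Rightarrow> bexp" where
  "eq_test e1 e2 = BAnd (BNot (NLess e1 e2)) (BNot (NLess e2 e1))"

definition entry_test :: "string \<Rightarrow> string \<Rightarrow> bexp" where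
  "entry_test a v = NLess (N 0) (NVar a (Var v))"

definition sum_loop :: "string \<Rightarrow> bexp \<Rightarrow> nexp \<Rightarrow> lcom" where
  "sum_loop v b e =
     SetN ''c'' (N 0) (N 0) ;; For v (When b (SetN ''c'' (N 0) (NPlus (Var ''c'') e)))"

text \<open>The subtraction from 1 is truncated, so it turns the number of conflicts into the
  indicator of there being none. The condition l < j also keeps out entries left over from an
  earlier guess.\<close>

definition net_body :: lcom where
  "net_body =
     sum_loop ''l'' (BAnd (BAnd (NLess (Var ''l'') (Var ''j'')) (entry_test ''Z'' ''l''))
         (BAnd (eq_test (NVar ''group'' (Var ''l'')) (NVar ''group'' (Var ''j'')))
           (RLess (RTimes (OfNat (N 3)) (dist_exp ''j'' ''l'')) (rscalar ''gamma'')))) (N 1) ;;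
     SetN ''Z'' (Var ''j'') (NMinus (N 1) (Var ''c''))"

definition net_prog :: lcom where
  "net_prog = For ''j'' net_body"

definition mw_init :: lcom where
  "mw_init = For ''j'' (SetN ''w'' (Var ''j'') (N 0) ;; SetN ''y'' (Var ''j'') (N 0) ;;
     SetN ''x'' (Var ''j'') (N 0))"

definition choose_body :: lcom where
  "choose_body =
     sum_loop ''p'' (close_test ''p'' ''j'') (NVar ''w'' (Var ''p'')) ;;
     IfB (BAnd (entry_test ''Z'' ''j'') (NLess (Var ''c'') (NVar ''y'' (NVar ''group'' (Var ''j'')))))
       (SetN ''A'' (Var ''j'') (N 1)) (SetN ''A'' (Var ''j'') (N 0))"

definition choose_prog :: lcom where
  "choose_prog = For ''j'' choose_body"

text \<open>Adding all of \<open>k\<close> before subtracting ones gives the truncated difference of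
  \<open>mw_step\<close>: repeated truncated subtractions of 1 equal one of their number, whereas an
  addition in between could change the result. \<open>A\<close> is fixed beforehand, so this update
  and the one of \<open>w\<close> both react to the old multipliers.\<close>

definition cover_prog :: lcom where
  "cover_prog =
     For ''i'' (SetN ''y'' (Var ''i'') (NPlus (NVar ''y'' (Var ''i'')) (NVar ''k'' (Var ''i'')))) ;;
     For ''j'' (When (entry_test ''A'' ''j'')
       (SetN ''y'' (NVar ''group'' (Var ''j'')) (NMinus (NVar ''y'' (NVar ''group'' (Var ''j''))) (N 1)) ;;
        SetN ''x'' (Var ''j'') (NPlus (NVar ''x'' (Var ''j'')) (N 1))))"

definition pack_body :: lcom where
  "pack_body =
     For ''j'' (When (BAnd (close_test ''p'' ''j'') (entry_test ''A'' ''j''))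
       (SetN ''w'' (Var ''p'') (NPlus (NVar ''w'' (Var ''p'')) (N 1)))) ;;
     SetN ''w'' (Var ''p'') (NMinus (NVar ''w'' (Var ''p'')) (N 1))"

definition pack_prog :: lcom where
  "pack_prog = For ''p'' pack_body"

definition mw_round :: lcom where
  "mw_round = choose_prog ;; cover_prog ;; pack_prog"

text \<open>The body runs n^e times. The counters are t, tt, ttt and so on, because a loop must not
  modify the counter of a loop around it.\<close>

primrec rep :: "nat \<Rightarrow> lcom \<Rightarrow> lcom" where
  "rep 0 c = c"
| "rep (Suc e) c = For (CHR ''t'' # replicate e (CHR ''t'')) (rep e c)"

definition factor_body :: lcom where
  "factor_body =
     sum_loop ''l'' (close_test ''j'' ''l'') (NVar ''x'' (Var ''l'')) ;;
     SetR ''q'' (Var ''j'') (RMinus (OfNat (N 1)) (RTimes (rscalar ''eps'')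
       (RDivide (OfNat (NVar ''x'' (Var ''j''))) (OfNat (Var ''c''))))) ;;
     SetN ''al'' (Var ''j'') (NVar ''x'' (Var ''j'')) ;;
     SetN ''S'' (Var ''j'') (N 0)"

definition weight_body :: lcom where
  "weight_body =
     SetR ''V'' (Var ''i'') (OfNat (N 1)) ;;
     For ''l'' (When (RLess (OfNat (NPlus (Var ''l'') (N 1))) (RTimes one_minus_eps (OfNat (NVar ''k'' (Var ''i'')))))
       (SetR ''V'' (Var ''i'') (RTimes (RVar ''V'' (Var ''i'')) (RDivide (OfNat (N 1)) one_minus_eps))))"

definition round_init :: lcom where
  "round_init =
     For ''j'' factor_body ;; For ''i'' weight_body ;;
     For ''j'' (SetR ''V'' (NVar ''group'' (Var ''j''))
       (RTimes (RVar ''V'' (NVar ''group'' (Var ''j''))) (RVar ''q'' (Var ''j''))))"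

definition score_prog :: lcom where
  "score_prog =
     SetR ''sc'' (N 0) (OfNat (N 0)) ;;
     For ''j'' (When (BAnd (entry_test ''al'' ''j'') (close_test ''z'' ''j''))
       (SetR ''sc'' (N 0) (RPlus (rscalar ''sc'')
         (RTimes (RVar ''V'' (NVar ''group'' (Var ''j'')))
           (RMinus (RDivide (OfNat (N 1)) (RVar ''q'' (Var ''j''))) (OfNat (N 1))))))) ;;
     SetR ''sc'' (N 0) (RMinus (rscalar ''sc'')
       (RDivide (RTimes (RVar ''V'' (NVar ''group'' (Var ''z''))) (rscalar ''eps'')) (RVar ''q'' (Var ''z''))))"

text \<open>\<open>''al''\<close> can be cleared in the loop that reads it, as iteration
  \<open>j\<close> touches only entry \<open>j\<close>. For positive \<gamma> the ball of
  \<open>z\<close> contains \<open>z\<close>, so the factor of \<open>z\<close> is divided out as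
  well.\<close>

definition select_prog :: lcom where
  "select_prog =
     SetR ''V'' (NVar ''group'' (Var ''z'')) (RTimes (RVar ''V'' (NVar ''group'' (Var ''z''))) one_minus_eps) ;;
     For ''j'' (When (BAnd (entry_test ''al'' ''j'') (close_test ''z'' ''j''))
       (SetR ''V'' (NVar ''group'' (Var ''j''))
          (RDivide (RVar ''V'' (NVar ''group'' (Var ''j''))) (RVar ''q'' (Var ''j''))) ;;
        SetN ''al'' (Var ''j'') (N 0))) ;;
     SetN ''S'' (Var ''z'') (N 1)"

definition try_point :: lcom where
  "try_point = score_prog ;;
     When (BAnd (entry_test ''al'' ''z'') (BNot (RLess (OfNat (N 0)) (rscalar ''sc'')))) select_prog"

text \<open>A positive score may drop later, hence repeated passes. Each settles a point while one
  is undecided, so n passes suffice.\<close>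

definition rounding :: lcom where
  "rounding = For ''r'' (For ''z'' try_point)"

definition check_body :: lcom where
  "check_body =
     sum_loop ''j'' (BAnd (entry_test ''S'' ''j'') (eq_test (NVar ''group'' (Var ''j'')) (Var ''i''))) (N 1) ;;
     When (RLess (OfNat (Var ''c'')) (RTimes one_minus_eps (OfNat (NVar ''k'' (Var ''i'')))))
       (SetN ''ok'' (N 0) (N 0))"

definition check_prog :: lcom where
  "check_prog = SetN ''ok'' (N 0) (N 1) ;; For ''i'' check_body"

definition attempt :: lcom where
  "attempt = net_prog ;; mw_init ;; rep 8 mw_round ;; round_init ;; rounding ;; check_prog"

text \<open>\<open>''best''\<close> starts at 0, so the guard also discards zero distances and
  ensures \<gamma> > 0. An infeasible \<gamma> may succeed as well; its output is then separated
  even better.\<close>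

definition guess :: lcom where
  "guess =
     SetR ''gamma'' (N 0) (dist_exp ''a'' ''b'') ;;
     When (RLess (rscalar ''best'') (rscalar ''gamma''))
       (attempt ;;
        When (NLess (N 0) (Var ''ok''))
          (SetR ''best'' (N 0) (rscalar ''gamma'') ;;
           For ''j'' (SetN ''out'' (Var ''j'') (NVar ''S'' (Var ''j'')))))"

definition row_init :: lcom where
  "row_init = For ''j'' (SetN ''row'' (NPlus (Var ''j'') (N 1)) (NPlus (NVar ''row'' (Var ''j'')) (Var ''n'')))"

definition main_prog :: lcom where
  "main_prog = row_init ;; For ''a'' (For ''b'' guess)"

section \<open>Rules for programs that leave the input data unchanged\<close>

definition safe :: "lcom \<Rightarrow> bool" where
  "safe c \<longleftrightarrow> mods c \<inter> {''n'', ''group'', ''k'', ''row'', ''eps'', ''d''} = {}"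

lemma mods_sum_loop [simp]: "mods (sum_loop v b e) = {''c'', v, ''skip''}"
  by (auto simp: sum_loop_def)

lemma wf_sum_loop [simp]: "wf_lcom (sum_loop v b e) \<longleftrightarrow> v \<notin> {''n'', ''c'', ''skip''}"
  by (auto simp: sum_loop_def)

declare den.simps(5) [simp del]

context fair_indices
begin

definition base :: "state \<Rightarrow> bool" where
  "base s \<longleftrightarrow> nats s ''n'' 0 = n \<and> nats s ''group'' = g \<and> nats s ''k'' = k \<and> reals s ''eps'' 0 = \<epsilon> \<and>
     (\<forall>u<n. \<forall>v<n. reals s ''d'' (nats s ''row'' u + v) = D u v)"

lemma base_frame:
  assumes "base s" "mods c \<inter> {''n'', ''group'', ''k'', ''row'', ''eps'', ''d''} = {}"
    and "\<And>a. a \<notin> mods c \<Longrightarrow> nats s' a = nats s a" "\<And>a. a \<notin> mods c \<Longrightarrow> reals s' a = reals s a"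
  shows "base s'"
proof -
  have "''n'' \<notin> mods c" "''group'' \<notin> mods c" "''k'' \<notin> mods c" "''row'' \<notin> mods c"
    "''eps'' \<notin> mods c" "''d'' \<notin> mods c"
    using assms(2) by blast+
  then show ?thesis using assms(1) unfolding base_def by (simp add: assms(3,4))
qed

lemma base_den: "base s \<Longrightarrow> safe c \<Longrightarrow> base (den c s)"
  using base_frame[of s c "den c s"] den_frame unfolding safe_def by simp

lemma base_nwrite [simp]: "a \<notin> {''n'', ''group'', ''k'', ''row''} \<Longrightarrow> base (nwrite a i x s) = base s"
  by (auto simp: base_def)

lemma base_rwrite [simp]: "a \<notin> {''eps'', ''d''} \<Longrightarrow> base (rwrite a i r s) = base s"
  by (auto simp: base_def)

lemma baseD [simp]:
  assumes "base s"
  shows "nats s ''n'' 0 = n" "nats s ''group'' = g" "nats s ''k'' = k" "reals s ''eps'' 0 = \<epsilon>"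
    "u < n \<Longrightarrow> v < n \<Longrightarrow> reals s ''d'' (nats s ''row'' u + v) = D u v"
  using assms unfolding base_def by blast+

lemma bval_eq_test [simp]: "bval (eq_test e1 e2) s \<longleftrightarrow> nval e1 s = nval e2 s"
  by (auto simp: eq_test_def)

lemma bval_entry_test [simp]: "bval (entry_test a v) s \<longleftrightarrow> 0 < nats s a (nats s v 0)"
  by (simp add: entry_test_def)

lemma bval_close_test [simp]:
  "base s \<Longrightarrow> nats s u 0 < n \<Longrightarrow> nats s v 0 < n \<Longrightarrow>
    bval (close_test u v) s \<longleftrightarrow> close (reals s ''gamma'' 0) (nats s u 0) (nats s v 0)"
  by (simp add: close_test_def close_def)

lemma For_base:
  assumes b: "base s" and wf: "wf_lcom (For v c)" and safe: "safe (For v c)"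
    and init: "I 0 s"
    and step: "\<And>j s'. \<lbrakk>j < n; I j s'; nats s' v 0 = j; base s';
        \<And>a. a \<notin> mods (For v c) \<Longrightarrow> nats s' a = nats s a;
        \<And>a. a \<notin> mods (For v c) \<Longrightarrow> reals s' a = reals s a\<rbrakk> \<Longrightarrow> I (Suc j) (den c s')"
    and indep: "\<And>j s' x. I j s' \<Longrightarrow> I j (nwrite v 0 x s')"
  shows "I n (den (For v c) s)"
proof (rule For_rule[where I = I])
  show "nats s ''n'' 0 = n" using b by simp
next
  fix j s'
  assume *: "j < n" "I j s'" "nats s' v 0 = j"
    "\<And>a. a \<notin> mods (For v c) \<Longrightarrow> nats s' a = nats s a"
    "\<And>a. a \<notin> mods (For v c) \<Longrightarrow> reals s' a = reals s a"
  have "base s'" by (rule base_frame[OF b safe[unfolded safe_def] *(4,5)])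
  from step[OF *(1-3) this *(4,5)] show "I (Suc j) (den c s')" .
qed (fact wf init indep)+

lemma den_sum_loop:
  assumes b: "base s" and v: "v \<notin> {''n'', ''c'', ''skip'', ''group'', ''k'', ''row'', ''eps'', ''d''}"
    and eval: "\<And>j s'. \<lbrakk>j < n; base s'; nats s' v 0 = j;
        \<And>a. a \<notin> {''c'', v, ''skip''} \<Longrightarrow> nats s' a = nats s a;
        \<And>a. reals s' a = reals s a\<rbrakk>
      \<Longrightarrow> (bval t s' \<longleftrightarrow> P j) \<and> nval e s' = f j"
  shows "nats (den (sum_loop v t e) s) ''c'' 0 = (\<Sum>j<n. of_bool (P j) * f j)"
proof -
  let ?s = "nwrite ''c'' 0 0 s"
  let ?body = "When t (SetN ''c'' (N 0) (NPlus (Var ''c'') e))"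
  define I where "I j s' \<longleftrightarrow> nats s' ''c'' 0 = (\<Sum>l<j. of_bool (P l) * f l) \<and> reals s' = reals s" for j and s' :: state
  have "I n (den (For v ?body) ?s)"
  proof (rule For_base)
    fix j s'
    assume j: "j < n" and I: "I j s'" and vj: "nats s' v 0 = j" and b': "base s'"
      and fr: "\<And>a. a \<notin> mods (For v ?body) \<Longrightarrow> nats s' a = nats ?s a"
    have "nats s' a = nats s a" if "a \<notin> {''c'', v, ''skip''}" for a
      using fr[of a] that by simp
    then have "bval t s' \<longleftrightarrow> P j" "nval e s' = f j"
      using eval[OF j b' vj] I unfolding I_def by simp_all
    then show "I (Suc j) (den ?body s')" using I unfolding I_def by simp
  qed (use b v in \<open>auto simp: I_def safe_def\<close>)
  then show ?thesis unfolding I_def sum_loop_def by simp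
qed

section \<open>Correctness of the thinning and of one subgradient step\<close>

lemma net_prog_correct:
  assumes b: "base s" and \<gamma>: "reals s ''gamma'' 0 = \<gamma>"
  shows "is_net \<gamma> (\<lambda>j. 0 < nats (den net_prog s) ''Z'' j)"
proof -
  define I where "I j s' \<longleftrightarrow> (\<forall>j'<j. 0 < nats s' ''Z'' j' \<longleftrightarrow>
    \<not> (\<exists>l<j'. 0 < nats s' ''Z'' l \<and> g l = g j' \<and> 3 * D j' l < \<gamma>))" for j and s' :: state
  have "I n (den net_prog s)"
    unfolding net_prog_def
  proof (rule For_base[OF b])
    fix j s'
    assume j: "j < n" and I: "I j s'" and vj: "nats s' ''j'' 0 = j" and b': "base s'"
      and fr: "\<And>a. a \<notin> mods (For ''j'' net_body) \<Longrightarrow> reals s' a = reals s a"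
    have \<gamma>': "reals s' ''gamma'' 0 = \<gamma>" using fr[of "''gamma''"] \<gamma> by (simp add: net_body_def)
    let ?P = "\<lambda>l. l < j \<and> 0 < nats s' ''Z'' l \<and> g l = g j \<and> 3 * D j l < \<gamma>"
    define inner where "inner = sum_loop ''l'' (BAnd (BAnd (NLess (Var ''l'') (Var ''j'')) (entry_test ''Z'' ''l''))
         (BAnd (eq_test (NVar ''group'' (Var ''l'')) (NVar ''group'' (Var ''j'')))
           (RLess (RTimes (OfNat (N 3)) (dist_exp ''j'' ''l'')) (rscalar ''gamma'')))) (N 1)"
    have c: "nats (den inner s') ''c'' 0 = (\<Sum>l<n. of_bool (?P l) * 1)"
      unfolding inner_def by (rule den_sum_loop[OF b']) (use b' j vj \<gamma>' in simp_all)
    have "0 < nats (den inner s') ''c'' 0 \<longleftrightarrow> (\<exists>l<j. ?P l)"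
    proof -
      have "(\<Sum>l<n. of_bool (?P l) * 1) = (0::nat) \<longleftrightarrow> (\<forall>l<n. \<not> ?P l)"
        unfolding sum_eq_0_iff[OF finite_lessThan] by auto
      moreover have "(\<forall>l<n. \<not> ?P l) \<longleftrightarrow> \<not> (\<exists>l<j. ?P l)"
        using j by (auto dest: order.strict_trans)
      ultimately show ?thesis unfolding c by (simp only: neq0_conv[symmetric] not_not)
    qed
    moreover have f2: "nats (den inner s') ''Z'' = nats s' ''Z''" "nats (den inner s') ''j'' = nats s' ''j''"
      by (simp_all add: den_frame inner_def)
    moreover have "den net_body s' = nwrite ''Z'' j (1 - nats (den inner s') ''c'' 0) (den inner s')"
      unfolding net_body_def inner_def[symmetric] using f2 vj by simp
    ultimately show "I (Suc j) (den net_body s')"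
      using I unfolding I_def by (auto simp: less_Suc_eq)
  qed (simp_all add: I_def safe_def net_body_def)
  then show ?thesis unfolding I_def is_net_def .
qed


lemma choose_prog_correct:
  assumes b: "base s" and \<gamma>: "reals s ''gamma'' 0 = \<gamma>" and j: "j < n"
  shows "0 < nats (den choose_prog s) ''A'' j \<longleftrightarrow>
    mw_chosen \<gamma> (\<lambda>j. 0 < nats s ''Z'' j) (nats s ''w'') (nats s ''y'') j"
proof -
  let ?C = "mw_chosen \<gamma> (\<lambda>j. 0 < nats s ''Z'' j) (nats s ''w'') (nats s ''y'')"
  define I where "I j s' \<longleftrightarrow> (\<forall>l<j. 0 < nats s' ''A'' l \<longleftrightarrow> ?C l)" for j and s' :: state
  have "I n (den choose_prog s)"
    unfolding choose_prog_def
  proof (rule For_base[OF b])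
    fix j s'
    assume j: "j < n" and I: "I j s'" and vj: "nats s' ''j'' 0 = j" and b': "base s'"
      and frn: "\<And>a. a \<notin> mods (For ''j'' choose_body) \<Longrightarrow> nats s' a = nats s a"
      and frr: "\<And>a. a \<notin> mods (For ''j'' choose_body) \<Longrightarrow> reals s' a = reals s a"
    have e: "reals s' ''gamma'' 0 = \<gamma>" "nats s' ''w'' = nats s ''w''" "nats s' ''y'' = nats s ''y''"
      "nats s' ''Z'' = nats s ''Z''"
      using frr[of "''gamma''"] frn[of "''w''"] frn[of "''y''"] frn[of "''Z''"] \<gamma>
      by (simp_all add: choose_body_def)
    define inner where "inner = sum_loop ''p'' (close_test ''p'' ''j'') (NVar ''w'' (Var ''p''))"
    have c: "nats (den inner s') ''c'' 0 = (\<Sum>p<n. of_bool (close \<gamma> p j) * nats s ''w'' p)"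
      unfolding inner_def by (rule den_sum_loop[OF b']) (use j vj e in simp_all)
    have f: "nats (den inner s') ''Z'' = nats s ''Z''" "nats (den inner s') ''j'' 0 = j"
      "nats (den inner s') ''y'' = nats s ''y''" "nats (den inner s') ''A'' = nats s' ''A''"
      using e vj by (simp_all add: den_frame inner_def)
    have "base (den inner s')" using b' by (rule base_den) (simp add: inner_def safe_def)
    then have "den choose_body s' = nwrite ''A'' j (of_bool (?C j)) (den inner s')"
      unfolding choose_body_def inner_def[symmetric] mw_chosen_def using f c by simp
    then show "I (Suc j) (den choose_body s')"
      using I f unfolding I_def by (auto simp: less_Suc_eq)
  qed (simp_all add: I_def safe_def choose_body_def)
  then show ?thesis using j unfolding I_def by blast
qed

lemma cover_prog_correct:
  assumes b: "base s"
  shows "i < n \<Longrightarrow> nats (den cover_prog s) ''y'' i =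
      nats s ''y'' i + k i - (\<Sum>j<n. of_bool (0 < nats s ''A'' j \<and> g j = i))"
    and "j < n \<Longrightarrow> nats (den cover_prog s) ''x'' j = nats s ''x'' j + of_bool (0 < nats s ''A'' j)"
proof -
  define c1 where "c1 = For ''i'' (SetN ''y'' (Var ''i'') (NPlus (NVar ''y'' (Var ''i'')) (NVar ''k'' (Var ''i''))))"
  define body where "body = When (entry_test ''A'' ''j'')
       (SetN ''y'' (NVar ''group'' (Var ''j'')) (NMinus (NVar ''y'' (NVar ''group'' (Var ''j''))) (N 1)) ;;
        SetN ''x'' (Var ''j'') (NPlus (NVar ''x'' (Var ''j'')) (N 1)))"
  define I1 where "I1 j s' \<longleftrightarrow> (\<forall>i. nats s' ''y'' i = nats s ''y'' i + (if i < j then k i else 0))" for j and s' :: state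
  have 1: "I1 n (den c1 s)"
    unfolding c1_def by (rule For_base[OF b]) (auto simp: I1_def safe_def less_Suc_eq)
  let ?s = "den c1 s"
  have b1: "base ?s" using b by (rule base_den) (simp add: c1_def safe_def)
  have f1: "nats ?s ''A'' = nats s ''A''" "nats ?s ''x'' = nats s ''x''"
    by (simp_all add: den_frame c1_def)
  define I2 where "I2 j s' \<longleftrightarrow>
      (\<forall>i. nats s' ''y'' i = nats ?s ''y'' i - (\<Sum>l<j. of_bool (0 < nats s ''A'' l \<and> g l = i))) \<and>
      (\<forall>l. nats s' ''x'' l = nats s ''x'' l + of_bool (l < j \<and> 0 < nats s ''A'' l))" for j and s' :: state
  have 2: "I2 n (den (For ''j'' body) ?s)"
  proof (rule For_base[OF b1])
    fix j s'
    assume j: "j < n" and I: "I2 j s'" and vj: "nats s' ''j'' 0 = j" and b': "base s'"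
      and frn: "\<And>a. a \<notin> mods (For ''j'' body) \<Longrightarrow> nats s' a = nats ?s a"
    have "nats s' ''A'' = nats s ''A''" using frn[of "''A''"] f1 by (simp add: body_def)
    then show "I2 (Suc j) (den body s')"
      using I vj b' unfolding I2_def body_def by (auto simp: less_Suc_eq)
  qed (use f1 in \<open>simp_all add: I2_def safe_def body_def\<close>)
  have eq: "den cover_prog s = den (For ''j'' body) ?s"
    by (simp add: cover_prog_def c1_def body_def)
  show "nats (den cover_prog s) ''y'' i =
      nats s ''y'' i + k i - (\<Sum>j<n. of_bool (0 < nats s ''A'' j \<and> g j = i))" if "i < n"
    using 1 2 that unfolding I1_def I2_def eq by (simp only: if_True)
  show "nats (den cover_prog s) ''x'' j = nats s ''x'' j + of_bool (0 < nats s ''A'' j)" if "j < n"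
    using 2 that unfolding I2_def eq by simp
qed

lemma pack_prog_correct:
  assumes b: "base s" and \<gamma>: "reals s ''gamma'' 0 = \<gamma>" and p: "p < n"
  shows "nats (den pack_prog s) ''w'' p =
    nats s ''w'' p + (\<Sum>j<n. of_bool (close \<gamma> p j \<and> 0 < nats s ''A'' j)) - 1"
proof -
  let ?L = "\<lambda>p. \<Sum>j<n. of_bool (close \<gamma> p j \<and> 0 < nats s ''A'' j)"
  define I where "I q s' \<longleftrightarrow> (\<forall>p. nats s' ''w'' p = (if p < q then nats s ''w'' p + ?L p - 1 else nats s ''w'' p))"
    for q and s' :: state
  have "I n (den pack_prog s)"
    unfolding pack_prog_def
  proof (rule For_base[OF b])
    fix p s'
    assume p: "p < n" and I: "I p s'" and vp: "nats s' ''p'' 0 = p" and b': "base s'"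
      and frn: "\<And>a. a \<notin> mods (For ''p'' pack_body) \<Longrightarrow> nats s' a = nats s a"
      and frr: "\<And>a. a \<notin> mods (For ''p'' pack_body) \<Longrightarrow> reals s' a = reals s a"
    have e: "reals s' ''gamma'' 0 = \<gamma>" "nats s' ''A'' = nats s ''A''"
      using frr[of "''gamma''"] frn[of "''A''"] \<gamma> by (simp_all add: pack_body_def)
    define body where "body = When (BAnd (close_test ''p'' ''j'') (entry_test ''A'' ''j''))
       (SetN ''w'' (Var ''p'') (NPlus (NVar ''w'' (Var ''p'')) (N 1)))"
    define I2 where "I2 j t \<longleftrightarrow> nats t ''w'' = (nats s' ''w'')(p := nats s ''w'' p +
        (\<Sum>l<j. of_bool (close \<gamma> p l \<and> 0 < nats s ''A'' l)))" for j and t :: state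
    have 2: "I2 n (den (For ''j'' body) s')"
    proof (rule For_base[OF b'])
      fix j t
      assume j: "j < n" and I: "I2 j t" and vj: "nats t ''j'' 0 = j" and bt: "base t"
        and frn: "\<And>a. a \<notin> mods (For ''j'' body) \<Longrightarrow> nats t a = nats s' a"
        and frr: "\<And>a. a \<notin> mods (For ''j'' body) \<Longrightarrow> reals t a = reals s' a"
      have "nats t ''A'' = nats s ''A''" "nats t ''p'' 0 = p" "reals t ''gamma'' 0 = \<gamma>"
        using frr[of "''gamma''"] frn[of "''A''"] frn[of "''p''"] e vp by (simp_all add: body_def)
      then show "I2 (Suc j) (den body t)"
        using I vj bt p j unfolding I2_def body_def by simp
    qed (use I in \<open>simp_all add: I2_def I_def safe_def body_def fun_upd_idem\<close>)
    have "nats (den (For ''j'' body) s') ''p'' 0 = p"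
      using vp by (simp add: den_frame body_def)
    then have "nats (den pack_body s') ''w'' = (nats s' ''w'')(p := nats s ''w'' p + ?L p - 1)"
      unfolding pack_body_def body_def[symmetric] den.simps(3) using 2 unfolding I2_def by simp
    then show "I (Suc p) (den pack_body s')"
      using I unfolding I_def by (simp add: less_Suc_eq)
  qed (simp_all add: I_def safe_def pack_body_def)
  then show ?thesis using p unfolding I_def by simp
qed


lemma mw_round_correct:
  assumes b: "base s" and \<gamma>: "reals s ''gamma'' 0 = \<gamma>" and "0 < \<gamma>"
    and Z: "Z = (\<lambda>j. 0 < nats s ''Z'' j)" "is_net \<gamma> Z"
    and inv: "mw_inv \<gamma> Z t (nats s ''w'') (nats s ''y'') (nats s ''x'')"
  shows "mw_inv \<gamma> Z (Suc t) (nats (den mw_round s) ''w'') (nats (den mw_round s) ''y'') (nats (den mw_round s) ''x'')"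
proof (rule mw_inv_step[OF Z(2) \<open>0 < \<gamma>\<close> inv])
  define s1 where "s1 = den choose_prog s"
  define s2 where "s2 = den cover_prog s1"
  have s3: "den mw_round s = den pack_prog s2" by (simp add: mw_round_def s1_def s2_def)
  have b1: "base s1" unfolding s1_def
    by (rule base_den[OF b]) (simp add: safe_def choose_prog_def choose_body_def)
  have b2: "base s2" unfolding s2_def
    by (rule base_den[OF b1]) (simp add: safe_def cover_prog_def)
  have f1: "nats s1 ''w'' = nats s ''w''" "nats s1 ''y'' = nats s ''y''" "nats s1 ''x'' = nats s ''x''"
    "reals s1 ''gamma'' 0 = \<gamma>"
    using \<gamma> by (simp_all add: s1_def den_frame choose_prog_def choose_body_def)
  have f2: "nats s2 ''w'' = nats s ''w''" "nats s2 ''A'' = nats s1 ''A''" "reals s2 ''gamma'' 0 = \<gamma>"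
    using f1 by (simp_all add: s2_def den_frame cover_prog_def)
  have f3: "nats (den pack_prog s2) ''y'' = nats s2 ''y''" "nats (den pack_prog s2) ''x'' = nats s2 ''x''"
    by (simp_all add: den_frame pack_prog_def pack_body_def)
  let ?C = "mw_chosen \<gamma> Z (nats s ''w'') (nats s ''y'')"
  have A: "0 < nats s1 ''A'' j \<longleftrightarrow> ?C j" if "j < n" for j
    using choose_prog_correct[OF b \<gamma> that] unfolding s1_def Z(1) .
  show "mw_step \<gamma> Z (nats s ''w'') (nats s ''y'') (nats s ''x'')
      (nats (den mw_round s) ''w'') (nats (den mw_round s) ''y'') (nats (den mw_round s) ''x'')"
    unfolding mw_step_def Let_def s3 f3
  proof (intro conjI allI impI)
    fix p assume "p < n"
    have "(\<Sum>j<n. of_bool (close \<gamma> p j \<and> 0 < nats s1 ''A'' j)) = (\<Sum>j<n. of_bool (close \<gamma> p j \<and> ?C j) :: nat)"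
      using A by (intro sum.cong refl) simp
    then show "nats (den pack_prog s2) ''w'' p = nats s ''w'' p + (\<Sum>j<n. of_bool (close \<gamma> p j \<and> ?C j)) - 1"
      using pack_prog_correct[OF b2 f2(3) \<open>p < n\<close>] unfolding f2 by (simp only:)
  next
    fix i assume "i < n"
    have "(\<Sum>j<n. of_bool (0 < nats s1 ''A'' j \<and> g j = i)) = (\<Sum>j<n. of_bool (?C j \<and> g j = i) :: nat)"
      using A by (intro sum.cong refl) simp
    then show "nats s2 ''y'' i = nats s ''y'' i + k i - (\<Sum>j<n. of_bool (?C j \<and> g j = i))"
      using cover_prog_correct(1)[OF b1 \<open>i < n\<close>] unfolding f1 s2_def by (simp only:)
  next
    fix j assume "j < n"
    then show "nats s2 ''x'' j = nats s ''x'' j + of_bool (?C j)"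
      using cover_prog_correct(2)[OF b1 \<open>j < n\<close>] A[of j] unfolding f1 s2_def by simp
  qed
qed

end

section \<open>Nested loops and the whole subgradient phase\<close>

lemma mods_rep:
  "mods (rep e c) = mods c \<union> (\<lambda>i. CHR ''t'' # replicate i (CHR ''t'')) ` {..<e}"
  by (induction e) (auto simp: lessThan_Suc)

lemma wf_rep:
  assumes "wf_lcom c" "\<And>i. CHR ''t'' # replicate i (CHR ''t'') \<notin> mods c"
  shows "wf_lcom (rep e c)"
proof (induction e)
  case (Suc e)
  have "replicate e (CHR ''t'') \<noteq> replicate i (CHR ''t'')" if "i < e" for i
    using that by (metis length_replicate nat_neq_iff)
  then have "CHR ''t'' # replicate e (CHR ''t'') \<notin> mods (rep e c)"
    using assms(2) unfolding mods_rep by auto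
  then show ?case using Suc by simp
qed (use assms in simp)

text \<open>The index counts executions of the body across all levels: one iteration around
  \<open>rep e\<close> advances it by n^e.\<close>

lemma rep_rule:
  assumes wf: "wf_lcom c" "\<And>i. CHR ''t'' # replicate i (CHR ''t'') \<notin> mods c"
    and size: "\<And>t s. I t s \<Longrightarrow> nats s ''n'' 0 = n"
    and step: "\<And>t s. I t s \<Longrightarrow> I (Suc t) (den c s)"
    and indep: "\<And>t s i x. I t s \<Longrightarrow> I t (nwrite (CHR ''t'' # replicate i (CHR ''t'')) 0 x s)"
  shows "I t s \<Longrightarrow> I (t + n ^ e) (den (rep e c) s)"
proof (induction e arbitrary: t s)
  case 0
  then show ?case using step[of t s] by simp
next
  case (Suc e)
  have "I (t + n * n ^ e) (den (rep (Suc e) c) s)"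
    unfolding rep.simps
  proof (rule For_rule[where I = "\<lambda>j s. I (t + j * n ^ e) s"])
    show "nats s ''n'' 0 = n" using size Suc.prems by blast
    show "wf_lcom (For (CHR ''t'' # replicate e (CHR ''t'')) (rep e c))"
      using wf_rep[OF wf, of "Suc e"] by simp
    show "I (t + 0 * n ^ e) s" using Suc.prems by simp
    show "I (t + Suc j * n ^ e) (den (rep e c) s')" if "I (t + j * n ^ e) s'" for j s'
      using Suc.IH[OF that] by (simp add: algebra_simps)
    show "I (t + j * n ^ e) (nwrite (CHR ''t'' # replicate e (CHR ''t'')) 0 x s')" if "I (t + j * n ^ e) s'" for j s' x
      using indep[OF that] .
  qed
  then show ?case by simp
qed

context fair_indices
begin

lemma mw_phase_correct:
  assumes b: "base s" and \<gamma>: "reals s ''gamma'' 0 = \<gamma>" and pos: "0 < \<gamma>"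
    and Z: "Z = (\<lambda>j. 0 < nats s ''Z'' j)" "is_net \<gamma> Z"
  defines "s' \<equiv> den (rep 8 mw_round) (den mw_init s)"
  shows "mw_inv \<gamma> Z (n^8) (nats s' ''w'') (nats s' ''y'') (nats s' ''x'')" "base s'" "reals s' ''gamma'' 0 = \<gamma>"
proof -
  define J where "J t s' \<longleftrightarrow> base s' \<and> reals s' ''gamma'' 0 = \<gamma> \<and> nats s' ''Z'' = nats s ''Z'' \<and>
    mw_inv \<gamma> Z t (nats s' ''w'') (nats s' ''y'') (nats s' ''x'')" for t and s' :: state
  have "J 0 (den mw_init s)"
  proof -
    define I where "I j s' \<longleftrightarrow> (\<forall>l<j. nats s' ''w'' l = 0 \<and> nats s' ''y'' l = 0 \<and> nats s' ''x'' l = 0)"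
      for j and s' :: state
    have "I n (den mw_init s)"
      unfolding mw_init_def by (rule For_base[OF b]) (auto simp: I_def safe_def less_Suc_eq)
    then have "mw_inv \<gamma> Z 0 (nats (den mw_init s) ''w'') (nats (den mw_init s) ''y'') (nats (den mw_init s) ''x'')"
      unfolding I_def by (intro mw_inv_0) blast
    moreover have "base (den mw_init s)" by (rule base_den[OF b]) (simp add: safe_def mw_init_def)
    ultimately show ?thesis using \<gamma> unfolding J_def by (simp add: den_frame mw_init_def)
  qed
  then have "J (0 + n^8) s'"
    unfolding s'_def
  proof (rule rep_rule[where I = J, rotated -1])
    show "wf_lcom mw_round"
      by (simp add: mw_round_def choose_prog_def choose_body_def cover_prog_def pack_prog_def pack_body_def)
    show "CHR ''t'' # replicate i (CHR ''t'') \<notin> mods mw_round" for i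
      by (simp add: mw_round_def choose_prog_def choose_body_def cover_prog_def pack_prog_def pack_body_def)
    show "nats t ''n'' 0 = n" if "J u t" for u t using that unfolding J_def by simp
    show "J (Suc u) (den mw_round t)" if J: "J u t" for u t
    proof -
      have "mw_inv \<gamma> Z (Suc u) (nats (den mw_round t) ''w'') (nats (den mw_round t) ''y'') (nats (den mw_round t) ''x'')"
        using J Z pos unfolding J_def by (intro mw_round_correct) simp_all
      moreover have "base (den mw_round t)"
        using J unfolding J_def
        by (intro base_den) (simp_all add: safe_def mw_round_def choose_prog_def choose_body_def cover_prog_def pack_prog_def pack_body_def)
      ultimately show ?thesis
        using J unfolding J_def
        by (simp add: den_frame mw_round_def choose_prog_def choose_body_def cover_prog_def pack_prog_def pack_body_def del: den.simps)
    qed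
    show "J u (nwrite (CHR ''t'' # replicate i (CHR ''t'')) 0 x t)" if "J u t" for u t i x
      using that unfolding J_def by simp
  qed
  then show "mw_inv \<gamma> Z (n^8) (nats s' ''w'') (nats s' ''y'') (nats s' ''x'')" "base s'" "reals s' ''gamma'' 0 = \<gamma>"
    unfolding J_def by simp_all
qed

section \<open>Correctness of the rounding\<close>

lemma factor_loop_correct:
  assumes b: "base s" and \<gamma>: "reals s ''gamma'' 0 = \<gamma>" and j: "j < n"
  defines "s' \<equiv> den (For ''j'' factor_body) s"
  shows "reals s' ''q'' j = qf \<gamma> (nats s ''x'') j \<and> nats s' ''al'' j = nats s ''x'' j \<and> nats s' ''S'' j = 0"
proof -
  define I where "I j s' \<longleftrightarrow> (\<forall>l<j. reals s' ''q'' l = qf \<gamma> (nats s ''x'') l \<and>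
      nats s' ''al'' l = nats s ''x'' l \<and> nats s' ''S'' l = 0)" for j and s' :: state
  have "I n s'"
    unfolding s'_def
  proof (rule For_base[OF b])
    fix j s'
    assume j: "j < n" and I: "I j s'" and vj: "nats s' ''j'' 0 = j" and b': "base s'"
      and frn: "\<And>a. a \<notin> mods (For ''j'' factor_body) \<Longrightarrow> nats s' a = nats s a"
      and frr: "\<And>a. a \<notin> mods (For ''j'' factor_body) \<Longrightarrow> reals s' a = reals s a"
    have e: "reals s' ''gamma'' 0 = \<gamma>" "nats s' ''x'' = nats s ''x''"
      using frr[of "''gamma''"] frn[of "''x''"] \<gamma> by (simp_all add: factor_body_def)
    define inner where "inner = sum_loop ''l'' (close_test ''j'' ''l'') (NVar ''x'' (Var ''l''))"
    have "nats (den inner s') ''c'' 0 = (\<Sum>l<n. of_bool (close \<gamma> j l) * nats s ''x'' l)"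
      unfolding inner_def by (rule den_sum_loop[OF b']) (use j vj e in simp_all)
    then have c: "nats (den inner s') ''c'' 0 = ball_mass \<gamma> (nats s ''x'') j"
      unfolding ball_mass_def .
    have f: "nats (den inner s') ''x'' = nats s ''x''" "nats (den inner s') ''j'' 0 = j"
      "nats (den inner s') ''al'' = nats s' ''al''" "nats (den inner s') ''S'' = nats s' ''S''"
      "reals (den inner s') ''q'' = reals s' ''q''"
      using e vj by (simp_all add: den_frame inner_def)
    have "base (den inner s')" using b' by (rule base_den) (simp add: inner_def safe_def)
    then have "den factor_body s' = nwrite ''S'' j 0 (nwrite ''al'' j (nats s ''x'' j)
        (rwrite ''q'' j (qf \<gamma> (nats s ''x'') j) (den inner s')))"
      unfolding factor_body_def inner_def[symmetric] qf_def using f c by simp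
    then show "I (Suc j) (den factor_body s')"
      using I f unfolding I_def by (auto simp: less_Suc_eq)
  qed (simp_all add: I_def safe_def factor_body_def)
  then show ?thesis using j unfolding I_def by blast
qed

lemma weight_loop_correct:
  assumes b: "base s" and i: "i < n"
  shows "reals (den (For ''i'' weight_body) s) ''V'' i = weight i"
proof -
  define I where "I i s' \<longleftrightarrow> (\<forall>l<i. reals s' ''V'' l = weight l)" for i and s' :: state
  have "I n (den (For ''i'' weight_body) s)"
  proof (rule For_base[OF b])
    fix i s'
    assume i: "i < n" and I: "I i s'" and vi: "nats s' ''i'' 0 = i" and b': "base s'"
    define body where "body = When (RLess (OfNat (NPlus (Var ''l'') (N 1))) (RTimes one_minus_eps (OfNat (NVar ''k'' (Var ''i'')))))
       (SetR ''V'' (Var ''i'') (RTimes (RVar ''V'' (Var ''i'')) (RDivide (OfNat (N 1)) one_minus_eps)))"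
    define I2 where "I2 j t \<longleftrightarrow> reals t ''V'' = (reals s' ''V'')
        (i := (1 / (1 - \<epsilon>)) ^ (\<Sum>l<j. of_bool (real (Suc l) < (1 - \<epsilon>) * real (k i))))" for j and t :: state
    let ?s = "rwrite ''V'' i 1 s'"
    have 2: "I2 n (den (For ''l'' body) ?s)"
    proof (rule For_base)
      fix l t
      assume I: "I2 l t" and vl: "nats t ''l'' 0 = l" and bt: "base t"
        and frn: "\<And>a. a \<notin> mods (For ''l'' body) \<Longrightarrow> nats t a = nats ?s a"
      have "nats t ''i'' 0 = i" using frn[of "''i''"] vi by (simp add: body_def)
      then show "I2 (Suc l) (den body t)"
        using I vl bt unfolding I2_def body_def by (simp add: add.commute)
    qed (use b' in \<open>simp_all add: I2_def safe_def body_def\<close>)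
    have "den weight_body s' = den (For ''l'' body) ?s"
      using vi by (simp add: weight_body_def body_def)
    then show "I (Suc i) (den weight_body s')"
      using I 2 unfolding I_def I2_def weight_def target_def by (simp add: less_Suc_eq)
  qed (simp_all add: I_def safe_def weight_body_def)
  then show ?thesis using i unfolding I_def by blast
qed

lemma round_init_correct:
  assumes b: "base s" and \<gamma>: "reals s ''gamma'' 0 = \<gamma>" and pos: "0 < \<gamma>"
  defines "s' \<equiv> den round_init s"
  shows "round_inv \<gamma> (nats s ''x'') (\<lambda>j. 0 < nats s' ''al'' j) (\<lambda>j. 0 < nats s' ''S'' j) (reals s' ''V'')"
    and "\<And>j. j < n \<Longrightarrow> reals s' ''q'' j = qf \<gamma> (nats s ''x'') j"
proof -
  define body where "body = SetR ''V'' (NVar ''group'' (Var ''j''))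
       (RTimes (RVar ''V'' (NVar ''group'' (Var ''j''))) (RVar ''q'' (Var ''j'')))"
  define s1 where "s1 = den (For ''j'' factor_body) s"
  define s2 where "s2 = den (For ''i'' weight_body) s1"
  have s': "s' = den (For ''j'' body) s2"
    by (simp add: s'_def round_init_def s1_def s2_def body_def)
  have b1: "base s1" unfolding s1_def by (rule base_den[OF b]) (simp add: safe_def factor_body_def)
  have b2: "base s2" unfolding s2_def by (rule base_den[OF b1]) (simp add: safe_def weight_body_def)
  have f2: "nats s2 ''al'' = nats s1 ''al''" "nats s2 ''S'' = nats s1 ''S''" "reals s2 ''q'' = reals s1 ''q''"
    by (simp_all add: s2_def den_frame weight_body_def)
  have f3: "nats s' ''al'' = nats s1 ''al''" "nats s' ''S'' = nats s1 ''S''" "reals s' ''q'' = reals s1 ''q''"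
    using f2 by (simp_all add: s' den_frame body_def)
  have 1: "reals s1 ''q'' j = qf \<gamma> (nats s ''x'') j \<and> nats s1 ''al'' j = nats s ''x'' j \<and> nats s1 ''S'' j = 0"
    if "j < n" for j
    using factor_loop_correct[OF b \<gamma> that] unfolding s1_def .
  show q: "reals s' ''q'' j = qf \<gamma> (nats s ''x'') j" if "j < n" for j
    using 1[OF that] f3 by simp
  define I where "I j s' \<longleftrightarrow> (\<forall>i. reals s' ''V'' i = reals s2 ''V'' i * (\<Prod>l<j. if g l = i then qf \<gamma> (nats s ''x'') l else 1))"
    for j and s' :: state
  have "I n s'"
    unfolding s'
  proof (rule For_base[OF b2])
    fix j t
    assume j: "j < n" and I: "I j t" and vj: "nats t ''j'' 0 = j" and bt: "base t"
      and frr: "\<And>a. a \<notin> mods (For ''j'' body) \<Longrightarrow> reals t a = reals s2 a"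
    have "reals t ''q'' j = qf \<gamma> (nats s ''x'') j"
      using frr[of "''q''"] f2 1[OF j] by (simp add: body_def)
    then show "I (Suc j) (den body t)" using I vj bt unfolding I_def body_def by auto
  qed (simp_all add: I_def safe_def body_def)
  moreover have "reals s2 ''V'' i = weight i" if "i < n" for i
    using weight_loop_correct[OF b1 that] unfolding s2_def .
  ultimately have "reals s' ''V'' i = weight i * (\<Prod>j<n. if g j = i then qf \<gamma> (nats s ''x'') j else 1)" if "i < m" for i
    using that m_le unfolding I_def by simp
  then show "round_inv \<gamma> (nats s ''x'') (\<lambda>j. 0 < nats s' ''al'' j) (\<lambda>j. 0 < nats s' ''S'' j) (reals s' ''V'')"
    using 1 f3 by (intro round_inv_0[OF pos]) simp_all
qed


definition alive :: "state \<Rightarrow> nat \<Rightarrow> bool" where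
  "alive s j \<longleftrightarrow> 0 < nats s ''al'' j"

definition chosen :: "state \<Rightarrow> nat \<Rightarrow> bool" where
  "chosen s j \<longleftrightarrow> 0 < nats s ''S'' j"

definition round_state :: "real \<Rightarrow> (nat \<Rightarrow> nat) \<Rightarrow> state \<Rightarrow> bool" where
  "round_state \<gamma> x s \<longleftrightarrow> base s \<and> reals s ''gamma'' 0 = \<gamma> \<and> (\<forall>j<n. reals s ''q'' j = qf \<gamma> x j) \<and>
     round_inv \<gamma> x (alive s) (chosen s) (reals s ''V'')"

lemma score_prog_correct:
  assumes b: "base s" and \<gamma>: "reals s ''gamma'' 0 = \<gamma>"
    and q: "\<And>j. j < n \<Longrightarrow> reals s ''q'' j = qf \<gamma> x j" and z: "nats s ''z'' 0 = z" "z < n"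
  shows "reals (den score_prog s) ''sc'' 0 = score \<gamma> x (alive s) (reals s ''V'') z"
proof -
  define body where "body = When (BAnd (entry_test ''al'' ''j'') (close_test ''z'' ''j''))
       (SetR ''sc'' (N 0) (RPlus (rscalar ''sc'')
         (RTimes (RVar ''V'' (NVar ''group'' (Var ''j'')))
           (RMinus (RDivide (OfNat (N 1)) (RVar ''q'' (Var ''j''))) (OfNat (N 1))))))"
  let ?f = "\<lambda>j. if alive s j \<and> close \<gamma> z j then reals s ''V'' (g j) * (1 / qf \<gamma> x j - 1) else 0"
  define I where "I j s' \<longleftrightarrow> reals s' ''sc'' 0 = (\<Sum>l<j. ?f l)" for j and s' :: state
  let ?s = "rwrite ''sc'' 0 0 s"
  have "I n (den (For ''j'' body) ?s)"
  proof (rule For_base)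
    fix j t
    assume j: "j < n" and I: "I j t" and vj: "nats t ''j'' 0 = j" and bt: "base t"
      and frn: "\<And>a. a \<notin> mods (For ''j'' body) \<Longrightarrow> nats t a = nats ?s a"
      and frr: "\<And>a. a \<notin> mods (For ''j'' body) \<Longrightarrow> reals t a = reals ?s a"
    have "reals t ''q'' j = qf \<gamma> x j" "reals t ''V'' = reals s ''V''" "reals t ''gamma'' 0 = \<gamma>"
      "nats t ''z'' 0 = z" "nats t ''al'' = nats s ''al''"
      using frr[of "''q''"] frr[of "''V''"] frr[of "''gamma''"] frn[of "''z''"] frn[of "''al''"] q[OF j] \<gamma> z
      by (simp_all add: body_def)
    then show "I (Suc j) (den body t)" using I vj bt j z unfolding I_def body_def alive_def by simp
  qed (use b in \<open>simp_all add: I_def safe_def body_def\<close>)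
  moreover have "nats (den (For ''j'' body) ?s) ''z'' = nats s ''z''"
    "reals (den (For ''j'' body) ?s) ''V'' = reals s ''V''" "reals (den (For ''j'' body) ?s) ''q'' = reals s ''q''"
    by (simp_all add: den_frame body_def)
  moreover have "base (den (For ''j'' body) ?s)"
    using b by (intro base_den) (simp_all add: safe_def body_def)
  ultimately show ?thesis
    unfolding score_prog_def body_def[symmetric] I_def score_def using z q by simp
qed

lemma select_prog_correct:
  assumes b: "base s" and \<gamma>: "reals s ''gamma'' 0 = \<gamma>"
    and q: "\<And>j. j < n \<Longrightarrow> reals s ''q'' j = qf \<gamma> x j" and z: "nats s ''z'' 0 = z" "z < n"
  defines "s' \<equiv> den select_prog s"
  shows "select \<gamma> x z (alive s) (chosen s) (reals s ''V'') (alive s') (chosen s') (reals s' ''V'')"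
proof -
  define body where "body = When (BAnd (entry_test ''al'' ''j'') (close_test ''z'' ''j''))
       (SetR ''V'' (NVar ''group'' (Var ''j''))
          (RDivide (RVar ''V'' (NVar ''group'' (Var ''j''))) (RVar ''q'' (Var ''j''))) ;;
        SetN ''al'' (Var ''j'') (N 0))"
  let ?V1 = "\<lambda>i. reals s ''V'' i * (if i = g z then 1 - \<epsilon> else 1)"
  let ?f = "\<lambda>i l. if alive s l \<and> close \<gamma> z l \<and> g l = i then qf \<gamma> x l else 1"
  define I where "I j t \<longleftrightarrow> (\<forall>i. reals t ''V'' i = ?V1 i / (\<Prod>l<j. ?f i l)) \<and>
      (\<forall>l. alive t l \<longleftrightarrow> alive s l \<and> \<not> (l < j \<and> close \<gamma> z l))" for j and t :: state
  let ?s = "rwrite ''V'' (g z) (reals s ''V'' (g z) * (1 - \<epsilon>)) s"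
  let ?t = "den (For ''j'' body) ?s"
  have I: "I n ?t"
  proof (rule For_base)
    fix j t
    assume j: "j < n" and I: "I j t" and vj: "nats t ''j'' 0 = j" and bt: "base t"
      and frn: "\<And>a. a \<notin> mods (For ''j'' body) \<Longrightarrow> nats t a = nats ?s a"
      and frr: "\<And>a. a \<notin> mods (For ''j'' body) \<Longrightarrow> reals t a = reals ?s a"
    have e: "reals t ''q'' j = qf \<gamma> x j" "reals t ''gamma'' 0 = \<gamma>" "nats t ''z'' 0 = z"
      using frr[of "''q''"] frr[of "''gamma''"] frn[of "''z''"] q[OF j] \<gamma> z
      by (simp_all add: body_def)
    have al: "0 < nats t ''al'' j \<longleftrightarrow> alive s j" using I unfolding I_def alive_def by simp
    have d: "den body t = (if alive s j \<and> close \<gamma> z j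
        then nwrite ''al'' j 0 (rwrite ''V'' (g j) (reals t ''V'' (g j) / qf \<gamma> x j) t)
        else nwrite ''skip'' 0 0 t)"
      unfolding body_def using al e vj bt j z by simp
    show "I (Suc j) (den body t)"
    proof (cases "alive s j \<and> close \<gamma> z j")
      case True
      then show ?thesis using I unfolding d I_def alive_def by (auto simp: less_Suc_eq)
    next
      case False
      then show ?thesis using I unfolding d I_def alive_def by (auto simp: less_Suc_eq)
    qed
  qed (use b in \<open>simp_all add: I_def alive_def safe_def body_def\<close>)
  have f: "nats ?t ''z'' 0 = z" "nats ?t ''S'' = nats s ''S''"
    using z by (simp_all add: den_frame body_def)
  have s': "s' = nwrite ''S'' z 1 ?t"
    unfolding s'_def select_prog_def body_def[symmetric] using f(1) z b by simp
  show ?thesis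
    unfolding select_def
  proof (intro conjI allI impI)
    fix j assume "j < n"
    then show "alive s' j \<longleftrightarrow> alive s j \<and> \<not> close \<gamma> z j"
      using I unfolding I_def s' alive_def by simp
    show "chosen s' j \<longleftrightarrow> chosen s j \<or> j = z" unfolding s' chosen_def using f(2) by simp
  next
    fix i
    show "reals s' ''V'' i = ?V1 i / (\<Prod>j<n. ?f i j)" using I unfolding I_def s' by simp
  qed
qed

text \<open>The last two conclusions are the alternatives of a visit: either \<open>z\<close> is
  settled, or nothing that scores depend on changes, so that scores seen earlier in the pass remain
  valid.\<close>

lemma try_point_correct:
  assumes net: "is_net \<gamma> Z" and pos: "0 < \<gamma>" and xZ: "\<forall>j<n. 0 < x j \<longrightarrow> Z j"
    and r: "round_state \<gamma> x s" and z: "nats s ''z'' 0 = z" "z < n"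
  defines "s' \<equiv> den try_point s"
  shows "round_state \<gamma> x s'" "alive s' j \<Longrightarrow> j < n \<Longrightarrow> alive s j"
    and "alive s z \<and> score \<gamma> x (alive s) (reals s ''V'') z \<le> 0 \<Longrightarrow> \<not> alive s' z"
    and "\<not> (alive s z \<and> score \<gamma> x (alive s) (reals s ''V'') z \<le> 0) \<Longrightarrow> alive s' = alive s \<and> reals s' ''V'' = reals s ''V''"
proof -
  have b: "base s" and \<gamma>: "reals s ''gamma'' 0 = \<gamma>" and q: "\<And>j. j < n \<Longrightarrow> reals s ''q'' j = qf \<gamma> x j"
    and inv: "round_inv \<gamma> x (alive s) (chosen s) (reals s ''V'')"
    using r unfolding round_state_def by auto
  let ?G = "alive s z \<and> score \<gamma> x (alive s) (reals s ''V'') z \<le> 0"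
  define s1 where "s1 = den score_prog s"
  have b1: "base s1" unfolding s1_def by (rule base_den[OF b]) (simp add: safe_def score_prog_def)
  have f1: "nats s1 ''z'' 0 = z" "alive s1 = alive s" "chosen s1 = chosen s" "reals s1 ''V'' = reals s ''V''"
    "reals s1 ''gamma'' 0 = \<gamma>" "reals s1 ''q'' = reals s ''q''" "nats s1 ''al'' = nats s ''al''"
    unfolding alive_def[abs_def] chosen_def[abs_def]
    using z \<gamma> by (simp_all add: s1_def den_frame score_prog_def del: den.simps)
  have sc: "reals s1 ''sc'' 0 = score \<gamma> x (alive s) (reals s ''V'') z"
    unfolding s1_def by (rule score_prog_correct[OF b \<gamma> q z])
  have s': "s' = (if ?G then den select_prog s1 else nwrite ''skip'' 0 0 s1)"
    unfolding s'_def try_point_def using sc f1 by (simp add: s1_def[symmetric] alive_def not_less)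
  let ?s2 = "den select_prog s1"
  have sel: "select \<gamma> x z (alive s) (chosen s) (reals s ''V'') (alive ?s2) (chosen ?s2) (reals ?s2 ''V'')"
    using select_prog_correct[OF b1 f1(5) _ f1(1) z(2), of x] q unfolding f1 by simp
  have r2: "round_state \<gamma> x ?s2" if ?G
  proof -
    have "base ?s2" by (rule base_den[OF b1]) (simp add: safe_def select_prog_def)
    moreover have "reals ?s2 ''gamma'' 0 = \<gamma>" "reals ?s2 ''q'' = reals s ''q''"
      using f1 by (simp_all add: den_frame select_prog_def del: den.simps)
    ultimately show ?thesis
      using round_inv_select[OF net pos _ inv z(2) _ _ sel] that q xZ unfolding round_state_def by simp
  qed
  have w: "alive (nwrite ''skip'' 0 0 s1) = alive s" "chosen (nwrite ''skip'' 0 0 s1) = chosen s"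
    using f1(2,3) unfolding alive_def[abs_def] chosen_def[abs_def] by simp_all
  show "round_state \<gamma> x s'"
    unfolding s' using r2 b1 f1 q inv by (auto simp: round_state_def w)
  have al: "alive ?s2 j \<longleftrightarrow> alive s j \<and> \<not> close \<gamma> z j" if "j < n" for j
    using sel that unfolding select_def by blast
  show "alive s j" if "alive s' j" "j < n"
    using that al[OF that(2)] w unfolding s' by (auto split: if_splits)
  show "\<not> alive s' z" if ?G
    using that al[OF z(2)] close_self[OF pos z(2)] unfolding s' by simp
  show "alive s' = alive s \<and> reals s' ''V'' = reals s ''V''" if "\<not> ?G"
    using that w f1(4) unfolding s' if_not_P[OF that] by simp
qed

definition alive_count :: "state \<Rightarrow> nat" where
  "alive_count s = card {j. j < n \<and> alive s j}"

text \<open>Until the first selection of a pass, all scores are those at its start. A pass without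
  selection would thus have found only positive scores at undecided points, which
  \<open>score_nonpos\<close> excludes unless no point is undecided; then the count is 0 and the
  truncated bound holds.\<close>

lemma pass_correct:
  assumes net: "is_net \<gamma> Z" and pos: "0 < \<gamma>" and xZ: "\<forall>j<n. 0 < x j \<longrightarrow> Z j"
    and r: "round_state \<gamma> x s"
  defines "s' \<equiv> den (For ''z'' try_point) s"
  shows "round_state \<gamma> x s' \<and> alive_count s' \<le> alive_count s - 1"
proof -
  let ?score = "score \<gamma> x (alive s) (reals s ''V'')"
  define I where "I z t \<longleftrightarrow> round_state \<gamma> x t \<and> {j. j < n \<and> alive t j} \<subseteq> {j. j < n \<and> alive s j} \<and>
    (alive_count t < alive_count s \<or>
      alive t = alive s \<and> reals t ''V'' = reals s ''V'' \<and> (\<forall>z'<z. \<not> (alive s z' \<and> ?score z' \<le> 0)))"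
    for z and t :: state
  have b: "base s" using r unfolding round_state_def by blast
  have "I n s'"
    unfolding s'_def
  proof (rule For_base[OF b])
    show "wf_lcom (For ''z'' try_point)" "safe (For ''z'' try_point)"
      by (simp_all add: safe_def try_point_def score_prog_def select_prog_def)
    show "I 0 s" using r by (simp add: I_def)
    show "I j (nwrite ''z'' 0 y t)" if "I j t" for j t y
      using that by (simp add: I_def round_state_def alive_def[abs_def] chosen_def[abs_def] alive_count_def)
    fix z t
    assume z: "z < n" and I: "I z t" and vz: "nats t ''z'' 0 = z"
    have rt: "round_state \<gamma> x t" using I unfolding I_def by blast
    let ?t = "den try_point t"
    note tp = try_point_correct[OF net pos xZ rt vz z]
    have sub: "{j. j < n \<and> alive ?t j} \<subseteq> {j. j < n \<and> alive t j}" using tp(2) by blast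
    then have le: "alive_count ?t \<le> alive_count t" unfolding alive_count_def by (intro card_mono) auto
    have sub': "{j. j < n \<and> alive ?t j} \<subseteq> {j. j < n \<and> alive s j}"
      using sub I unfolding I_def by blast
    consider "alive_count t < alive_count s" | "alive t z" "score \<gamma> x (alive t) (reals t ''V'') z \<le> 0"
      | "\<not> alive_count t < alive_count s" "\<not> (alive t z \<and> score \<gamma> x (alive t) (reals t ''V'') z \<le> 0)"
      by blast
    then show "I (Suc z) ?t"
    proof cases
      case 1
      then show ?thesis using tp(1) sub' le unfolding I_def by simp
    next
      case 2
      then have "\<not> alive ?t z" using tp(3) by simp
      then have "{j. j < n \<and> alive ?t j} \<subset> {j. j < n \<and> alive t j}" using sub 2 z by blast
      then have "alive_count ?t < alive_count t" unfolding alive_count_def by (intro psubset_card_mono) auto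
      moreover have "alive_count t \<le> alive_count s"
        using I unfolding I_def alive_count_def by (intro card_mono) auto
      ultimately show ?thesis using tp(1) sub' unfolding I_def by simp
    next
      case 3
      then have eq: "alive t = alive s" "reals t ''V'' = reals s ''V''"
        and all: "\<forall>z'<z. \<not> (alive s z' \<and> ?score z' \<le> 0)"
        using I unfolding I_def by simp_all
      have "alive ?t = alive s" "reals ?t ''V'' = reals s ''V''"
        using tp(4)[OF 3(2)] eq by simp_all
      moreover have "\<forall>z'<Suc z. \<not> (alive s z' \<and> ?score z' \<le> 0)"
        using all 3(2) eq less_Suc_eq by simp
      ultimately show ?thesis using tp(1) sub' unfolding I_def by simp
    qed
  qed
  moreover have "alive_count s = 0" if "\<forall>z'<n. \<not> (alive s z' \<and> ?score z' \<le> 0)"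
  proof (rule ccontr)
    assume "alive_count s \<noteq> 0"
    then have "{j. j < n \<and> alive s j} \<noteq> {}" unfolding alive_count_def by (metis card.empty)
    then obtain z0 where z0: "z0 < n" "alive s z0" by blast
    have inv: "round_inv \<gamma> x (alive s) (chosen s) (reals s ''V'')" using r unfolding round_state_def by blast
    have "\<exists>z<n. alive s z \<and> ?score z \<le> 0"
    proof (rule score_nonpos[where ?z0.0 = z0])
      show "0 < x j" if "j < n" "alive s j" for j using inv that unfolding round_inv_def by blast
      show "0 \<le> reals s ''V'' i" if "i < m" for i using round_inv_V_pos[OF pos inv that] by simp
    qed (fact pos z0)+
    then show False using that by blast
  qed
  moreover have "alive_count s' = alive_count s" if "alive s' = alive s"
    unfolding alive_count_def that ..
  ultimately show ?thesis unfolding I_def by auto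
qed

lemma rounding_correct:
  assumes net: "is_net \<gamma> Z" and pos: "0 < \<gamma>" and xZ: "\<forall>j<n. 0 < x j \<longrightarrow> Z j"
    and r: "round_state \<gamma> x s"
  defines "s' \<equiv> den rounding s"
  shows "round_state \<gamma> x s'" "\<And>j. j < n \<Longrightarrow> \<not> alive s' j"
proof -
  have b: "base s" using r unfolding round_state_def by blast
  define I where "I i t \<longleftrightarrow> round_state \<gamma> x t \<and> alive_count t \<le> n - i" for i and t :: state
  have "I n s'"
    unfolding s'_def rounding_def
  proof (rule For_base[OF b])
    show "wf_lcom (For ''r'' (For ''z'' try_point))" "safe (For ''r'' (For ''z'' try_point))"
      by (simp_all add: safe_def try_point_def score_prog_def select_prog_def)
    have "alive_count s \<le> card {..<n}" unfolding alive_count_def by (intro card_mono) auto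
    then show "I 0 s" using r by (simp add: I_def)
    show "I j (nwrite ''r'' 0 y t)" if "I j t" for j t y
      using that by (simp add: I_def round_state_def alive_def[abs_def] chosen_def[abs_def] alive_count_def)
    show "I (Suc j) (den (For ''z'' try_point) t)" if "I j t" for j t
      using pass_correct[OF net pos xZ, of t] that unfolding I_def by fastforce
  qed
  then show "round_state \<gamma> x s'" "\<And>j. j < n \<Longrightarrow> \<not> alive s' j"
    unfolding I_def alive_count_def by auto
qed

lemma check_prog_correct:
  assumes b: "base s"
  shows "0 < nats (den check_prog s) ''ok'' 0 \<longleftrightarrow>
    (\<forall>i<n. (1 - \<epsilon>) * real (k i) \<le> (\<Sum>j<n. of_bool (chosen s j \<and> g j = i)))"
proof -
  let ?c = "\<lambda>i. (\<Sum>j<n. of_bool (chosen s j \<and> g j = i)) :: nat"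
  define I where "I i t \<longleftrightarrow> (0 < nats t ''ok'' 0 \<longleftrightarrow> (\<forall>l<i. (1 - \<epsilon>) * real (k l) \<le> real (?c l)))"
    for i and t :: state
  let ?s = "nwrite ''ok'' 0 1 s"
  have "I n (den (For ''i'' check_body) ?s)"
  proof (rule For_base)
    fix i t
    assume i: "i < n" and I: "I i t" and vi: "nats t ''i'' 0 = i" and bt: "base t"
      and frn: "\<And>a. a \<notin> mods (For ''i'' check_body) \<Longrightarrow> nats t a = nats ?s a"
    have S: "nats t ''S'' = nats s ''S''" using frn[of "''S''"] by (simp add: check_body_def)
    define inner where "inner = sum_loop ''j'' (BAnd (entry_test ''S'' ''j'') (eq_test (NVar ''group'' (Var ''j'')) (Var ''i''))) (N 1)"
    have "nats (den inner t) ''c'' 0 = (\<Sum>j<n. of_bool (chosen s j \<and> g j = i) * 1)"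
      unfolding inner_def chosen_def by (rule den_sum_loop[OF bt]) (use S vi bt in simp_all)
    then have c: "nats (den inner t) ''c'' 0 = ?c i" by (simp only: mult_1_right)
    have f: "nats (den inner t) ''i'' 0 = i" "nats (den inner t) ''ok'' = nats t ''ok''"
      using vi by (simp_all add: den_frame inner_def)
    have "base (den inner t)" using bt by (rule base_den) (simp add: inner_def safe_def)
    then have "den check_body t = (if real (?c i) < (1 - \<epsilon>) * real (k i) then nwrite ''ok'' 0 0 (den inner t)
        else nwrite ''skip'' 0 0 (den inner t))"
      unfolding check_body_def inner_def[symmetric] using f c by (simp del: of_nat_sum sum_of_bool_eq)
    then show "I (Suc i) (den check_body t)"
      using I f unfolding I_def by (auto simp: less_Suc_eq not_less simp del: of_nat_sum sum_of_bool_eq)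
  qed (use b in \<open>simp_all add: I_def safe_def check_body_def\<close>)
  then show ?thesis unfolding I_def check_prog_def by simp
qed

end

section \<open>The loop over all guesses\<close>

lemma wf_mw_round: "wf_lcom mw_round"
  by (simp add: mw_round_def choose_prog_def choose_body_def cover_prog_def pack_prog_def pack_body_def)

lemma rep_counter_not_mods: "CHR ''t'' # cs \<notin> mods mw_round"
  by (simp add: mw_round_def choose_prog_def choose_body_def cover_prog_def pack_prog_def pack_body_def)

lemma wf_attempt: "wf_lcom attempt"
proof -
  have "wf_lcom (rep 8 mw_round)"
    by (rule wf_rep[OF wf_mw_round rep_counter_not_mods])
  then show ?thesis
    by (simp add: attempt_def net_prog_def net_body_def mw_init_def round_init_def factor_body_def
        weight_body_def rounding_def try_point_def score_prog_def select_prog_def check_prog_def check_body_def)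
qed

lemma mods_attempt:
  "''n'' \<notin> mods attempt" "''group'' \<notin> mods attempt" "''k'' \<notin> mods attempt" "''row'' \<notin> mods attempt"
  "''eps'' \<notin> mods attempt" "''d'' \<notin> mods attempt" "''gamma'' \<notin> mods attempt" "''best'' \<notin> mods attempt"
  "''out'' \<notin> mods attempt" "''a'' \<notin> mods attempt" "''b'' \<notin> mods attempt"
  by (simp_all add: attempt_def net_prog_def net_body_def mw_init_def round_init_def factor_body_def
      weight_body_def rounding_def try_point_def score_prog_def select_prog_def check_prog_def check_body_def
      mods_rep image_iff mw_round_def choose_prog_def choose_body_def cover_prog_def pack_prog_def pack_body_def
      del: rep.simps)

lemma wf_guess: "wf_lcom guess"
  using wf_attempt by (simp add: guess_def)

lemma mods_guess:
  "''n'' \<notin> mods guess" "''group'' \<notin> mods guess" "''k'' \<notin> mods guess" "''row'' \<notin> mods guess"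
  "''eps'' \<notin> mods guess" "''d'' \<notin> mods guess" "''a'' \<notin> mods guess" "''b'' \<notin> mods guess"
  using mods_attempt by (simp_all add: guess_def)

lemma wf_main: "wf_lcom main_prog"
  using wf_guess mods_guess by (simp add: main_prog_def row_init_def)

context fair_indices
begin

definition covers :: "(nat \<Rightarrow> bool) \<Rightarrow> bool" where
  "covers P \<longleftrightarrow> (\<forall>i<m. (1 - \<epsilon>) * real (k i) \<le> (\<Sum>j<n. of_bool (P j \<and> g j = i)))"

definition spread :: "real \<Rightarrow> (nat \<Rightarrow> bool) \<Rightarrow> bool" where
  "spread \<gamma> P \<longleftrightarrow> (\<forall>u<n. \<forall>v<n. P u \<and> P v \<and> u \<noteq> v \<longrightarrow> \<gamma> \<le> 6 * D u v)"

lemma attempt_correct: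
  assumes b: "base s" and \<gamma>: "reals s ''gamma'' 0 = \<gamma>" and pos: "0 < \<gamma>"
  defines "s' \<equiv> den attempt s"
  shows "base s'" "spread \<gamma> (chosen s')" "0 < nats s' ''ok'' 0 \<Longrightarrow> covers (chosen s')"
    "feasible \<gamma> \<Longrightarrow> 0 < nats s' ''ok'' 0"
proof -
  define s1 where "s1 = den net_prog s"
  define s2 where "s2 = den (rep 8 mw_round) (den mw_init s1)"
  define s3 where "s3 = den round_init s2"
  define s4 where "s4 = den rounding s3"
  have s': "s' = den check_prog s4"
    by (simp add: s'_def attempt_def s1_def s2_def s3_def s4_def)
  define Z where "Z = (\<lambda>j. 0 < nats s1 ''Z'' j)"
  have b1: "base s1" unfolding s1_def by (rule base_den[OF b]) (simp add: safe_def net_prog_def net_body_def)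
  have \<gamma>1: "reals s1 ''gamma'' 0 = \<gamma>"
    using \<gamma> by (simp add: s1_def den_frame net_prog_def net_body_def)
  have net: "is_net \<gamma> Z" using net_prog_correct[OF b \<gamma>] unfolding Z_def s1_def .
  note mw = mw_phase_correct[OF b1 \<gamma>1 pos Z_def net, folded s2_def]
  define x where "x = nats s2 ''x''"
  have xZ: "\<forall>j<n. 0 < x j \<longrightarrow> Z j" using mw(1) unfolding mw_inv_def x_def by blast
  have "round_state \<gamma> x s3"
    unfolding round_state_def
  proof (intro conjI allI impI)
    show "base s3" unfolding s3_def
      by (rule base_den[OF mw(2)]) (simp add: safe_def round_init_def factor_body_def weight_body_def)
    show "reals s3 ''gamma'' 0 = \<gamma>"
      using mw(3) by (simp add: s3_def den_frame round_init_def factor_body_def weight_body_def del: den.simps)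
    show "reals s3 ''q'' j = qf \<gamma> x j" if "j < n" for j
      using round_init_correct(2)[OF mw(2,3) pos that] unfolding s3_def x_def .
    show "round_inv \<gamma> x (alive s3) (chosen s3) (reals s3 ''V'')"
      using round_init_correct(1)[OF mw(2,3) pos] unfolding s3_def x_def alive_def[abs_def] chosen_def[abs_def] .
  qed
  note r = rounding_correct[OF net pos xZ this, folded s4_def]
  have b4: "base s4" and inv: "round_inv \<gamma> x (alive s4) (chosen s4) (reals s4 ''V'')"
    using r(1) unfolding round_state_def by blast+
  have ch: "chosen s' = chosen s4"
    unfolding chosen_def[abs_def] by (simp add: s' den_frame check_prog_def check_body_def del: den.simps)
  show "base s'" unfolding s' by (rule base_den[OF b4]) (simp add: safe_def check_prog_def check_body_def)
  show "spread \<gamma> (chosen s')"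
    using inv[unfolded round_inv_def, THEN conjunct2, THEN conjunct1]
    unfolding ch spread_def close_def not_less .
  have ok: "0 < nats s' ''ok'' 0 \<longleftrightarrow> (\<forall>i<n. (1 - \<epsilon>) * real (k i) \<le> (\<Sum>j<n. of_bool (chosen s4 j \<and> g j = i)))"
    using check_prog_correct[OF b4] unfolding s' .
  show "covers (chosen s')" if "0 < nats s' ''ok'' 0"
    unfolding covers_def ch
  proof (intro allI impI)
    fix i assume "i < m"
    then have "i < n" using m_le by simp
    then show "(1 - \<epsilon>) * real (k i) \<le> (\<Sum>j<n. of_bool (chosen s4 j \<and> g j = i))"
      using that unfolding ok by blast
  qed
  show "0 < nats s' ''ok'' 0" if feas: "feasible \<gamma>"
    unfolding ok
  proof (intro allI impI)
    fix i
    have "initial_potential \<gamma> x < 1"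
      using initial_potential_less[OF pos feas mw(1)] unfolding x_def .
    show "(1 - \<epsilon>) * real (k i) \<le> (\<Sum>j<n. of_bool (chosen s4 j \<and> g j = i))"
    proof (cases "i < m")
      case True
      then show ?thesis by (intro round_inv_final[OF inv pos _ \<open>initial_potential \<gamma> x < 1\<close>] r(2))
    next
      \<comment> \<open>The check also visits indices without a group; there \<open>k\<close> is 0
        and it passes.\<close>
      case False
      then show ?thesis using k_0[of i] by (simp add: sum_nonneg)
    qed
  qed
qed

text \<open>Pairs are tried in lexicographic order. A positive \<open>''best''\<close> certifies the
  stored output, 0 means that nothing is stored yet. A feasible distance already tried is dominated
  whether it was accepted itself or skipped in favour of a larger one.\<close>

definition guess_inv :: "nat \<Rightarrow> nat \<Rightarrow> state \<Rightarrow> bool" where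
  "guess_inv a b s \<longleftrightarrow> base s \<and> 0 \<le> reals s ''best'' 0 \<and>
     (0 < reals s ''best'' 0 \<longrightarrow>
        spread (reals s ''best'' 0) (\<lambda>j. 0 < nats s ''out'' j) \<and> covers (\<lambda>j. 0 < nats s ''out'' j)) \<and>
     (\<forall>a'<n. \<forall>b'<n. (a' < a \<or> a' = a \<and> b' < b) \<and> feasible (D a' b') \<longrightarrow> D a' b' \<le> reals s ''best'' 0)"

lemma guess_correct:
  assumes G: "guess_inv a b s" and a: "nats s ''a'' 0 = a" "a < n" and b: "nats s ''b'' 0 = b" "b < n"
  shows "guess_inv a (Suc b) (den guess s)"
proof -
  let ?\<gamma> = "D a b"
  let ?best = "reals s ''best'' 0"
  let ?s = "rwrite ''gamma'' 0 ?\<gamma> s"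
  have bs: "base s" using G unfolding guess_inv_def by blast
  have old: "D a' b' \<le> ?best" if "a' < n" "b' < n" "a' < a \<or> a' = a \<and> b' < b" "feasible (D a' b')" for a' b'
    using G that unfolding guess_inv_def by blast
  define fin where "fin = SetR ''best'' (N 0) (rscalar ''gamma'') ;;
           For ''j'' (SetN ''out'' (Var ''j'') (NVar ''S'' (Var ''j'')))"
  define s1 where "s1 = den attempt ?s"
  have eq: "den guess s = (if ?best < ?\<gamma> then
      (if 0 < nats s1 ''ok'' 0 then den fin s1 else nwrite ''skip'' 0 0 s1) else nwrite ''skip'' 0 0 ?s)"
    using a b bs by (simp add: guess_def s1_def fin_def)
  show ?thesis
  proof (cases "?best < ?\<gamma>")
    case False
    then show ?thesis
      using G unfolding eq guess_inv_def by (auto simp: less_Suc_eq)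
  next
    case True
    have pos: "0 < ?\<gamma>" using True G unfolding guess_inv_def by linarith
    have bs': "base ?s" using bs by simp
    have \<gamma>s: "reals ?s ''gamma'' 0 = ?\<gamma>" by simp
    note at = attempt_correct[OF bs' \<gamma>s pos, folded s1_def]
    have f1: "reals s1 ''best'' 0 = ?best" "nats s1 ''out'' = nats s ''out''" "reals s1 ''gamma'' 0 = ?\<gamma>"
      using mods_attempt by (simp_all add: s1_def den_frame)
    show ?thesis
    proof (cases "0 < nats s1 ''ok'' 0")
      case ok: False
      have "\<not> feasible ?\<gamma>" using ok at(4) by (rule contrapos_nn)
      moreover have "den guess s = nwrite ''skip'' 0 0 s1" using True ok unfolding eq by simp
      ultimately show ?thesis
        using G at(1) f1 unfolding guess_inv_def by (auto simp: less_Suc_eq)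
    next
      case ok: True
      let ?s2 = "rwrite ''best'' 0 ?\<gamma> s1"
      let ?loop = "For ''j'' (SetN ''out'' (Var ''j'') (NVar ''S'' (Var ''j'')))"
      define I where "I j t \<longleftrightarrow> (\<forall>l<j. nats t ''out'' l = nats s1 ''S'' l)" for j and t :: state
      have "I n (den ?loop ?s2)"
      proof (rule For_base)
        fix j t
        assume I: "I j t" and vj: "nats t ''j'' 0 = j"
          and frn: "\<And>a. a \<notin> mods ?loop \<Longrightarrow> nats t a = nats ?s2 a"
        show "I (Suc j) (den (SetN ''out'' (Var ''j'') (NVar ''S'' (Var ''j''))) t)"
          using I vj frn[of "''S''"] unfolding I_def by (simp add: less_Suc_eq)
      qed (use at(1) in \<open>simp_all add: I_def safe_def\<close>)
      moreover have dg: "den guess s = den ?loop ?s2"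
        unfolding eq if_P[OF True] if_P[OF ok] using f1 by (simp add: fin_def)
      ultimately have out: "0 < nats (den guess s) ''out'' l \<longleftrightarrow> chosen s1 l" if "l < n" for l
        using that unfolding I_def chosen_def by simp
      have best: "reals (den guess s) ''best'' 0 = ?\<gamma>"
        unfolding dg by (simp add: den_frame)
      have "base (den guess s)"
        unfolding dg using at(1) by (intro base_den) (simp_all add: safe_def)
      moreover have "spread ?\<gamma> (\<lambda>j. 0 < nats (den guess s) ''out'' j)"
        using at(2) out unfolding spread_def by simp
      moreover have "covers (\<lambda>j. 0 < nats (den guess s) ''out'' j)"
      proof -
        have "(\<Sum>j<n. of_bool (0 < nats (den guess s) ''out'' j \<and> g j = i)) =
            (\<Sum>j<n. of_bool (chosen s1 j \<and> g j = i) :: real)" for i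
          using out by (intro sum.cong refl) simp
        then show ?thesis using at(3) ok unfolding covers_def by simp
      qed
      moreover have "D a' b' \<le> ?\<gamma>" if "a' < n" "b' < n" "a' < a \<or> a' = a \<and> b' < Suc b" "feasible (D a' b')" for a' b'
        using old[OF that(1,2) _ that(4)] that(3) True by (auto simp: less_Suc_eq)
      ultimately show ?thesis unfolding guess_inv_def best using pos by auto
    qed
  qed
qed

lemma row_init_correct:
  assumes "nats s ''n'' 0 = n" "nats s ''group'' = g" "nats s ''k'' = k" "reals s ''eps'' 0 = \<epsilon>"
    "nats s ''row'' 0 = 0" "\<And>u v. u < n \<Longrightarrow> v < n \<Longrightarrow> reals s ''d'' (u * n + v) = D u v"
  shows "base (den row_init s)"
proof -
  define I where "I j t \<longleftrightarrow> (\<forall>l\<le>j. nats t ''row'' l = l * n)" for j and t :: state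
  have "I n (den row_init s)"
    unfolding row_init_def
  proof (rule For_rule[OF assms(1)])
    fix j t
    assume "I j t" "nats t ''j'' 0 = j" "nats t ''n'' = nats s ''n''"
    then show "I (Suc j) (den (SetN ''row'' (NPlus (Var ''j'') (N 1)) (NPlus (NVar ''row'' (Var ''j'')) (Var ''n''))) t)"
      unfolding I_def using assms(1) by (auto simp: le_Suc_eq)
  qed (use assms(5) in \<open>simp_all add: I_def\<close>)
  then show ?thesis
    using assms unfolding base_def I_def by (simp add: den_frame row_init_def)
qed

lemma main_correct:
  assumes "nats s ''n'' 0 = n" "nats s ''group'' = g" "nats s ''k'' = k" "reals s ''eps'' 0 = \<epsilon>"
    "nats s ''row'' 0 = 0" "\<And>u v. u < n \<Longrightarrow> v < n \<Longrightarrow> reals s ''d'' (u * n + v) = D u v"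
    and best: "reals s ''best'' 0 = 0"
    and opt: "a < n" "b < n" "a \<noteq> b" "feasible (D a b)"
  defines "P \<equiv> \<lambda>j. nats (den main_prog s) ''out'' j \<noteq> 0"
  shows "spread (D a b) P" "covers P"
proof -
  let ?s = "den row_init s"
  have b0: "base ?s" by (rule row_init_correct) fact+
  have G0: "guess_inv 0 0 ?s"
    using b0 best unfolding guess_inv_def by (simp add: den_frame row_init_def)
  have safe: "safe (For ''b'' guess)" "safe (For ''a'' (For ''b'' guess))"
    using mods_guess unfolding safe_def by auto
  have wf: "wf_lcom (For ''b'' guess)" "wf_lcom (For ''a'' (For ''b'' guess))"
    using wf_guess mods_guess by auto
  have indep: "guess_inv i j (nwrite v 0 x t)" if "guess_inv i j t" "v \<in> {''a'', ''b''}" for i j v x t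
    using that unfolding guess_inv_def by auto
  have "guess_inv n 0 (den (For ''a'' (For ''b'' guess)) ?s)"
  proof (rule For_base[OF b0 wf(2) safe(2), where I = "\<lambda>i. guess_inv i 0"])
    fix i t
    assume i: "i < n" and G: "guess_inv i 0 t" and vi: "nats t ''a'' 0 = i" and bt: "base t"
    have "guess_inv i n (den (For ''b'' guess) t)"
    proof (rule For_base[OF bt wf(1) safe(1), where I = "guess_inv i"])
      fix j u
      assume j: "j < n" and G: "guess_inv i j u" and vj: "nats u ''b'' 0 = j"
        and frn: "\<And>a. a \<notin> mods (For ''b'' guess) \<Longrightarrow> nats u a = nats t a"
      have "nats u ''a'' 0 = i" using frn[of "''a''"] mods_guess vi by simp
      then show "guess_inv i (Suc j) (den guess u)" using guess_correct[OF G _ i vj j] by simp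
    qed (use G indep in simp_all)
    \<comment> \<open>The end of one row is the start of the next in the lexicographic
      order.\<close>
    then show "guess_inv (Suc i) 0 (den (For ''b'' guess) t)"
      unfolding guess_inv_def by (auto simp: less_Suc_eq)
  qed (use G0 indep in simp_all)
  then have G: "guess_inv n 0 (den main_prog s)" by (simp add: main_prog_def)
  let ?best = "reals (den main_prog s) ''best'' 0"
  have le: "D a b \<le> ?best" using G opt unfolding guess_inv_def by blast
  \<comment> \<open>Positivity distinguishes \<open>?best\<close> from the initial 0, so an output
    has been stored.\<close>
  moreover have "0 < D a b" using D_pos opt by blast
  ultimately have "spread ?best P" "covers P"
    using G unfolding guess_inv_def P_def by simp_all
  then show "spread (D a b) P" "covers P" using le unfolding spread_def by (auto intro: order_trans)
qed

end

section \<open>Transport to metric spaces\<close>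

lemma diversity_attained:
  assumes "finite Q" "2 \<le> card Q"
  obtains u v where "u \<in> Q" "v \<in> Q" "u \<noteq> v" "diversity d Q = ereal (d u v)"
proof -
  let ?Pairs = "{(u, v). u \<in> Q \<and> v \<in> Q \<and> u \<noteq> v}"
  have "finite ?Pairs" using assms(1) by (intro finite_subset[of ?Pairs "Q \<times> Q"]) auto
  moreover have "?Pairs \<noteq> {}"
  proof -
    have "\<not> card Q \<le> Suc 0" using assms(2) by simp
    then show ?thesis using card_le_Suc0_iff_eq[OF assms(1)] by auto
  qed
  ultimately have "diversity d Q \<in> (\<lambda>(u, v). ereal (d u v)) ` ?Pairs"
    unfolding diversity_def by (subst Min_Inf[symmetric]) (auto intro!: Min_in)
  then show ?thesis using that by auto
qed

text \<open>\<open>Max\<close> is meaningful because fair subsets exist: choose \<open>k i\<close>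
  points in each group, where disjointness keeps the choices from interfering.\<close>

lemma opt_diversity_attained:
  assumes "fair_instance X d m G k"
  shows "\<exists>Q\<subseteq>X. (\<forall>i<m. card (Q \<inter> G i) = k i) \<and> diversity d Q = opt_diversity X d m G k"
proof -
  let ?F = "{S. S \<subseteq> X \<and> (\<forall>i<m. card (S \<inter> G i) = k i)}"
  have X: "finite X" "X = (\<Union>i<m. G i)" "disjoint_family_on G {..<m}" "\<forall>i<m. k i \<le> card (G i)"
    using assms unfolding fair_instance_def by - (elim conjE, assumption)+
  have "\<exists>S\<subseteq>G i. card S = k i" if "i < m" for i
  proof -
    have "k i \<le> card (G i)" using X(4) that by simp
    then obtain S where "S \<subseteq> G i" "card S = k i" by (rule obtain_subset_with_card_n)
    then show ?thesis by blast
  qed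
  then have "\<forall>i. \<exists>S. i < m \<longrightarrow> S \<subseteq> G i \<and> card S = k i" by blast
  then obtain T where T: "\<And>i. i < m \<Longrightarrow> T i \<subseteq> G i \<and> card (T i) = k i"
    using choice[of "\<lambda>i S. i < m \<longrightarrow> S \<subseteq> G i \<and> card S = k i"] by blast
  have "(\<Union>i<m. T i) \<in> ?F"
  proof -
    have "(\<Union>j<m. T j) \<inter> G i = T i" if "i < m" for i
    proof
      show "(\<Union>j<m. T j) \<inter> G i \<subseteq> T i"
      proof
        fix y assume "y \<in> (\<Union>j<m. T j) \<inter> G i"
        then obtain j where j: "j < m" "y \<in> T j" "y \<in> G i" by blast
        then have "y \<in> G j \<inter> G i" using T[of j] by blast
        then have "j = i" using X(3) j(1) that unfolding disjoint_family_on_def by blast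
        then show "y \<in> T i" using j(2) by simp
      qed
      show "T i \<subseteq> (\<Union>j<m. T j) \<inter> G i" using T[OF that] that by blast
    qed
    moreover have "(\<Union>i<m. T i) \<subseteq> X" using T X(2) by blast
    ultimately show ?thesis using T by (intro CollectI conjI allI impI) (simp_all only:)
  qed
  then have "diversity d ` ?F \<noteq> {}" by blast
  moreover have "finite ?F" by (rule finite_subset[of _ "Pow X"]) (use X(1) in \<open>blast, simp\<close>)
  ultimately have "opt_diversity X d m G k \<in> diversity d ` ?F"
    unfolding opt_diversity_def by (intro Max_in finite_imageI)
  then obtain Q where "Q \<in> ?F" "opt_diversity X d m G k = diversity d Q" by (rule imageE)
  then show ?thesis by (intro exI[of _ Q]) simp
qed

text \<open>By ln 2 \<ge> 2/3 and \<epsilon> < 1 the lower bound exceeds 2. Three points per group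
  make the optimal diversity a distance of two points, and give n \<ge> 3 * m.\<close>

lemma group_size_lower:
  assumes "0 < \<epsilon>" "\<epsilon> < 1" "0 < m" "3 / \<epsilon>^2 * ln (2 * real m) \<le> real k"
  shows "3 \<le> k"
proof -
  have "2 / 3 \<le> ln (2 * real m)"
  proof -
    have "ln 2 \<le> ln (2 * real m)" using assms(3) by simp
    then show ?thesis using ln2_ge_two_thirds by linarith
  qed
  have sq: "0 < \<epsilon>^2" "\<epsilon>^2 < 1" using assms(1,2) by (simp_all add: power_less_one_iff)
  have "2 < 2 / \<epsilon>^2" using sq by (simp add: less_divide_eq)
  also have "\<dots> = 3 / \<epsilon>^2 * (2 / 3)" by simp
  also have "\<dots> \<le> 3 / \<epsilon>^2 * ln (2 * real m)"
    using \<open>2 / 3 \<le> ln (2 * real m)\<close> by (intro mult_left_mono) auto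
  finally have "2 < real k" using assms(4) by linarith
  then show ?thesis by linarith
qed

lemma main_prog_output:
  fixes X :: "'a set" and \<epsilon> \<delta> :: real
  assumes eps: "0 < \<epsilon>" "\<epsilon> < 1" and inst: "fair_instance X d m G k"
    and k_ge: "\<forall>i<m. real (k i) \<ge> 3 / \<epsilon>^2 * ln (2 * real m)" and xs: "distinct xs" "set xs = X"
  defines "S \<equiv> output_set xs (den main_prog (input_state xs d m G k \<epsilon> \<delta>))"
  shows "S \<subseteq> X" "opt_diversity X d m G k / 6 \<le> diversity d S"
    "\<forall>i<m. (1 - \<epsilon>) * real (k i) \<le> real (card (S \<inter> G i))"
proof -
  have X: "finite X" "X = (\<Union>i<m. G i)" "disjoint_family_on G {..<m}" "\<forall>i<m. k i \<le> card (G i)"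
    and metric: "Metric_space X d"
    using inst unfolding fair_instance_def by - (elim conjE, assumption)+
  interpret M: Metric_space X d by (rule metric)
  let ?s = "input_state xs d m G k \<epsilon> \<delta>"
  define n where "n = length xs"
  have n: "n = card X" using xs distinct_card n_def by metis
  have nth: "xs ! j \<in> X" if "j < n" for j using that xs n_def nth_mem by blast
  show "S \<subseteq> X" unfolding S_def output_set_def using nth n_def by auto
  have "(opt_diversity X d m G k / 6 \<le> diversity d S) \<and>
      (\<forall>i<m. (1 - \<epsilon>) * real (k i) \<le> real (card (S \<inter> G i)))"
  proof (cases "m = 0")
    \<comment> \<open>Without groups there are no points, and the empty output has diversity
      \<infinity>.\<close>
    case True
    then have "S = {}" using \<open>S \<subseteq> X\<close> X(2) by simp
    then show ?thesis using True by (simp add: diversity_def top_ereal_def)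
  next
    case False
    \<comment> \<open>Read off the memory, since \<open>base\<close> demands equality of functions,
      also at positions beyond the input; \<open>k'\<close> follows the memory for the same
      reason.\<close>
    define g where "g = nats ?s ''group''"
    define k' where "k' i = (if i < m then k i else 0)" for i
    define D where "D u v = d (xs ! u) (xs ! v)" for u v
    have g_eq: "g j = (THE i. i < m \<and> xs ! j \<in> G i)" if "j < n" for j
      using that by (simp add: g_def input_state_def n_def Let_def)
    have g: "g j < m \<and> xs ! j \<in> G (g j)" if "j < n" for j
    proof -
      have "\<exists>!i. i < m \<and> xs ! j \<in> G i"
        using nth[OF that] X(2,3) unfolding disjoint_family_on_def by blast
      then show ?thesis unfolding g_eq[OF that] by (rule theI')
    qed
    have g_iff: "g j = i \<longleftrightarrow> xs ! j \<in> G i" if "j < n" "i < m" for i j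
      using g[OF that(1)] X(3) that(2) unfolding disjoint_family_on_def by blast
    have k3: "3 \<le> k i" if "i < m" for i
      using group_size_lower[OF eps _ ] False k_ge that by blast
    have "3 * m = (\<Sum>i<m. 3)" by simp
    also have "\<dots> \<le> (\<Sum>i<m. card (G i))"
    proof (rule sum_mono)
      fix i assume "i \<in> {..<m}"
      then show "3 \<le> card (G i)" using k3[of i] X(4) by fastforce
    qed
    also have "\<dots> = n"
      unfolding n X(2) using X(1,2,3)
      by (intro card_UN_disjoint[symmetric]) (auto simp: disjoint_family_on_def)
    finally have nm: "3 * m \<le> n" .
    have Gfin: "finite (G i)" "G i \<subseteq> X" if "i < m" for i
      using that X(1,2) by (auto intro: finite_subset)
    interpret fair_indices n m g k' D \<epsilon>
    proof
      show "3 \<le> n" "0 < m" "m \<le> n" using nm False by linarith+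
      show "g j < m" if "j < n" for j using g that by blast
      show "k' i \<le> n" for i
      proof (cases "i < m")
        case True
        then have "card (G i) \<le> n" unfolding n using Gfin X(1) by (intro card_mono) auto
        then show ?thesis using True X(4) by (fastforce simp: k'_def)
      qed (simp add: k'_def)
      show "k' i = 0" if "m \<le> i" for i using that by (simp add: k'_def)
      show "3 / \<epsilon>\<^sup>2 * ln (2 * real m) \<le> real (k' i)" if "i < m" for i
        using k_ge that by (simp add: k'_def)
      show "D u u = 0" if "u < n" for u using nth that by (simp add: D_def)
      show "0 < D u v" if "u < n" "v < n" "u \<noteq> v" for u v
        unfolding D_def using that nth xs(1) n_def by (simp add: nth_eq_iff_index_eq)
      show "D u v = D v u" if "u < n" "v < n" for u v unfolding D_def by (rule M.commute)
      show "D u w \<le> D u v + D v w" if "u < n" "v < n" "w < n" for u v w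
        unfolding D_def using M.triangle nth that by blast
    qed (use eps in auto)
    have card_idx: "card {j. j < n \<and> xs ! j \<in> Q \<and> g j = i} = card (Q \<inter> G i)" if i: "i < m" for Q i
    proof -
      have "bij_betw ((!) xs) {j. j < n \<and> xs ! j \<in> Q \<and> g j = i} (Q \<inter> G i)"
        unfolding bij_betw_def
      proof
        show "inj_on ((!) xs) {j. j < n \<and> xs ! j \<in> Q \<and> g j = i}"
          using xs(1) n_def by (auto simp: inj_on_def nth_eq_iff_index_eq)
        show "(!) xs ` {j. j < n \<and> xs ! j \<in> Q \<and> g j = i} = Q \<inter> G i"
        proof
          show "(!) xs ` {j. j < n \<and> xs ! j \<in> Q \<and> g j = i} \<subseteq> Q \<inter> G i"
            using g_iff[OF _ i] by auto
          show "Q \<inter> G i \<subseteq> (!) xs ` {j. j < n \<and> xs ! j \<in> Q \<and> g j = i}"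
          proof
            fix y assume y: "y \<in> Q \<inter> G i"
            then have "y \<in> set xs" using Gfin(2)[OF i] xs(2) by blast
            then obtain j where "j < n" "y = xs ! j" unfolding n_def by (metis in_set_conv_nth)
            then show "y \<in> (!) xs ` {j. j < n \<and> xs ! j \<in> Q \<and> g j = i}"
              using y g_iff[OF _ i] by auto
          qed
        qed
      qed
      then show ?thesis by (rule bij_betw_same_card)
    qed
    obtain Q where Q: "Q \<subseteq> X" "\<forall>i<m. card (Q \<inter> G i) = k i" "diversity d Q = opt_diversity X d m G k"
      using opt_diversity_attained[OF inst] by blast
    have finQ: "finite Q" using Q(1) X(1) finite_subset by blast
    have "3 \<le> card (Q \<inter> G 0)" using Q(2) k3 False by simp
    also have "\<dots> \<le> card Q" using finQ by (intro card_mono) auto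
    finally have "2 \<le> card Q" by simp
    \<comment> \<open>The optimum is a distance of two points, hence among the values that the
      program tries.\<close>
    then obtain p q where pq: "p \<in> Q" "q \<in> Q" "p \<noteq> q" "diversity d Q = ereal (d p q)"
      by (rule diversity_attained[OF finQ])
    obtain a where a: "a < n" "xs ! a = p" using pq(1) Q(1) xs(2) n_def by (metis in_set_conv_nth subsetD)
    obtain b where b: "b < n" "xs ! b = q" using pq(2) Q(1) xs(2) n_def by (metis in_set_conv_nth subsetD)
    have feas: "feasible (D a b)"
      unfolding feasible_def
    proof (intro exI[of _ "{j. j < n \<and> xs ! j \<in> Q}"] conjI allI impI ballI)
      show "{j. j < n \<and> xs ! j \<in> Q} \<subseteq> {..<n}" by auto
      show "card {j \<in> {j. j < n \<and> xs ! j \<in> Q}. g j = i} = k' i" if "i < m" for i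
      proof -
        have eq: "{j \<in> {j. j < n \<and> xs ! j \<in> Q}. g j = i} = {j. j < n \<and> xs ! j \<in> Q \<and> g j = i}" by auto
        show ?thesis unfolding eq card_idx[OF that] using Q(2) that by (simp add: k'_def)
      qed
      fix u v
      assume uv: "u \<in> {j. j < n \<and> xs ! j \<in> Q}" "v \<in> {j. j < n \<and> xs ! j \<in> Q}" "u \<noteq> v"
      then have "xs ! u \<noteq> xs ! v" using xs(1) n_def by (simp add: nth_eq_iff_index_eq)
      then have "diversity d Q \<le> ereal (d (xs ! u) (xs ! v))"
        unfolding diversity_def using uv by (intro INF_lower2[of "(xs ! u, xs ! v)"]) auto
      then show "D a b \<le> D u v" unfolding pq(4) D_def a b by simp
    qed
    define P where "P j \<longleftrightarrow> nats (den main_prog ?s) ''out'' j \<noteq> 0" for j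
    have "spread (D a b) P \<and> covers P"
    proof -
      have 1: "nats ?s ''n'' 0 = n" "nats ?s ''group'' = g" "nats ?s ''k'' = k'" "reals ?s ''eps'' 0 = \<epsilon>"
        "nats ?s ''row'' 0 = 0" "reals ?s ''best'' 0 = 0"
        by (auto simp: input_state_def n_def g_def k'_def Let_def)
      have 2: "reals ?s ''d'' (u * n + v) = D u v" if "u < n" "v < n" for u v
      proof -
        have "u * n + v < Suc u * n" using that(2) by simp
        also have "\<dots> \<le> n * n" using that(1) by (intro mult_right_mono) auto
        finally have "u * n + v < n * n" .
        moreover have "(u * n + v) div n = u" "(u * n + v) mod n = v"
          using div_mult_self1[of n v u] that(2) by (simp_all add: add.commute)
        ultimately show ?thesis by (simp add: input_state_def D_def Let_def flip: n_def)
      qed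
      have "a \<noteq> b" using pq(3) a b by blast
      then show ?thesis
        using main_correct[OF 1(1-5) 2 1(6) a(1) b(1) _ feas] unfolding P_def[abs_def] by blast
    qed
    then have spread: "spread (D a b) P" and covers: "covers P" by auto
    have S: "S = {xs ! j | j. j < n \<and> P j}"
      unfolding S_def output_set_def P_def n_def ..
    have "opt_diversity X d m G k / 6 \<le> diversity d S"
      unfolding diversity_def
    proof (rule INF_greatest, clarify)
      fix u v assume "u \<in> S" "v \<in> S" "u \<noteq> v"
      then obtain i j where "u = xs ! i" "v = xs ! j" "i < n" "j < n" "P i" "P j" "i \<noteq> j"
        unfolding S by blast
      then have "D a b \<le> 6 * d u v" using spread unfolding spread_def D_def by blast
      then show "opt_diversity X d m G k / 6 \<le> ereal (d u v)"
        unfolding Q(3)[symmetric] pq(4) using a b by (simp add: D_def)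
    qed
    moreover have "(1 - \<epsilon>) * real (k i) \<le> real (card (S \<inter> G i))" if i: "i < m" for i
    proof -
      have "{..<n} \<inter> {j. P j \<and> g j = i} = {j. j < n \<and> xs ! j \<in> S \<and> g j = i}"
      proof -
        have "P j \<longleftrightarrow> xs ! j \<in> S" if "j < n" for j
          using that xs(1) unfolding S n_def by (auto simp: nth_eq_iff_index_eq)
        then show ?thesis by auto
      qed
      then have "(\<Sum>j<n. of_bool (P j \<and> g j = i)) = real (card (S \<inter> G i))"
        using card_idx[OF i, of S] by simp
      then show ?thesis using covers i unfolding covers_def k'_def by auto
    qed
    ultimately show ?thesis by blast
  qed
  then show "opt_diversity X d m G k / 6 \<le> diversity d S"
    "\<forall>i<m. (1 - \<epsilon>) * real (k i) \<le> real (card (S \<inter> G i))" by blast+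
qed

theorem theorem1:
  "\<exists>(P :: com) (C :: nat) (c :: nat).
     \<forall>(X :: 'a set) d m G k \<epsilon> \<delta> xs.
       0 < \<epsilon> \<and> \<epsilon> < 1 \<and> 0 < \<delta> \<and> \<delta> < 1 \<and>
       fair_instance X d m G k \<and>
       (\<forall>i<m. real (k i) \<ge> 3 / \<epsilon>^2 * ln (2 * real m)) \<and>
       distinct xs \<and> set xs = X \<longrightarrow>
       (\<exists>t. real t \<le> real C * (real (card X) + real (\<Sum>i<m. k i) + 1 / \<delta>) ^ c \<and>
            halts_within t P (input_state xs d m G k \<epsilon> \<delta>) \<and>
            (\<forall>S \<in> set_pmf (output_pmf t P xs (input_state xs d m G k \<epsilon> \<delta>)).
               S \<subseteq> X \<and> diversity d S \<ge> opt_diversity X d m G k / 6) \<and>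
            measure_pmf.prob (output_pmf t P xs (input_state xs d m G k \<epsilon> \<delta>))
              {S. \<forall>i<m. real (card (S \<inter> G i)) \<ge> (1 - \<epsilon>) * real (k i)} \<ge> 1 - \<delta>)"
proof -
  obtain C c where time: "\<And>s :: state. \<exists>t \<le> C * (nats s ''n'' 0 + 1) ^ c.
      steps t (compile main_prog) s SKIP (den main_prog s)"
    using compile_correct[OF wf_main] by blast
  show ?thesis
  proof (rule exI[of _ "compile main_prog"], rule exI[of _ C], rule exI[of _ c], intro allI impI, elim conjE)
    fix X :: "'a set" and d m G k and \<epsilon> \<delta> :: real and xs
    assume eps: "0 < \<epsilon>" "\<epsilon> < 1" and delta: "0 < \<delta>" "\<delta> < 1" and inst: "fair_instance X d m G k"
      and k_ge: "\<forall>i<m. real (k i) \<ge> 3 / \<epsilon>^2 * ln (2 * real m)" and xs: "distinct xs" "set xs = X"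
    let ?s = "input_state xs d m G k \<epsilon> \<delta>"
    let ?S = "output_set xs (den main_prog ?s)"
    have n: "nats ?s ''n'' 0 = card X"
      using distinct_card[OF xs(1)] xs(2) by (simp add: input_state_def Let_def)
    obtain t where t: "t \<le> C * (card X + 1) ^ c" "steps t (compile main_prog) ?s SKIP (den main_prog ?s)"
      using time[of ?s] unfolding n by blast
    have run: "run t (compile main_prog, ?s) = return_pmf (SKIP, den main_prog ?s)"
      using steps_run[OF t(2)] .
    have out: "output_pmf t (compile main_prog) xs ?s = return_pmf ?S"
      unfolding output_pmf_def run by simp
    have "real t \<le> real (C * (card X + 1) ^ c)" using t(1) by (rule of_nat_mono)
    also have "\<dots> = real C * (real (card X) + 1) ^ c" by (simp add: add.commute)
    \<comment> \<open>The summand 1 / \<delta> is at least 1 and absorbs the 1 in the base.\<close>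
    also have "\<dots> \<le> real C * (real (card X) + real (\<Sum>i<m. k i) + 1 / \<delta>) ^ c"
    proof -
      have "1 \<le> 1 / \<delta>" using delta by simp
      moreover have "0 \<le> real (\<Sum>i<m. k i)" by (rule of_nat_0_le_iff)
      ultimately have "real (card X) + 1 \<le> real (card X) + real (\<Sum>i<m. k i) + 1 / \<delta>" by linarith
      then show ?thesis by (intro mult_left_mono power_mono) auto
    qed
    finally have bound: "real t \<le> real C * (real (card X) + real (\<Sum>i<m. k i) + 1 / \<delta>) ^ c" .
    note S = main_prog_output[OF eps inst k_ge xs, of \<delta>]
    show "\<exists>t. real t \<le> real C * (real (card X) + real (\<Sum>i<m. k i) + 1 / \<delta>) ^ c \<and>
            halts_within t (compile main_prog) ?s \<and>
            (\<forall>S \<in> set_pmf (output_pmf t (compile main_prog) xs ?s).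
               S \<subseteq> X \<and> diversity d S \<ge> opt_diversity X d m G k / 6) \<and>
            measure_pmf.prob (output_pmf t (compile main_prog) xs ?s)
              {S. \<forall>i<m. real (card (S \<inter> G i)) \<ge> (1 - \<epsilon>) * real (k i)} \<ge> 1 - \<delta>"
    proof (intro exI[of _ t] conjI)
      show "halts_within t (compile main_prog) ?s" by (simp add: halts_within_def run)
      show "\<forall>S \<in> set_pmf (output_pmf t (compile main_prog) xs ?s).
          S \<subseteq> X \<and> diversity d S \<ge> opt_diversity X d m G k / 6"
        unfolding out using S(1,2) by simp
      \<comment> \<open>The output distribution is a point mass at a good set, so the probability is
        1.\<close>
      show "measure_pmf.prob (output_pmf t (compile main_prog) xs ?s)
          {S. \<forall>i<m. real (card (S \<inter> G i)) \<ge> (1 - \<epsilon>) * real (k i)} \<ge> 1 - \<delta>"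
        unfolding out using S(3) delta by (simp add: measure_return_pmf indicator_def)
    qed (fact bound)
  qed
qed

end
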